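(* Let $W=(W_{s,t};(s,t)\in[0,1]^2)$ be an $\mathbb{R}^d$-valued Brownian sheet and let $b:[0,1]^2\times\mathbb{R}^d\to\mathbb{R}$ be a bounded Borel measurable function such that $\Vert b\Vert_\infty\le1$. Then there exist positive constants $\alpha$ and $C$ such that for every $(a,\varepsilon)\in[0,1]\times(0,1)$ with $a+\varepsilon\le1$ and every $(s,s',x,x')\in\,]0,1]^2\times\mathbb{R}^{2d}$ with $s\le s'$ and $(s,x)\ne(s',x')$, $$\mathbb{E}\left[\exp\left(\frac{\alpha\sqrt{\varepsilon s}}{|x'-x|+\sqrt{s'-s}}\left|\int_0^1\left\{b(s,t,x'+W^{\varepsilon}_{s',t})-b(s,t,x+W^{\varepsilon}_{s,t})\right\}\mathrm{d}t\right|\right)\right]\le C .$$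
   Context: A one-dimensional Brownian sheet is a centered continuous Gaussian process with covariance $(s\wedge s')(t\wedge t')$; an $\mathbb{R}^d$-valued Brownian sheet has independent one-dimensional Brownian sheets as components. $|\cdot|$ is the maximum norm on $\mathbb{R}^d$. For given $(a,\varepsilon)$, $W^{\varepsilon}_{s,t}:=W_{s,a+\varepsilon t}$ for $(s,t)\in[0,1]^2$. *)

theory Defs
  imports "HOL-Probability.Probability"
begin

(* Point masses count as Gaussian: a Brownian sheet vanishes on the coordinate axes. *)
definition gaussian_rv :: "'a measure \<Rightarrow> ('a \<Rightarrow> real) \<Rightarrow> bool" where
  "gaussian_rv M X \<longleftrightarrow>
     X \<in> borel_measurable M \<and>
     ((\<exists>\<mu> \<sigma>. \<sigma> > 0 \<and> distributed M lborel X (normal_density \<mu> \<sigma>)) \<or>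
      (\<exists>\<mu>. AE \<omega> in M. X \<omega> = \<mu>))"

definition gaussian_process :: "'a measure \<Rightarrow> 'i set \<Rightarrow> ('i \<Rightarrow> 'a \<Rightarrow> real) \<Rightarrow> bool" where
  "gaussian_process M T X \<longleftrightarrow>
     (\<forall>F c. finite F \<and> F \<subseteq> T \<longrightarrow> gaussian_rv M (\<lambda>\<omega>. \<Sum>i\<in>F. c i * X i \<omega>))"

definition covariance :: "'a measure \<Rightarrow> ('a \<Rightarrow> real) \<Rightarrow> ('a \<Rightarrow> real) \<Rightarrow> real" where
  "covariance M X Y =
     prob_space.expectation M
       (\<lambda>\<omega>. (X \<omega> - prob_space.expectation M X) * (Y \<omega> - prob_space.expectation M Y))"

abbreviation unit_square :: "(real \<times> real) set" where
  "unit_square \<equiv> {0..1} \<times> {0..1}"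

(* Processes are total functions on real \<times> real; only their values on the unit square matter. *)
definition real_brownian_sheet :: "'a measure \<Rightarrow> (real \<times> real \<Rightarrow> 'a \<Rightarrow> real) \<Rightarrow> bool" where
  "real_brownian_sheet M X \<longleftrightarrow>
     gaussian_process M unit_square X \<and>
     (\<forall>p\<in>unit_square. prob_space.expectation M (X p) = 0) \<and>
     (\<forall>\<omega>\<in>space M. continuous_on unit_square (\<lambda>p. X p \<omega>)) \<and>
     (\<forall>s\<in>{0..1}. \<forall>t\<in>{0..1}. \<forall>s'\<in>{0..1}. \<forall>t'\<in>{0..1}.
        covariance M (X (s, t)) (X (s', t')) = min s s' * min t t')"

(* Independence of the components is independence as processes, that is, as random elements
   of the product space indexed by the unit square. *)
definition brownian_sheet ::
  "'a measure \<Rightarrow> (real \<times> real \<Rightarrow> 'a \<Rightarrow> real ^ 'd) \<Rightarrow> bool" where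
  "brownian_sheet M W \<longleftrightarrow>
     (\<forall>i. real_brownian_sheet M (\<lambda>p \<omega>. W p \<omega> $ i)) \<and>
     prob_space.indep_vars M
       (\<lambda>i. PiM unit_square (\<lambda>p. borel))
       (\<lambda>i \<omega>. \<lambda>p\<in>unit_square. W p \<omega> $ i)
       (UNIV :: 'd set)"

definition rescaled_sheet ::
  "(real \<times> real \<Rightarrow> 'a \<Rightarrow> real ^ 'd) \<Rightarrow> real \<Rightarrow> real \<Rightarrow> real \<Rightarrow> real \<Rightarrow> 'a \<Rightarrow> real ^ 'd" where
  "rescaled_sheet W a \<epsilon> s t \<omega> = W (s, a + \<epsilon> * t) \<omega>"

end

theory Submission
  imports Defs
begin

text \<open>
  Why the estimate holds. For fixed \<open>s\<close> the coefficient is a bounded measurable function \<open>f (t, \<cdot>)\<close>, the process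
  \<open>t \<mapsto> W (s, a + \<epsilon> t)\<close> is a Brownian motion \<open>B\<close> with variance rate \<open>\<epsilon> s\<close>, and \<open>W (s', \<cdot>) - W (s, \<cdot>)\<close> is
  independent of it. So the claim concerns \<open>f (t, B + y) - f (t, B)\<close>, where the shift \<open>y\<close> is independent of \<open>B\<close> and has
  size \<open>\<bar>x' - x\<bar> + sqrt (s' - s)\<close> up to a factor with Gaussian tails. This difference is the divergence of the
  field \<open>F y\<close>, where \<open>F\<close> is the mean of \<open>f\<close> over the segment from \<open>B\<close> to \<open>B + y\<close>. The time integral of a
  divergence along a Brownian path is the difference of a backward and a forward stochastic integral of the field
  itself, divided by \<open>\<epsilon> s\<close>. The forward integral is a martingale with sub-Gaussian increments; so is the backward
  one after time reversal, up to the drift \<open>F y B / (t + a / \<epsilon>)\<close>, which has exponential moments for a small factor in the exponent,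
  because \<open>1 / sqrt t\<close> is integrable at the origin.

  The proof carries this out on finite grids, where no stochastic integral and no regularity of \<open>f\<close> are
  needed. An integral over the unit interval equals the average of its Riemann sums over all shifts of a grid
  (\<open>integral_eq_average\<close>), so by Jensen it suffices to bound exponential moments of the Riemann sums for one
  grid that is fine enough. The identity between divergence and stochastic integrals becomes Gaussian
  integration by parts over one step (\<open>gauss_shift_by_parts\<close>), and the two integrals become martingale transforms, bounded by
  a product supermartingale (\<open>supermartingale_product\<close>) in \<open>exp_moment_shift_differences\<close>. The remaining
  compensators and the drift are integrated in \<open>hybrid_exp_moment_le\<close>. The coordinates are shifted one
  after the other, so that only one-dimensional Gaussian densities occur.

  The independence that the martingale arguments use is derived from vanishing covariances
  (\<open>gaussian_space_indep_event\<close>), by induction from the uniqueness theorem for characteristic functions on the line.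
\<close>

section \<open>Exponential integrals of Gaussian variables\<close>

text \<open>
  The centred Gaussian law with standard deviation \<open>\<sigma>\<close>, as a measure on the reals.
\<close>

abbreviation gauss :: "real \<Rightarrow> real measure" where
  "gauss \<sigma> \<equiv> density lborel (\<lambda>x. ennreal (normal_density 0 \<sigma> x))"

lemma gauss_exp_linear:
  assumes "\<sigma> > 0"
  shows "(\<integral>\<^sup>+x. ennreal (exp (c * x)) \<partial>gauss \<sigma>) = ennreal (exp (c\<^sup>2 * \<sigma>\<^sup>2 / 2))"
proof -
  have pt: "normal_density 0 \<sigma> x * exp (c * x) = exp (c\<^sup>2 * \<sigma>\<^sup>2 / 2) * normal_density (c * \<sigma>\<^sup>2) \<sigma> x" for x
  proof -
    have "- (x - 0)\<^sup>2 / (2 * \<sigma>\<^sup>2) + c * x = c\<^sup>2 * \<sigma>\<^sup>2 / 2 + - (x - c * \<sigma>\<^sup>2)\<^sup>2 / (2 * \<sigma>\<^sup>2)"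
      using assms by (simp add: field_simps power2_eq_square)
    then show ?thesis
      by (simp add: normal_density_def exp_add [symmetric] mult.assoc mult.left_commute)
  qed
  have "(\<integral>\<^sup>+x. ennreal (exp (c * x)) \<partial>gauss \<sigma>)
      = (\<integral>\<^sup>+x. ennreal (exp (c\<^sup>2 * \<sigma>\<^sup>2 / 2)) * ennreal (normal_density (c * \<sigma>\<^sup>2) \<sigma> x) \<partial>lborel)"
    by (subst nn_integral_density) (simp_all add: ennreal_mult' [symmetric] pt)
  also have "\<dots> = ennreal (exp (c\<^sup>2 * \<sigma>\<^sup>2 / 2)) * (\<integral>\<^sup>+x. ennreal (normal_density (c * \<sigma>\<^sup>2) \<sigma> x) \<partial>lborel)"
    by (rule nn_integral_cmult) simp
  also have "(\<integral>\<^sup>+x. ennreal (normal_density (c * \<sigma>\<^sup>2) \<sigma> x) \<partial>lborel) = 1"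
    using prob_space.emeasure_space_1[OF prob_space_normal_density[OF assms, of "c * \<sigma>\<^sup>2"]]
    by (simp add: emeasure_density)
  finally show ?thesis by simp
qed

lemma gauss_exp_square:
  assumes "\<sigma> > 0" "2 * a * \<sigma>\<^sup>2 < 1"
  shows "(\<integral>\<^sup>+x. ennreal (exp (a * x\<^sup>2)) \<partial>gauss \<sigma>) = ennreal (1 / sqrt (1 - 2 * a * \<sigma>\<^sup>2))"
proof -
  define r where "r = 1 - 2 * a * \<sigma>\<^sup>2"
  define \<tau> where "\<tau> = \<sigma> / sqrt r"
  have r: "r > 0" using assms by (simp add: r_def)
  have \<tau>: "\<tau> > 0" using r assms by (simp add: \<tau>_def)
  have \<tau>2: "\<tau>\<^sup>2 = \<sigma>\<^sup>2 / r" using r by (simp add: \<tau>_def power_divide)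
  have pt: "normal_density 0 \<sigma> x * exp (a * x\<^sup>2) = 1 / sqrt r * normal_density 0 \<tau> x" for x
  proof -
    have "- (x - 0)\<^sup>2 / (2 * \<sigma>\<^sup>2) + a * x\<^sup>2 = - (x - 0)\<^sup>2 / (2 * \<tau>\<^sup>2)"
      using assms r unfolding \<tau>2 by (simp add: field_simps r_def)
    moreover have "1 / sqrt (2 * pi * \<sigma>\<^sup>2) = 1 / sqrt r * (1 / sqrt (2 * pi * \<tau>\<^sup>2))"
      using r assms unfolding \<tau>2 by (simp add: real_sqrt_mult real_sqrt_divide)
    ultimately show ?thesis
      by (simp add: normal_density_def exp_add [symmetric] mult.assoc)
  qed
  have "(\<integral>\<^sup>+x. ennreal (exp (a * x\<^sup>2)) \<partial>gauss \<sigma>)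
      = (\<integral>\<^sup>+x. ennreal (1 / sqrt r) * ennreal (normal_density 0 \<tau> x) \<partial>lborel)"
    using r by (subst nn_integral_density) (simp_all add: ennreal_mult' [symmetric] pt)
  also have "\<dots> = ennreal (1 / sqrt r) * (\<integral>\<^sup>+x. ennreal (normal_density 0 \<tau> x) \<partial>lborel)"
    by (rule nn_integral_cmult) simp
  also have "(\<integral>\<^sup>+x. ennreal (normal_density 0 \<tau> x) \<partial>lborel) = 1"
    using prob_space.emeasure_space_1[OF prob_space_normal_density[OF \<tau>, of 0]]
    by (simp add: emeasure_density)
  finally show ?thesis by (simp add: r_def)
qed

lemma exp_le_add_exp_square: "exp x \<le> x + exp (x\<^sup>2)" for x :: real
proof (cases "x \<ge> 1")
  case True
  then have "x \<le> x\<^sup>2" by (simp add: power2_eq_square)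
  then have "exp x \<le> exp (x\<^sup>2)" by simp
  then show ?thesis using True by linarith
next
  case False
  have "exp x \<le> 1 + x + x\<^sup>2"
  proof (cases "x \<ge> 0")
    case True
    then show ?thesis using exp_bound[of x] False by simp
  next
    case neg: False
    have "exp x * (1 - x) \<le> exp x * exp (- x)"
      using exp_ge_add_one_self[of "- x"] by (intro mult_left_mono) auto
    also have "\<dots> = 1" by (simp add: exp_minus)
    also have "1 \<le> 1 - x ^ 3" using neg by (simp add: power_le_zero_eq)
    also have "\<dots> = (1 + x + x\<^sup>2) * (1 - x)" by (simp add: algebra_simps power2_eq_square power3_eq_cube)
    finally show ?thesis using neg by (simp add: mult_le_cancel_right)
  qed
  also have "\<dots> \<le> x + exp (x\<^sup>2)" using exp_ge_add_one_self[of "x\<^sup>2"] by linarith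
  finally show ?thesis .
qed

lemma exp_add_le_sum: "exp (x + y :: real) \<le> (exp (2 * x) + exp (2 * y)) / 2"
proof -
  have "0 \<le> (exp x - exp y)\<^sup>2" by simp
  then show ?thesis
    unfolding exp_double exp_add power2_diff by (simp add: algebra_simps)
qed

lemma inverse_sqrt_le_exp:
  assumes "0 \<le> x" "x \<le> 1/2"
  shows "1 / sqrt (1 - x) \<le> exp (x :: real)"
proof -
  have "0 \<le> x * (1 - 2 * x)" using assms by simp
  then have "1 \<le> (1 + 2 * x) * (1 - x)" by (simp add: algebra_simps)
  also have "\<dots> \<le> exp (2 * x) * (1 - x)"
    using assms exp_ge_add_one_self[of "2 * x"] by (intro mult_right_mono) auto
  also have "\<dots> = (exp x)\<^sup>2 * (1 - x)" by (simp add: exp_double)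
  finally have "1 \<le> sqrt ((exp x)\<^sup>2 * (1 - x))" by simp
  also have "\<dots> = exp x * sqrt (1 - x)" by (simp add: real_sqrt_mult)
  finally show ?thesis using assms by (simp add: field_simps)
qed

text \<open>
  A centred function of a Gaussian variable that grows at most linearly is sub-Gaussian, with a
  variance proxy of the order of the squared growth constants. Centring is essential: it removes
  the first-order term, so that the bound is \<open>1 + O(p\<^sup>2 + q\<^sup>2 \<sigma>\<^sup>2)\<close> for small constants.
\<close>

lemma gauss_centered_exp:
  assumes \<sigma>: "\<sigma> > 0"
    and [measurable]: "h \<in> borel_measurable borel"
    and mean: "(LINT z|gauss \<sigma>. h z) = 0"
    and bound: "\<And>z. \<bar>h z\<bar> \<le> p + q * \<bar>z\<bar>"
    and p: "p \<ge> 0" and q: "q \<ge> 0"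
  shows "(\<integral>\<^sup>+z. ennreal (exp (h z)) \<partial>gauss \<sigma>) \<le> ennreal (exp (9 * (p\<^sup>2 + q\<^sup>2 * \<sigma>\<^sup>2)))"
proof (cases "q\<^sup>2 * \<sigma>\<^sup>2 \<le> 1/8")
  case True
  interpret G: prob_space "gauss \<sigma>" using \<sigma> by (rule prob_space_normal_density)
  have int_id: "integrable (gauss \<sigma>) (\<lambda>z. \<bar>z\<bar>)"
    using integrable_normal_moment_abs[OF \<sigma>, of 0 1] by (simp add: integrable_density)
  have int_h: "integrable (gauss \<sigma>) h"
    by (rule Bochner_Integration.integrable_bound[of _ "\<lambda>z. p + q * \<bar>z\<bar>"])
       (use int_id bound p q in \<open>auto intro!: AE_I2 order_trans[OF bound]\<close>)
  have nn: "(\<integral>\<^sup>+z. ennreal (exp ((h z)\<^sup>2)) \<partial>gauss \<sigma>) \<le> ennreal (exp (9 * (p\<^sup>2 + q\<^sup>2 * \<sigma>\<^sup>2)))"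
  proof -
    have "(h z)\<^sup>2 \<le> 2 * p\<^sup>2 + 2 * q\<^sup>2 * z\<^sup>2" for z
    proof -
      have "(h z)\<^sup>2 = \<bar>h z\<bar>\<^sup>2" by simp
      also have "\<dots> \<le> (p + q * \<bar>z\<bar>)\<^sup>2" by (rule power_mono[OF bound]) simp
      also have "\<dots> \<le> 2 * p\<^sup>2 + 2 * (q * \<bar>z\<bar>)\<^sup>2"
        using zero_le_power2[of "p - q * \<bar>z\<bar>"] by (simp add: power2_diff power2_sum)
      finally show ?thesis by (simp add: power_mult_distrib)
    qed
    then have "(\<integral>\<^sup>+z. ennreal (exp ((h z)\<^sup>2)) \<partial>gauss \<sigma>)
        \<le> (\<integral>\<^sup>+z. ennreal (exp (2 * p\<^sup>2)) * ennreal (exp (2 * q\<^sup>2 * z\<^sup>2)) \<partial>gauss \<sigma>)"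
      by (intro nn_integral_mono) (simp add: ennreal_mult' [symmetric] exp_add [symmetric])
    also have "\<dots> = ennreal (exp (2 * p\<^sup>2)) * (\<integral>\<^sup>+z. ennreal (exp (2 * q\<^sup>2 * z\<^sup>2)) \<partial>gauss \<sigma>)"
      by (rule nn_integral_cmult) simp
    also have "(\<integral>\<^sup>+z. ennreal (exp (2 * q\<^sup>2 * z\<^sup>2)) \<partial>gauss \<sigma>) = ennreal (1 / sqrt (1 - 4 * (q\<^sup>2 * \<sigma>\<^sup>2)))"
      using gauss_exp_square[OF \<sigma>, of "2 * q\<^sup>2"] True by (simp add: mult.assoc)
    also have "ennreal (exp (2 * p\<^sup>2)) * \<dots> \<le> ennreal (exp (2 * p\<^sup>2)) * ennreal (exp (4 * (q\<^sup>2 * \<sigma>\<^sup>2)))"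
      using inverse_sqrt_le_exp[of "4 * (q\<^sup>2 * \<sigma>\<^sup>2)"] True by (intro mult_left_mono ennreal_leI) auto
    also have "\<dots> \<le> ennreal (exp (9 * (p\<^sup>2 + q\<^sup>2 * \<sigma>\<^sup>2)))"
      by (simp add: ennreal_mult' [symmetric] exp_add [symmetric] algebra_simps add_mono mult_right_mono)
    finally show ?thesis .
  qed
  have int_sq: "integrable (gauss \<sigma>) (\<lambda>z. exp ((h z)\<^sup>2))"
    by (rule integrableI_nonneg) (use le_less_trans[OF nn] in auto)
  have int_exp: "integrable (gauss \<sigma>) (\<lambda>z. exp (h z))"
    by (rule Bochner_Integration.integrable_bound[of _ "\<lambda>z. h z + exp ((h z)\<^sup>2)"])
       (use int_h int_sq exp_le_add_exp_square in \<open>auto intro!: AE_I2 order_trans[OF exp_le_add_exp_square]\<close>)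
  have "(\<integral>\<^sup>+z. ennreal (exp (h z)) \<partial>gauss \<sigma>) = ennreal (LINT z|gauss \<sigma>. exp (h z))"
    by (rule nn_integral_eq_integral[OF int_exp]) simp
  also have "(LINT z|gauss \<sigma>. exp (h z)) \<le> (LINT z|gauss \<sigma>. h z + exp ((h z)\<^sup>2))"
    using int_exp int_h int_sq by (intro integral_mono) (auto intro: exp_le_add_exp_square)
  also have "\<dots> = (LINT z|gauss \<sigma>. exp ((h z)\<^sup>2))"
    using int_h int_sq mean by simp
  also have "ennreal (LINT z|gauss \<sigma>. exp ((h z)\<^sup>2)) = (\<integral>\<^sup>+z. ennreal (exp ((h z)\<^sup>2)) \<partial>gauss \<sigma>)"
    by (rule nn_integral_eq_integral[OF int_sq, symmetric]) simp
  also note nn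
  finally show ?thesis by (simp add: ennreal_leI)
next
  case False
  have "exp (h z) \<le> exp p * (exp (q * z) + exp (- q * z))" for z
  proof -
    have "exp (h z) \<le> exp p * exp (q * \<bar>z\<bar>)" using bound[of z] by (simp add: exp_add [symmetric])
    also have "exp (q * \<bar>z\<bar>) \<le> exp (q * z) + exp (- q * z)" by (cases "z \<ge> 0") auto
    finally show ?thesis by simp
  qed
  then have "(\<integral>\<^sup>+z. ennreal (exp (h z)) \<partial>gauss \<sigma>)
      \<le> (\<integral>\<^sup>+z. ennreal (exp p) * (ennreal (exp (q * z)) + ennreal (exp (- q * z))) \<partial>gauss \<sigma>)"
    by (intro nn_integral_mono) (simp add: ennreal_mult' [symmetric] ennreal_plus [symmetric] del: ennreal_plus)
  also have "\<dots> = ennreal (exp p) * ((\<integral>\<^sup>+z. ennreal (exp (q * z)) \<partial>gauss \<sigma>) + (\<integral>\<^sup>+z. ennreal (exp (- q * z)) \<partial>gauss \<sigma>))"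
    by (subst nn_integral_cmult, simp, subst nn_integral_add) simp_all
  also have "\<dots> = ennreal (exp p * (2 * exp (q\<^sup>2 * \<sigma>\<^sup>2 / 2)))"
    unfolding gauss_exp_linear[OF \<sigma>]
    by (simp add: ennreal_mult' [symmetric] ennreal_plus [symmetric] del: ennreal_plus)
  also have "\<dots> \<le> ennreal (exp (9 * (p\<^sup>2 + q\<^sup>2 * \<sigma>\<^sup>2)))"
  proof (rule ennreal_leI)
    have "p \<le> p\<^sup>2 + 1/4"
      using zero_le_power2[of "p - 1/2"] unfolding power2_diff by (simp add: power_divide)
    then have "p \<le> 9 * p\<^sup>2 + 1/4"
      using zero_le_power2[of p] by linarith
    moreover have "(2 :: real) \<le> exp (3/4)" using exp_lower_Taylor_quadratic[of "3/4 :: real"] by (simp add: power2_eq_square)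
    ultimately have "exp p * (2 * exp (q\<^sup>2 * \<sigma>\<^sup>2 / 2))
        \<le> exp (9 * p\<^sup>2 + 1/4) * (exp (3/4) * exp (q\<^sup>2 * \<sigma>\<^sup>2 / 2))"
      by (intro mult_mono) auto
    also have "\<dots> \<le> exp (9 * (p\<^sup>2 + q\<^sup>2 * \<sigma>\<^sup>2))"
      using False by (simp add: exp_add [symmetric])
    finally show "exp p * (2 * exp (q\<^sup>2 * \<sigma>\<^sup>2 / 2)) \<le> exp (9 * (p\<^sup>2 + q\<^sup>2 * \<sigma>\<^sup>2))" .
  qed
  finally show ?thesis .
qed

section \<open>Uncorrelated jointly Gaussian variables are independent\<close>

text \<open>
  Uniqueness for characteristic functions on the line, for the image under \<open>X\<close> of two finite measures
  that have bounded densities with respect to \<open>M\<close>. It is stated with real cosines; the phase \<open>\<theta>\<close> covers the sine.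
\<close>

lemma (in prob_space) weighted_law_unique:
  fixes X w w' :: "'a \<Rightarrow> real"
  assumes [measurable]: "X \<in> borel_measurable M" "w \<in> borel_measurable M" "w' \<in> borel_measurable M"
    and w: "\<And>\<omega>. 0 \<le> w \<omega>" "\<And>\<omega>. w \<omega> \<le> K" and w': "\<And>\<omega>. 0 \<le> w' \<omega>" "\<And>\<omega>. w' \<omega> \<le> K"
    and cos_eq: "\<And>t \<theta>. expectation (\<lambda>\<omega>. w \<omega> * cos (t * X \<omega> + \<theta>)) = expectation (\<lambda>\<omega>. w' \<omega> * cos (t * X \<omega> + \<theta>))"
    and A: "A \<in> sets borel"
  shows "expectation (\<lambda>\<omega>. w \<omega> * indicator A (X \<omega>)) = expectation (\<lambda>\<omega>. w' \<omega> * indicator A (X \<omega>))"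
proof -
  define c where "c = expectation w"
  have intw: "integrable M w" "integrable M w'"
    using w w' by (auto intro!: integrable_const_bound[of _ K])
  have c': "c = expectation w'" using cos_eq[of 0 0] by (simp add: c_def)
  have c0: "c \<ge> 0" unfolding c_def by (rule integral_nonneg_AE) (use w in auto)
  have A' [measurable]: "A \<in> sets borel" by fact
  show ?thesis
  proof (cases "c = 0")
    case True
    have "AE \<omega> in M. w \<omega> = 0" "AE \<omega> in M. w' \<omega> = 0"
      using integral_nonneg_eq_0_iff_AE[OF intw(1)] integral_nonneg_eq_0_iff_AE[OF intw(2)] w w' c' True
      by (auto simp: c_def)
    then have "expectation (\<lambda>\<omega>. w \<omega> * indicator A (X \<omega>)) = expectation (\<lambda>_. 0)"
         "expectation (\<lambda>\<omega>. w' \<omega> * indicator A (X \<omega>)) = expectation (\<lambda>_. 0)"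
      by (intro integral_cong_AE; force)+
    then show ?thesis by simp
  next
    case False
    then have c: "c > 0" using c0 by simp
    define D where "D v = distr (density M (\<lambda>\<omega>. ennreal (v \<omega> / c))) borel X" for v
    have rd: "real_distribution (D v)" and ch: "char (D v) t = Complex (expectation (\<lambda>\<omega>. v \<omega> * cos (t * X \<omega> + 0)) / c)
          (expectation (\<lambda>\<omega>. v \<omega> * cos (t * X \<omega> + - pi/2)) / c)"
      and ms: "measure (D v) A = expectation (\<lambda>\<omega>. v \<omega> * indicator A (X \<omega>)) / c"
      if [measurable]: "v \<in> borel_measurable M" and v0: "\<And>\<omega>. 0 \<le> v \<omega>" and vK: "\<And>\<omega>. v \<omega> \<le> K" and vc: "expectation v = c" for v t
    proof -
      have intv: "integrable M (\<lambda>\<omega>. v \<omega> * g \<omega>)" if [measurable]: "g \<in> borel_measurable M" and "\<And>\<omega>. \<bar>g \<omega>\<bar> \<le> 1" for g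
        by (rule integrable_const_bound[of _ K])
           (auto simp: abs_mult v0 intro!: AE_I2 order_trans[OF mult_left_mono[OF that(2)]] vK)
      have "emeasure (density M (\<lambda>\<omega>. ennreal (v \<omega> / c))) (space M) = (\<integral>\<^sup>+\<omega>. ennreal (v \<omega> / c) \<partial>M)"
        by (subst emeasure_density) (auto intro!: nn_integral_cong)
      also have "\<dots> = ennreal (expectation (\<lambda>\<omega>. v \<omega> / c))"
        using intv[of "\<lambda>_. 1"] v0 c by (intro nn_integral_eq_integral) auto
      finally have "prob_space (density M (\<lambda>\<omega>. ennreal (v \<omega> / c)))"
        using c vc by (intro prob_spaceI) simp
      then interpret E: prob_space "density M (\<lambda>\<omega>. ennreal (v \<omega> / c))" .
      interpret D: prob_space "D v" unfolding D_def by (rule E.prob_space_distr) simp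
      show "real_distribution (D v)"
        by (intro real_distribution.intro real_distribution_axioms.intro D.prob_space_axioms) (simp_all add: D_def)
      have re: "(LINT x|D v. g x) = expectation (\<lambda>\<omega>. v \<omega> * g (X \<omega>)) / c"
        if [measurable]: "g \<in> borel_measurable borel" for g :: "real \<Rightarrow> real"
        unfolding D_def using c v0
        by (subst integral_distr, simp, simp, subst integral_density) (auto simp: divide_inverse mult_ac)
      have int: "integrable (D v) (\<lambda>x. iexp (t * x))"
        by (intro D.integrable_const_bound[of _ 1]) (auto simp: D_def)
      have "char (D v) t = Complex (LINT x|D v. cos (t * x)) (LINT x|D v. sin (t * x))"
        unfolding char_def using int
        by (intro complex_eqI) (simp_all add: integral_Re [symmetric] integral_Im [symmetric] cis_conv_exp [symmetric] cos_exp_eq del: of_real_mult)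
      then show "char (D v) t = Complex (expectation (\<lambda>\<omega>. v \<omega> * cos (t * X \<omega> + 0)) / c)
          (expectation (\<lambda>\<omega>. v \<omega> * cos (t * X \<omega> + - pi/2)) / c)"
        by (simp add: re cos_diff)
      have "measure (D v) A = (LINT x|D v. indicator A x)"
        by (simp add: D_def)
      also have "\<dots> = expectation (\<lambda>\<omega>. v \<omega> * indicator A (X \<omega>)) / c"
        by (rule re) simp
      finally show "measure (D v) A = expectation (\<lambda>\<omega>. v \<omega> * indicator A (X \<omega>)) / c" .
    qed
    have "char (D w) = char (D w')"
      by (intro ext) (simp only: ch[OF assms(2) w c_def[symmetric]] ch[OF assms(3) w' c'[symmetric]] cos_eq)
    then have "D w = D w'"
      by (intro Levy_uniqueness rd w w') (simp_all add: c_def [symmetric] c' [symmetric])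
    then show ?thesis using ms[OF assms(2) w c_def[symmetric]] ms[OF assms(3) w' c'[symmetric]] c
      by simp
  qed
qed

text \<open>
  The multivariate version: two weighted joint laws of finitely many variables with the same
  characteristic function agree on boxes. The induction splits off one variable at a time and absorbs
  the others into the weight, the nonnegative factor \<open>1 + cos (L + \<theta>)\<close> for a linear combination
  \<open>L\<close> of the remaining variables; thus only the one-dimensional uniqueness theorem is needed.
\<close>

lemma (in prob_space) weighted_joint_law_unique:
  fixes V :: "'i \<Rightarrow> 'a \<Rightarrow> real" and w w' :: "'a \<Rightarrow> real"
  assumes "finite J"
    and "\<And>j. j \<in> J \<Longrightarrow> V j \<in> borel_measurable M"
    and "w \<in> borel_measurable M" "w' \<in> borel_measurable M"
    and "\<And>\<omega>. 0 \<le> w \<omega>" "\<And>\<omega>. w \<omega> \<le> K" and "\<And>\<omega>. 0 \<le> w' \<omega>" "\<And>\<omega>. w' \<omega> \<le> K"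
    and "\<And>t \<theta>. expectation (\<lambda>\<omega>. w \<omega> * cos ((\<Sum>j\<in>J. t j * V j \<omega>) + \<theta>))
       = expectation (\<lambda>\<omega>. w' \<omega> * cos ((\<Sum>j\<in>J. t j * V j \<omega>) + \<theta>))"
    and "\<And>j. j \<in> J \<Longrightarrow> C j \<in> sets borel"
  shows "expectation (\<lambda>\<omega>. w \<omega> * (\<Prod>j\<in>J. indicator (C j) (V j \<omega>)))
       = expectation (\<lambda>\<omega>. w' \<omega> * (\<Prod>j\<in>J. indicator (C j) (V j \<omega>)))"
  using assms
proof (induction J arbitrary: w w' K rule: finite_induct)
  case empty
  show ?case using empty(8)[of "\<lambda>_. 0" 0] by simp
next
  case (insert k J)
  let ?i = "\<lambda>\<omega>. indicator (C k) (V k \<omega>) :: real"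
  note [measurable] = insert.prems(2,3)
  have [measurable]: "V k \<in> borel_measurable M" "C k \<in> sets borel"
    using insert.prems(1,9) by auto
  have VJ: "(\<lambda>\<omega>. \<Sum>j\<in>J. t j * V j \<omega>) \<in> borel_measurable M" for t :: "'i \<Rightarrow> real"
    using insert.prems(1) by (intro borel_measurable_sum borel_measurable_times) auto
  have bnd: "integrable M (\<lambda>\<omega>. v \<omega> * g \<omega>)"
    if [measurable]: "v \<in> borel_measurable M" "g \<in> borel_measurable M" and "\<And>\<omega>. 0 \<le> v \<omega>" "\<And>\<omega>. v \<omega> \<le> K'" "\<And>\<omega>. \<bar>g \<omega>\<bar> \<le> 1"
    for v g :: "'a \<Rightarrow> real" and K'
    by (rule integrable_const_bound[of _ K'])
       (auto simp: abs_mult that intro!: AE_I2 order_trans[OF mult_left_mono[OF that(5)]] that)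
  have key: "expectation (\<lambda>\<omega>. w \<omega> * ?i \<omega> * cos ((\<Sum>j\<in>J. t j * V j \<omega>) + \<theta>))
       = expectation (\<lambda>\<omega>. w' \<omega> * ?i \<omega> * cos ((\<Sum>j\<in>J. t j * V j \<omega>) + \<theta>))" for t \<theta>
  proof -
    define L where "L \<omega> = (\<Sum>j\<in>J. t j * V j \<omega>)" for \<omega>
    have [measurable]: "L \<in> borel_measurable M" unfolding L_def by (rule VJ)
    have gen: "expectation (\<lambda>\<omega>. w \<omega> * cos (a * L \<omega> + r * V k \<omega> + \<phi>)) = expectation (\<lambda>\<omega>. w' \<omega> * cos (a * L \<omega> + r * V k \<omega> + \<phi>))" for a r \<phi>
    proof -
      have "(\<Sum>j\<in>insert k J. (if j = k then r else a * t j) * V j \<omega>) = a * L \<omega> + r * V k \<omega>" for \<omega>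
      proof -
        have "(\<Sum>j\<in>J. (if j = k then r else a * t j) * V j \<omega>) = (\<Sum>j\<in>J. a * (t j * V j \<omega>))"
          using insert.hyps by (intro sum.cong) auto
        then show ?thesis using insert.hyps by (simp add: L_def sum_distrib_left)
      qed
      then show ?thesis using insert.prems(8)[of "\<lambda>j. if j = k then r else a * t j" \<phi>] by simp
    qed
    have one: "expectation (\<lambda>\<omega>. w \<omega> * ?i \<omega>) = expectation (\<lambda>\<omega>. w' \<omega> * ?i \<omega>)"
      by (rule weighted_law_unique[where K = K]) (use insert.prems gen[of 0] in auto)
    let ?c = "\<lambda>\<omega>. 1 + cos (L \<omega> + \<theta>)"
    have prod: "v \<omega> * ?c \<omega> * cos (r * V k \<omega> + \<phi>) =
         v \<omega> * cos (0 * L \<omega> + r * V k \<omega> + \<phi>) + (v \<omega> * cos (1 * L \<omega> + r * V k \<omega> + (\<theta> + \<phi>))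
           + v \<omega> * cos (-1 * L \<omega> + r * V k \<omega> + (\<phi> - \<theta>))) / 2" for v :: "'a \<Rightarrow> real" and r \<phi> \<omega>
    proof -
      have "1 * L \<omega> + r * V k \<omega> + (\<theta> + \<phi>) = (L \<omega> + \<theta>) + (r * V k \<omega> + \<phi>)"
        "-1 * L \<omega> + r * V k \<omega> + (\<phi> - \<theta>) = (r * V k \<omega> + \<phi>) - (L \<omega> + \<theta>)" by auto
      then show ?thesis by (simp only: cos_add cos_diff) (simp add: field_simps)
    qed
    have E: "expectation (\<lambda>\<omega>. v \<omega> * ?c \<omega> * cos (r * V k \<omega> + \<phi>)) =
         expectation (\<lambda>\<omega>. v \<omega> * cos (0 * L \<omega> + r * V k \<omega> + \<phi>)) + (expectation (\<lambda>\<omega>. v \<omega> * cos (1 * L \<omega> + r * V k \<omega> + (\<theta> + \<phi>)))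
           + expectation (\<lambda>\<omega>. v \<omega> * cos (-1 * L \<omega> + r * V k \<omega> + (\<phi> - \<theta>)))) / 2"
      if [measurable]: "v \<in> borel_measurable M" and "\<And>\<omega>. 0 \<le> v \<omega>" "\<And>\<omega>. v \<omega> \<le> K" for v r \<phi>
    proof -
      have "integrable M (\<lambda>\<omega>. v \<omega> * cos (a * L \<omega> + r * V k \<omega> + \<psi>))" for a \<psi>
        using that by (intro bnd) auto
      from this[of 0 \<phi>] this[of 1 "\<theta> + \<phi>"] this[of "-1" "\<phi> - \<theta>"] show ?thesis
        unfolding prod by simp
    qed
    have two: "expectation (\<lambda>\<omega>. w \<omega> * ?c \<omega> * ?i \<omega>)
        = expectation (\<lambda>\<omega>. w' \<omega> * ?c \<omega> * ?i \<omega>)"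
    proof (rule weighted_law_unique[where K = "K * 2"])
      have c2: "0 \<le> 1 + cos (L \<omega> + \<theta>)" "1 + cos (L \<omega> + \<theta>) \<le> 2" for \<omega>
        using cos_ge_minus_one[of "L \<omega> + \<theta>"] cos_le_one[of "L \<omega> + \<theta>"] by linarith+
      show "0 \<le> w \<omega> * ?c \<omega>" "0 \<le> w' \<omega> * ?c \<omega>"
        "w \<omega> * ?c \<omega> \<le> K * 2" "w' \<omega> * ?c \<omega> \<le> K * 2" for \<omega>
        using insert.prems(4,5,6,7)[of \<omega>] c2[of \<omega>] by (auto intro!: mult_mono intro: order_trans)
      show "expectation (\<lambda>\<omega>. w \<omega> * ?c \<omega> * cos (r * V k \<omega> + \<phi>))
         = expectation (\<lambda>\<omega>. w' \<omega> * ?c \<omega> * cos (r * V k \<omega> + \<phi>))" for r \<phi>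
        unfolding E[OF insert.prems(2,4,5)] E[OF insert.prems(3,6,7)] by (simp only: gen)
    qed (use insert.prems(2,3) in measurable)
    have split: "expectation (\<lambda>\<omega>. v \<omega> * ?c \<omega> * ?i \<omega>)
        = expectation (\<lambda>\<omega>. v \<omega> * ?i \<omega>) + expectation (\<lambda>\<omega>. v \<omega> * ?i \<omega> * cos (L \<omega> + \<theta>))"
      if [measurable]: "v \<in> borel_measurable M" and "\<And>\<omega>. 0 \<le> v \<omega>" "\<And>\<omega>. v \<omega> \<le> K" for v
    proof -
      have "integrable M (\<lambda>\<omega>. v \<omega> * (?i \<omega> * cos (L \<omega> + \<theta>)))"
        "integrable M (\<lambda>\<omega>. v \<omega> * ?i \<omega>)"
        using that by (auto intro!: bnd split: split_indicator)
      then show ?thesis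
        by (subst Bochner_Integration.integral_add [symmetric]) (auto simp: algebra_simps)
    qed
    show ?thesis using one two split[OF insert.prems(2,4,5)] split[OF insert.prems(3,6,7)]
      unfolding L_def by simp
  qed
  have K0: "0 \<le> K" using insert.prems(4,5) order_trans by blast
  have "expectation (\<lambda>\<omega>. w \<omega> * ?i \<omega> * (\<Prod>j\<in>J. indicator (C j) (V j \<omega>)))
       = expectation (\<lambda>\<omega>. w' \<omega> * ?i \<omega> * (\<Prod>j\<in>J. indicator (C j) (V j \<omega>)))"
    by (rule insert.IH)
       (use insert.prems key K0 in \<open>auto split: split_indicator\<close>)
  then show ?case using insert.hyps by (simp add: mult.assoc)
qed

text \<open>
  A centred Gaussian variable is determined by its variance; the degenerate case is kept apart.
\<close>

lemma (in prob_space) gaussian_rv_centered_cases: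
  assumes g: "gaussian_rv M X" and m: "expectation X = 0"
  obtains (degenerate) "AE \<omega> in M. X \<omega> = 0" "expectation (\<lambda>\<omega>. (X \<omega>)\<^sup>2) = 0" "integrable M (\<lambda>\<omega>. (X \<omega>)\<^sup>2)"
    | (normal) \<sigma> where "\<sigma> > 0" "distr M borel X = gauss \<sigma>" "expectation (\<lambda>\<omega>. (X \<omega>)\<^sup>2) = \<sigma>\<^sup>2" "integrable M (\<lambda>\<omega>. (X \<omega>)\<^sup>2)"
proof -
  have [measurable]: "X \<in> borel_measurable M" using g by (simp add: gaussian_rv_def)
  consider \<mu> \<sigma> where "\<sigma> > 0" "distributed M lborel X (normal_density \<mu> \<sigma>)" | \<mu> where "AE \<omega> in M. X \<omega> = \<mu>"
    using g by (auto simp: gaussian_rv_def)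
  then show thesis
  proof cases
    case 1
    have "expectation X = \<mu>" using 1 by (intro normal_distributed_expectation) auto
    then have \<mu>: "\<mu> = 0" using m by simp
    have D: "distr M borel X = gauss \<sigma>"
      using distributed_distr_eq_density[OF 1(2)] unfolding \<mu>
      by (metis distr_cong sets_lborel)
    have "variance X = \<sigma>\<^sup>2" using 1 by (intro normal_distributed_variance) auto
    then have v: "expectation (\<lambda>\<omega>. (X \<omega>)\<^sup>2) = \<sigma>\<^sup>2" using m by simp
    have "integrable lborel (\<lambda>x. normal_density 0 \<sigma> x * x\<^sup>2)"
      using integrable_normal_moment[OF \<open>\<sigma> > 0\<close>, of 0 2] by simp
    then have "integrable (distr M borel X) (\<lambda>x. x\<^sup>2)"
      unfolding D by (subst integrable_density) auto
    then have "integrable M (\<lambda>\<omega>. (X \<omega>)\<^sup>2)"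
      by (subst (asm) integrable_distr_eq) auto
    with 1 D v show thesis by (intro normal)
  next
    case 2
    have "expectation X = expectation (\<lambda>_. \<mu>)"
      using 2 by (intro integral_cong_AE) auto
    then have \<mu>: "\<mu> = 0" using m by (simp add: prob_space)
    have "expectation (\<lambda>\<omega>. (X \<omega>)\<^sup>2) = expectation (\<lambda>_. 0)"
      using 2 \<mu> by (intro integral_cong_AE) auto
    moreover have "integrable M (\<lambda>\<omega>. (X \<omega>)\<^sup>2)"
      using 2 \<mu> by (subst integrable_cong_AE[of _ _ "\<lambda>_. 0"]) auto
    ultimately show thesis using 2 \<mu> by (intro degenerate) auto
  qed
qed

lemma cos_gauss:
  assumes "\<sigma> > 0"
  shows "(LINT x|gauss \<sigma>. cos (x + \<theta>)) = exp (- \<sigma>\<^sup>2 / 2) * cos \<theta>"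
proof -
  interpret N: prob_space std_normal_distribution by (rule prob_space_normal_density) simp
  have "distributed std_normal_distribution lborel (\<lambda>x. x) std_normal_density"
    unfolding distributed_def by (auto simp: distr_id2)
  then have "distributed std_normal_distribution lborel (\<lambda>x. 0 + \<sigma> * x) (normal_density (0 + \<sigma> * 0) (\<bar>\<sigma>\<bar> * 1))"
    using assms by (intro N.normal_density_affine) auto
  then have g: "gauss \<sigma> = distr std_normal_distribution lborel (\<lambda>x. \<sigma> * x)"
    using assms distributed_distr_eq_density by fastforce
  have int: "integrable std_normal_distribution (\<lambda>x. iexp (\<sigma> * x))"
    by (intro N.integrable_const_bound[of _ 1]) auto
  have ch: "(CLINT x|std_normal_distribution. iexp (\<sigma> * x)) = complex_of_real (exp (- \<sigma>\<^sup>2 / 2))"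
    using char_std_normal_distribution unfolding char_def fun_eq_iff by simp
  have "(LINT x|std_normal_distribution. cos (\<sigma> * x)) = Re (CLINT x|std_normal_distribution. iexp (\<sigma> * x))"
    by (subst integral_Re [OF int, symmetric]) (simp add: Re_exp)
  then have "(LINT x|std_normal_distribution. cos (\<sigma> * x)) = exp (- \<sigma>\<^sup>2 / 2)"
    unfolding ch by (simp only: Re_complex_of_real)
  moreover have "(LINT x|std_normal_distribution. sin (\<sigma> * x)) = Im (CLINT x|std_normal_distribution. iexp (\<sigma> * x))"
    by (subst integral_Im [OF int, symmetric]) (simp add: Im_exp)
  then have "(LINT x|std_normal_distribution. sin (\<sigma> * x)) = 0"
    unfolding ch by (simp only: Im_complex_of_real)
  moreover have "integrable std_normal_distribution (\<lambda>x. cos (\<sigma> * x))" "integrable std_normal_distribution (\<lambda>x. sin (\<sigma> * x))"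
    by (intro N.integrable_const_bound[of _ 1]; simp)+
  ultimately have "(LINT x|std_normal_distribution. cos (\<sigma> * x + \<theta>)) = exp (- \<sigma>\<^sup>2 / 2) * cos \<theta>"
    by (simp add: cos_add)
  then show ?thesis unfolding g by (subst integral_distr) auto
qed

lemma (in prob_space) gaussian_rv_expectation_cos:
  assumes "gaussian_rv M X" "expectation X = 0"
  shows "expectation (\<lambda>\<omega>. cos (X \<omega> + \<theta>)) = exp (- expectation (\<lambda>\<omega>. (X \<omega>)\<^sup>2) / 2) * cos \<theta>"
proof -
  have [measurable]: "X \<in> borel_measurable M" using assms by (simp add: gaussian_rv_def)
  from assms show ?thesis
  proof (cases rule: gaussian_rv_centered_cases)
    case degenerate
    have "expectation (\<lambda>\<omega>. cos (X \<omega> + \<theta>)) = expectation (\<lambda>_. cos \<theta>)"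
      using degenerate by (intro integral_cong_AE) auto
    with degenerate show ?thesis by (simp add: prob_space)
  next
    case (normal \<sigma>)
    have "expectation (\<lambda>\<omega>. cos (X \<omega> + \<theta>)) = (LINT x|distr M borel X. cos (x + \<theta>))"
      by (subst integral_distr) auto
    with normal cos_gauss show ?thesis by simp
  qed
qed

lemma (in prob_space) gaussian_rv_exp_linear:
  assumes "gaussian_rv M X" "expectation X = 0"
  shows "(\<integral>\<^sup>+\<omega>. ennreal (exp (c * X \<omega>)) \<partial>M) = ennreal (exp (c\<^sup>2 * expectation (\<lambda>\<omega>. (X \<omega>)\<^sup>2) / 2))"
proof -
  have [measurable]: "X \<in> borel_measurable M" using assms by (simp add: gaussian_rv_def)
  from assms show ?thesis
  proof (cases rule: gaussian_rv_centered_cases)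
    case degenerate
    have "(\<integral>\<^sup>+\<omega>. ennreal (exp (c * X \<omega>)) \<partial>M) = (\<integral>\<^sup>+\<omega>. 1 \<partial>M)"
      using degenerate by (intro nn_integral_cong_AE) auto
    with degenerate show ?thesis by (simp add: emeasure_space_1)
  next
    case (normal \<sigma>)
    have "(\<integral>\<^sup>+\<omega>. ennreal (exp (c * X \<omega>)) \<partial>M) = (\<integral>\<^sup>+x. ennreal (exp (c * x)) \<partial>distr M borel X)"
      by (subst nn_integral_distr) auto
    with normal show ?thesis by (simp add: gauss_exp_linear)
  qed
qed

lemma (in prob_space) gaussian_rv_exp_square:
  assumes "gaussian_rv M X" "expectation X = 0" and "0 \<le> a" "2 * a * expectation (\<lambda>\<omega>. (X \<omega>)\<^sup>2) \<le> 1/2"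
  shows "(\<integral>\<^sup>+\<omega>. ennreal (exp (a * (X \<omega>)\<^sup>2)) \<partial>M) \<le> 2"
proof -
  have [measurable]: "X \<in> borel_measurable M" using assms by (simp add: gaussian_rv_def)
  from assms(1,2) show ?thesis
  proof (cases rule: gaussian_rv_centered_cases)
    case degenerate
    have "(\<integral>\<^sup>+\<omega>. ennreal (exp (a * (X \<omega>)\<^sup>2)) \<partial>M) = (\<integral>\<^sup>+\<omega>. 1 \<partial>M)"
      using degenerate by (intro nn_integral_cong_AE) auto
    with degenerate show ?thesis by (simp add: emeasure_space_1)
  next
    case (normal \<sigma>)
    have "(\<integral>\<^sup>+\<omega>. ennreal (exp (a * (X \<omega>)\<^sup>2)) \<partial>M) = (\<integral>\<^sup>+x. ennreal (exp (a * x\<^sup>2)) \<partial>distr M borel X)"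
      by (subst nn_integral_distr) auto
    also have "\<dots> = ennreal (1 / sqrt (1 - 2 * a * \<sigma>\<^sup>2))"
      using normal assms by (simp add: gauss_exp_square)
    also have "\<dots> \<le> ennreal 2"
    proof (rule ennreal_leI)
      have "1/2 = sqrt (1/4)" by (simp add: real_sqrt_divide)
      also have "\<dots> \<le> sqrt (1 - 2 * a * \<sigma>\<^sup>2)" using assms normal by (intro real_sqrt_le_mono) auto
      finally show "1 / sqrt (1 - 2 * a * \<sigma>\<^sup>2) \<le> 2"
        using assms normal by (simp add: divide_le_eq)
    qed
    finally show ?thesis by simp
  qed
qed

text \<open>
  A Gaussian space: a set of real random variables that contains zero, is closed under linear
  combinations of two members, and consists of centred Gaussian variables (point masses included).
  The variables are functions, not classes modulo null sets.
\<close>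

definition gaussian_space :: "'a measure \<Rightarrow> ('a \<Rightarrow> real) set \<Rightarrow> bool" where
  "gaussian_space M H \<longleftrightarrow>
     (\<lambda>_. 0) \<in> H \<and>
     (\<forall>X\<in>H. gaussian_rv M X \<and> prob_space.expectation M X = 0) \<and>
     (\<forall>X\<in>H. \<forall>Y\<in>H. \<forall>a b. (\<lambda>\<omega>. a * X \<omega> + b * Y \<omega>) \<in> H)"

context prob_space
begin

context
  fixes H :: "('a \<Rightarrow> real) set"
  assumes H: "gaussian_space M H"
begin

lemma gaussian_space_rv: "X \<in> H \<Longrightarrow> gaussian_rv M X"
  and gaussian_space_mean: "X \<in> H \<Longrightarrow> expectation X = 0"
  and gaussian_space_comb: "X \<in> H \<Longrightarrow> Y \<in> H \<Longrightarrow> (\<lambda>\<omega>. a * X \<omega> + b * Y \<omega>) \<in> H"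
  and gaussian_space_zero: "(\<lambda>_. 0) \<in> H"
  using H by (auto simp: gaussian_space_def)

lemma gaussian_space_measurable: "X \<in> H \<Longrightarrow> X \<in> borel_measurable M"
  using gaussian_space_rv by (auto simp: gaussian_rv_def)

lemma gaussian_space_diff: "X \<in> H \<Longrightarrow> Y \<in> H \<Longrightarrow> (\<lambda>\<omega>. X \<omega> - Y \<omega>) \<in> H"
  using gaussian_space_comb[of X Y 1 "-1"] by simp

lemma gaussian_space_sum:
  assumes "finite J" "\<And>j. j \<in> J \<Longrightarrow> V j \<in> H"
  shows "(\<lambda>\<omega>. \<Sum>j\<in>J. t j * V j \<omega>) \<in> H"
  using assms
proof (induction J rule: finite_induct)
  case empty
  then show ?case by (simp add: gaussian_space_zero)
next
  case (insert j J)
  then show ?case using gaussian_space_comb[of "V j" "\<lambda>\<omega>. \<Sum>j\<in>J. t j * V j \<omega>" "t j" 1] by simp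
qed

lemma gaussian_space_square_integrable:
  assumes "X \<in> H"
  shows "integrable M (\<lambda>\<omega>. (X \<omega>)\<^sup>2)"
  using gaussian_rv_centered_cases[OF gaussian_space_rv gaussian_space_mean, OF assms assms] by metis

lemma gaussian_space_product_integrable:
  assumes "X \<in> H" "Y \<in> H"
  shows "integrable M (\<lambda>\<omega>. X \<omega> * Y \<omega>)"
proof (rule Bochner_Integration.integrable_bound[of _ "\<lambda>\<omega>. (X \<omega>)\<^sup>2 + (Y \<omega>)\<^sup>2"])
  show "integrable M (\<lambda>\<omega>. (X \<omega>)\<^sup>2 + (Y \<omega>)\<^sup>2)"
    using assms by (intro Bochner_Integration.integrable_add gaussian_space_square_integrable)
  show "(\<lambda>\<omega>. X \<omega> * Y \<omega>) \<in> borel_measurable M"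
    using assms[THEN gaussian_space_measurable] by measurable
  have "\<bar>x * y\<bar> \<le> x\<^sup>2 + y\<^sup>2" for x y :: real
    using zero_le_power2[of "\<bar>x\<bar> - \<bar>y\<bar>"] mult_nonneg_nonneg[OF abs_ge_zero[of x] abs_ge_zero[of y]]
    unfolding power2_diff abs_mult power2_abs by linarith
  then show "AE \<omega> in M. norm (X \<omega> * Y \<omega>) \<le> norm ((X \<omega>)\<^sup>2 + (Y \<omega>)\<^sup>2)" by simp
qed

lemma gaussian_space_cov_comb:
  assumes "X \<in> H" "Y \<in> H" "Z \<in> H"
  shows "expectation (\<lambda>\<omega>. X \<omega> * (a * Y \<omega> + b * Z \<omega>)) = a * expectation (\<lambda>\<omega>. X \<omega> * Y \<omega>) + b * expectation (\<lambda>\<omega>. X \<omega> * Z \<omega>)"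
proof -
  have "(\<lambda>\<omega>. X \<omega> * (a * Y \<omega> + b * Z \<omega>)) = (\<lambda>\<omega>. a * (X \<omega> * Y \<omega>) + b * (X \<omega> * Z \<omega>))"
    by (auto simp: algebra_simps)
  then show ?thesis
    using gaussian_space_product_integrable[OF assms(1,2)] gaussian_space_product_integrable[OF assms(1,3)] by simp
qed

lemma gaussian_space_uncorrelated_sum:
  assumes "finite J" "X \<in> H" "\<And>j. j \<in> J \<Longrightarrow> V j \<in> H" "\<And>j. j \<in> J \<Longrightarrow> expectation (\<lambda>\<omega>. X \<omega> * V j \<omega>) = 0"
  shows "expectation (\<lambda>\<omega>. X \<omega> * (\<Sum>j\<in>J. t j * V j \<omega>)) = 0"
  using assms
proof (induction J rule: finite_induct)
  case (insert j J)
  have "expectation (\<lambda>\<omega>. X \<omega> * (t j * V j \<omega> + 1 * (\<Sum>j\<in>J. t j * V j \<omega>))) = 0"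
    using insert by (subst gaussian_space_cov_comb) (auto intro!: gaussian_space_sum)
  then show ?case using insert by simp
qed simp

lemma gaussian_space_cos_uncorrelated:
  assumes X: "X \<in> H" and U: "U \<in> H" and cov: "expectation (\<lambda>\<omega>. X \<omega> * U \<omega>) = 0"
  shows "expectation (\<lambda>\<omega>. cos (r * X \<omega> + a * U \<omega> + \<psi>))
     = exp (- r\<^sup>2 * expectation (\<lambda>\<omega>. (X \<omega>)\<^sup>2) / 2) * exp (- a\<^sup>2 * expectation (\<lambda>\<omega>. (U \<omega>)\<^sup>2) / 2) * cos \<psi>"
proof -
  note [simp] = gaussian_space_square_integrable[OF X] gaussian_space_square_integrable[OF U]
    gaussian_space_product_integrable[OF X U]
  have "(\<lambda>\<omega>. (r * X \<omega> + a * U \<omega>)\<^sup>2) = (\<lambda>\<omega>. r\<^sup>2 * (X \<omega>)\<^sup>2 + a\<^sup>2 * (U \<omega>)\<^sup>2 + 2 * r * a * (X \<omega> * U \<omega>))"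
    by (auto simp: power2_sum power_mult_distrib)
  then have "expectation (\<lambda>\<omega>. (r * X \<omega> + a * U \<omega>)\<^sup>2) = r\<^sup>2 * expectation (\<lambda>\<omega>. (X \<omega>)\<^sup>2) + a\<^sup>2 * expectation (\<lambda>\<omega>. (U \<omega>)\<^sup>2)"
    using cov by simp
  then show ?thesis
    using gaussian_rv_expectation_cos[OF gaussian_space_rv gaussian_space_mean, OF gaussian_space_comb gaussian_space_comb, OF X U X U, of r a \<psi>]
    by (simp add: exp_add [symmetric] add_divide_distrib diff_divide_distrib)
qed

text \<open>
  In a Gaussian space, a variable that is uncorrelated with finitely many others is independent of
  them jointly. The weight \<open>1 + cos (U + \<theta>)\<close>, with \<open>U\<close> a linear combination of the others, turns the
  factorisation of the Gaussian characteristic function into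
  an identity between two weighted laws of \<open>X\<close>; then the weight \<open>indicator A X\<close> is compared with the
  constant weight \<open>P(X \<in> A)\<close> for the joint law of the others.
\<close>

lemma gaussian_space_indep_event:
  assumes X: "X \<in> H" and J: "finite J" and V: "\<And>j. j \<in> J \<Longrightarrow> V j \<in> H"
    and cov: "\<And>j. j \<in> J \<Longrightarrow> expectation (\<lambda>\<omega>. X \<omega> * V j \<omega>) = 0"
    and A [measurable]: "A \<in> sets borel" and C: "\<And>j. j \<in> J \<Longrightarrow> C j \<in> sets borel"
  shows "prob {\<omega>\<in>space M. X \<omega> \<in> A \<and> (\<forall>j\<in>J. V j \<omega> \<in> C j)}
       = prob {\<omega>\<in>space M. X \<omega> \<in> A} * prob {\<omega>\<in>space M. \<forall>j\<in>J. V j \<omega> \<in> C j}"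
proof -
  let ?A = "{\<omega>\<in>space M. X \<omega> \<in> A}" and ?V = "{\<omega>\<in>space M. \<forall>j\<in>J. V j \<omega> \<in> C j}"
  let ?p = "\<lambda>\<omega>. \<Prod>j\<in>J. indicator (C j) (V j \<omega>) :: real"
  have [measurable]: "X \<in> borel_measurable M" by (rule gaussian_space_measurable[OF X])
  have [measurable]: "V j \<in> borel_measurable M" "C j \<in> sets borel" if "j \<in> J" for j
    using gaussian_space_measurable[OF V] C that by auto
  define p where "p = prob ?A"
  have p_int: "p = expectation (\<lambda>\<omega>. indicator A (X \<omega>))"
  proof -
    have "expectation (\<lambda>\<omega>. indicator A (X \<omega>)) = expectation (indicator ?A :: 'a \<Rightarrow> real)"
      by (intro Bochner_Integration.integral_cong) (auto split: split_indicator)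
    then show ?thesis by (simp add: p_def)
  qed
  have key: "expectation (\<lambda>\<omega>. indicator A (X \<omega>) * cos ((\<Sum>j\<in>J. t j * V j \<omega>) + \<theta>))
       = expectation (\<lambda>\<omega>. p * cos ((\<Sum>j\<in>J. t j * V j \<omega>) + \<theta>))" for t \<theta>
  proof -
    define U where "U \<omega> = (\<Sum>j\<in>J. t j * V j \<omega>)" for \<omega>
    have U: "U \<in> H" unfolding U_def using J V by (rule gaussian_space_sum)
    have [measurable]: "U \<in> borel_measurable M" by (rule gaussian_space_measurable[OF U])
    have cXU: "expectation (\<lambda>\<omega>. X \<omega> * U \<omega>) = 0"
      unfolding U_def using J X V cov by (rule gaussian_space_uncorrelated_sum)
    note cosE = gaussian_space_cos_uncorrelated[OF X U cXU]
    define m where "m = expectation (\<lambda>\<omega>. cos (U \<omega> + \<theta>))"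
    have m: "m = exp (- expectation (\<lambda>\<omega>. (U \<omega>)\<^sup>2) / 2) * cos \<theta>"
      using cosE[of 0 1 \<theta>] by (simp add: m_def)
    have bnd: "integrable M (\<lambda>\<omega>. cos (r * X \<omega> + a * U \<omega> + \<psi>))" for r a \<psi>
      by (intro integrable_const_bound[of _ 1]) auto
    have "expectation (\<lambda>\<omega>. (1 + cos (U \<omega> + \<theta>)) * indicator A (X \<omega>))
        = expectation (\<lambda>\<omega>. (1 + m) * indicator A (X \<omega>))"
    proof (rule weighted_law_unique[where K = 2])
      have m1: "\<bar>m\<bar> \<le> 1" unfolding m_def
        by (rule order_trans[OF integral_abs_bound]) (auto intro!: integral_le_const integrable_const_bound[of _ 1])
      show "0 \<le> 1 + m" "1 + m \<le> 2" using m1 by auto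
      show "0 \<le> 1 + cos (U \<omega> + \<theta>)" "1 + cos (U \<omega> + \<theta>) \<le> 2" for \<omega>
        using cos_ge_minus_one[of "U \<omega> + \<theta>"] cos_le_one[of "U \<omega> + \<theta>"] by linarith+
      show "expectation (\<lambda>\<omega>. (1 + cos (U \<omega> + \<theta>)) * cos (r * X \<omega> + \<phi>))
          = expectation (\<lambda>\<omega>. (1 + m) * cos (r * X \<omega> + \<phi>))" for r \<phi>
      proof -
        have prod: "(1 + cos (U \<omega> + \<theta>)) * cos (r * X \<omega> + \<phi>) = cos (r * X \<omega> + 0 * U \<omega> + \<phi>)
            + (cos (r * X \<omega> + 1 * U \<omega> + (\<theta> + \<phi>)) + cos (r * X \<omega> + -1 * U \<omega> + (\<phi> - \<theta>))) / 2" for \<omega>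
        proof -
          have "r * X \<omega> + 1 * U \<omega> + (\<theta> + \<phi>) = (U \<omega> + \<theta>) + (r * X \<omega> + \<phi>)"
            "r * X \<omega> + -1 * U \<omega> + (\<phi> - \<theta>) = (r * X \<omega> + \<phi>) - (U \<omega> + \<theta>)" by auto
          then show ?thesis by (simp only: cos_add cos_diff) (simp add: field_simps)
        qed
        define e where "e = exp (- r\<^sup>2 * expectation (\<lambda>\<omega>. (X \<omega>)\<^sup>2) / 2)"
        have "expectation (\<lambda>\<omega>. (1 + cos (U \<omega> + \<theta>)) * cos (r * X \<omega> + \<phi>)) =
           expectation (\<lambda>\<omega>. cos (r * X \<omega> + 0 * U \<omega> + \<phi>))
            + (expectation (\<lambda>\<omega>. cos (r * X \<omega> + 1 * U \<omega> + (\<theta> + \<phi>))) + expectation (\<lambda>\<omega>. cos (r * X \<omega> + -1 * U \<omega> + (\<phi> - \<theta>)))) / 2"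
          unfolding prod using bnd[of r 0 \<phi>] bnd[of r 1 "\<theta> + \<phi>"] bnd[of r "-1" "\<phi> - \<theta>"] by simp
        also have "\<dots> = e * cos \<phi> + e * exp (- expectation (\<lambda>\<omega>. (U \<omega>)\<^sup>2) / 2) * ((cos (\<theta> + \<phi>) + cos (\<phi> - \<theta>)) / 2)"
          unfolding cosE by (simp add: e_def algebra_simps)
        also have "(cos (\<theta> + \<phi>) + cos (\<phi> - \<theta>)) / 2 = cos \<theta> * cos \<phi>"
          by (simp add: cos_add cos_diff)
        also have "e * cos \<phi> + e * exp (- expectation (\<lambda>\<omega>. (U \<omega>)\<^sup>2) / 2) * (cos \<theta> * cos \<phi>) = (1 + m) * (e * cos \<phi>)"
          by (simp add: m algebra_simps)
        also have "e * cos \<phi> = expectation (\<lambda>\<omega>. cos (r * X \<omega> + \<phi>))"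
          using cosE[of r 0 \<phi>] by (simp add: e_def)
        finally show ?thesis by simp
      qed
    qed auto
    moreover have "expectation (\<lambda>\<omega>. (1 + cos (U \<omega> + \<theta>)) * indicator A (X \<omega>))
        = p + expectation (\<lambda>\<omega>. indicator A (X \<omega>) * cos (U \<omega> + \<theta>))"
    proof -
      have "integrable M (\<lambda>\<omega>. indicator A (X \<omega>) :: real)" "integrable M (\<lambda>\<omega>. indicator A (X \<omega>) * cos (U \<omega> + \<theta>))"
        by (auto intro!: integrable_const_bound[of _ 1] split: split_indicator)
      then show ?thesis unfolding p_int
        by (subst Bochner_Integration.integral_add [symmetric]) (auto simp: algebra_simps)
    qed
    moreover have "expectation (\<lambda>\<omega>. (1 + m) * indicator A (X \<omega>)) = (1 + m) * p"
      by (simp add: p_int)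
    moreover have "expectation (\<lambda>\<omega>. p * cos (U \<omega> + \<theta>)) = p * m"
      by (simp add: m_def)
    ultimately show ?thesis unfolding U_def[symmetric]
      by (simp only: distrib_right) simp
  qed
  have "expectation (\<lambda>\<omega>. indicator A (X \<omega>) * ?p \<omega>)
       = expectation (\<lambda>\<omega>. p * ?p \<omega>)"
    by (rule weighted_joint_law_unique[OF J, where K = 1])
       (auto simp: p_def C key[unfolded p_def] gaussian_space_measurable V split: split_indicator)
  moreover have prodJ: "?p \<omega> = (if \<forall>j\<in>J. V j \<omega> \<in> C j then 1 else 0 :: real)" for \<omega>
    using J by (induction J rule: finite_induct) auto
  have meas [measurable]: "?V \<in> sets M"
    using J by (intro sets.sets_Collect_finite_All) auto
  have "expectation (\<lambda>\<omega>. indicator A (X \<omega>) * ?p \<omega>)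
      = expectation (indicator (?A \<inter> ?V) :: 'a \<Rightarrow> real)"
    unfolding prodJ by (intro Bochner_Integration.integral_cong) (auto split: split_indicator)
  moreover have "expectation (\<lambda>\<omega>. p * ?p \<omega>)
      = p * expectation (indicator ?V :: 'a \<Rightarrow> real)"
    unfolding prodJ integral_mult_right_zero
    by (intro arg_cong2[where f = "(*)"] Bochner_Integration.integral_cong) (auto split: split_indicator)
  moreover have "?A \<inter> ?V = {\<omega>\<in>space M. X \<omega> \<in> A \<and> (\<forall>j\<in>J. V j \<omega> \<in> C j)}"
    by auto
  ultimately show ?thesis by (simp add: p_def)
qed

end
end

section \<open>Gaussian integration by parts for shifts\<close>

lemma integrable_abs_times_normal_density:
  assumes "\<sigma> > 0"
  shows "integrable lborel (\<lambda>z. normal_density 0 \<sigma> z * \<bar>z\<bar>)"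
  using integrable_normal_moment_abs[OF assms, of 0 1] by simp

text \<open>
  Gaussian integration by parts for a finite difference. Formally
  \<open>f (z + y) - f z\<close> is the derivative in \<open>z\<close> of \<open>y\<close> times the mean of \<open>f\<close> over the segment
  from \<open>z\<close> to \<open>z + y\<close>. No regularity of \<open>f\<close> is needed: the derivative falls on the density, through
  \<open>q (z - y) - q z = \<integral> y (z - \<theta> y) q (z - \<theta> y) / \<sigma>\<^sup>2 d\<theta>\<close>, with \<open>\<theta>\<close> from 0 to 1, and Fubini.
\<close>

lemma gauss_shift_by_parts:
  fixes f :: "real \<Rightarrow> real"
  assumes \<sigma>: "\<sigma> > 0" and [measurable]: "f \<in> borel_measurable borel" and f: "\<And>x. \<bar>f x\<bar> \<le> 1"
  shows "(LINT z|gauss \<sigma>. f (z + y) - f z) = (LINT z|gauss \<sigma>. (LINT \<theta>:{0..1}|lborel. f (z + \<theta> * y)) * (y * z)) / \<sigma>\<^sup>2"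
proof -
  define q where "q = normal_density 0 \<sigma>"
  have [measurable]: "q \<in> borel_measurable borel" by (simp add: q_def)
  have q0: "q z \<ge> 0" for z by (simp add: q_def)
  have intq: "integrable lborel q" using \<sigma> by (simp add: q_def)
  have intqz: "integrable lborel (\<lambda>z. q z * \<bar>z\<bar>)"
    unfolding q_def using \<sigma> by (rule integrable_abs_times_normal_density)
  have deriv: "((\<lambda>\<theta>. \<sigma>\<^sup>2 * q (z - \<theta> * y)) has_real_derivative y * (z - \<theta> * y) * q (z - \<theta> * y)) (at \<theta>)" for z \<theta>
  proof -
    define c where "c = 1 / sqrt (2 * pi * \<sigma>\<^sup>2)"
    have q: "q w = c * exp (- w\<^sup>2 / (2 * \<sigma>\<^sup>2))" for w
      by (simp add: q_def normal_density_def c_def)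
    show ?thesis
      unfolding q using \<sigma> by (auto intro!: derivative_eq_intros simp: power2_eq_square)
  qed
  have ftc: "(LINT \<theta>|lborel. y * (z - \<theta> * y) * q (z - \<theta> * y) * indicator {0..1} \<theta>) = \<sigma>\<^sup>2 * q (z - y) - \<sigma>\<^sup>2 * q z" for z
  proof -
    have "isCont (\<lambda>\<theta>. y * (z - \<theta> * y) * q (z - \<theta> * y)) \<theta>" for \<theta>
      using \<sigma> unfolding q_def normal_density_def by (intro continuous_intros) auto
    then show ?thesis
      by (subst integral_FTC_Icc_real[of 0 1 "\<lambda>\<theta>. \<sigma>\<^sup>2 * q (z - \<theta> * y)", OF _ deriv]) auto
  qed
  have shift: "(LINT z|lborel. g (z + c)) = (LINT z|lborel. g z)" for g :: "real \<Rightarrow> real" and c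
    using lborel_integral_real_affine[of 1 g c] by (simp add: add.commute)
  have shift_int: "integrable lborel (\<lambda>z. g (z + c)) \<longleftrightarrow> integrable lborel g" for g :: "real \<Rightarrow> real" and c
    using lborel_integrable_real_affine_iff[of 1 g c] by (simp add: add.commute)
  have absm: "\<bar>y * z * a * b\<bar> \<le> \<bar>y\<bar> * (a * \<bar>z\<bar>)" if "\<bar>b\<bar> \<le> 1" "a \<ge> 0" for z a b :: real
  proof -
    have "\<bar>y * z * a * b\<bar> = \<bar>y\<bar> * (a * \<bar>z\<bar>) * \<bar>b\<bar>" using that by (simp add: abs_mult)
    also have "\<dots> \<le> \<bar>y\<bar> * (a * \<bar>z\<bar>) * 1" using that by (intro mult_left_mono) auto
    finally show ?thesis by simp
  qed
  define K where "K \<theta> z = indicator {0..1} \<theta> * (y * z * q z * f (z + \<theta> * y))" for \<theta> z :: real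
  define L where "L \<theta> z = indicator {0..1} \<theta> * (y * (z - \<theta> * y) * q (z - \<theta> * y) * f z)" for \<theta> z :: real
  have KL: "L \<theta> (z + \<theta> * y) = K \<theta> z" for \<theta> z by (simp add: K_def L_def)
  have [measurable]: "K \<theta> \<in> borel_measurable borel" for \<theta>
    unfolding K_def by measurable
  have Kint: "integrable lborel (K \<theta>)" for \<theta>
    by (rule Bochner_Integration.integrable_bound[OF integrable_mult_right[OF intqz, of "\<bar>y\<bar>"]])
       (auto simp: K_def f q0 abs_mult[of "indicator _ _"] intro!: order_trans[OF absm] split: split_indicator)
  have Lint: "integrable lborel (L \<theta>)" for \<theta>
    using Kint[of \<theta>] shift_int[of "L \<theta>" "\<theta> * y"] by (simp add: KL)
  define B where "B = (LINT z|lborel. \<bar>y\<bar> * (q z * \<bar>z\<bar>))"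
  have Kbound: "(LINT z|lborel. norm (K \<theta> z)) \<le> indicator {0..1} \<theta> * B" for \<theta>
    unfolding B_def
    by (subst integral_mult_right_zero [symmetric], intro integral_mono integrable_norm Kint integrable_mult_right intqz)
       (auto simp: K_def f q0 abs_mult[of "indicator _ _"] intro!: order_trans[OF absm] split: split_indicator)
  have Lbound: "(LINT z|lborel. norm (L \<theta> z)) = (LINT z|lborel. norm (K \<theta> z))" for \<theta>
    using shift[of "\<lambda>z. norm (L \<theta> z)" "\<theta> * y"] by (simp add: KL)
  have int1: "integrable lborel (\<lambda>\<theta> :: real. indicator {0..1} \<theta> * B)"
    by (intro integrable_mult_left integrable_real_indicator) auto
  have Knorm: "integrable lborel (\<lambda>\<theta>. LINT z|lborel. norm (K \<theta> z))"
  proof (rule Bochner_Integration.integrable_bound[OF int1])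
    show "(\<lambda>\<theta>. LINT z|lborel. norm (K \<theta> z)) \<in> borel_measurable lborel" unfolding K_def by measurable
    have "norm (LINT z|lborel. norm (K \<theta> z)) = (LINT z|lborel. norm (K \<theta> z))" for \<theta>
      by simp
    then show "AE \<theta> in lborel. norm (LINT z|lborel. norm (K \<theta> z)) \<le> norm (indicator {0..1} \<theta> * B)"
      using Kbound by (intro AE_I2) (metis abs_ge_self order_trans real_norm_def)
  qed
  have Kpair: "integrable (lborel \<Otimes>\<^sub>M lborel) (\<lambda>(\<theta>, z). K \<theta> z)"
  proof (rule lborel_pair.Fubini_integrable)
    show "(\<lambda>(\<theta>, z). K \<theta> z) \<in> borel_measurable (lborel \<Otimes>\<^sub>M lborel)" unfolding K_def by measurable
  qed (use Knorm Kint in simp_all)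
  have Lpair: "integrable (lborel \<Otimes>\<^sub>M lborel) (\<lambda>(\<theta>, z). L \<theta> z)"
  proof (rule lborel_pair.Fubini_integrable)
    show "(\<lambda>(\<theta>, z). L \<theta> z) \<in> borel_measurable (lborel \<Otimes>\<^sub>M lborel)" unfolding L_def by measurable
    show "integrable lborel (\<lambda>\<theta>. LINT z|lborel. norm (case (\<theta>, z) of (\<theta>, z) \<Rightarrow> L \<theta> z))"
      using Knorm by (simp only: prod.case Lbound)
  qed (simp add: Lint)
  have intf: "integrable lborel (\<lambda>z. q z * f (z + c))" for c
    by (rule Bochner_Integration.integrable_bound[OF intq]) (auto simp: abs_mult q0 mult_left_le f)
  have intf': "integrable lborel (\<lambda>z. q (z - y) * f z)"
    using shift_int[of "\<lambda>z. q (z - y) * f z" y] intf[of y] by simp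
  have Kz: "(LINT \<theta>|lborel. K \<theta> z) = q z * ((LINT \<theta>:{0..1}|lborel. f (z + \<theta> * y)) * (y * z))" for z
  proof -
    have "(LINT \<theta>|lborel. K \<theta> z) = (LINT \<theta>|lborel. (q z * (y * z)) * (indicator {0..1} \<theta> *\<^sub>R f (z + \<theta> * y)))"
      by (intro Bochner_Integration.integral_cong) (simp_all add: K_def)
    then show ?thesis by (simp only: integral_mult_right_zero set_lebesgue_integral_def mult_ac)
  qed
  have "(LINT z|gauss \<sigma>. (LINT \<theta>:{0..1}|lborel. f (z + \<theta> * y)) * (y * z)) = (LINT z|lborel. LINT \<theta>|lborel. K \<theta> z)"
    unfolding Kz q_def[symmetric] using q0
    by (subst integral_density) (measurable, auto simp: set_lebesgue_integral_def)
  also have "\<dots> = (LINT \<theta>|lborel. LINT z|lborel. K \<theta> z)"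
    by (rule lborel_pair.Fubini_integral[OF Kpair])
  also have "\<dots> = (LINT \<theta>|lborel. LINT z|lborel. L \<theta> z)"
    using shift[of "L \<theta>" "\<theta> * y" for \<theta>] by (simp only: KL)
  also have "\<dots> = (LINT z|lborel. LINT \<theta>|lborel. L \<theta> z)"
    by (rule lborel_pair.Fubini_integral[OF Lpair, symmetric])
  also have "\<dots> = (LINT z|lborel. f z * (\<sigma>\<^sup>2 * q (z - y) - \<sigma>\<^sup>2 * q z))"
    unfolding ftc[symmetric] L_def
    by (simp only: integral_mult_right_zero [symmetric]) (intro Bochner_Integration.integral_cong; simp add: mult_ac)
  also have "\<dots> = (LINT z|lborel. \<sigma>\<^sup>2 * (q (z - y) * f z) - \<sigma>\<^sup>2 * (q z * f z))"
    by (simp add: algebra_simps)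
  also have "\<dots> = \<sigma>\<^sup>2 * ((LINT z|lborel. q (z - y) * f z) - (LINT z|lborel. q z * f z))"
    using intf' intf[of 0] by (simp add: right_diff_distrib)
  also have "(LINT z|lborel. q (z - y) * f z) = (LINT z|lborel. q z * f (z + y))"
    using shift[of "\<lambda>z. q (z - y) * f z" y] by simp
  also have "(LINT z|lborel. q z * f (z + y)) - (LINT z|lborel. q z * f z) = (LINT z|lborel. q z * (f (z + y) - f z))"
    using intf[of y] intf[of 0] by (simp add: right_diff_distrib)
  also have "\<dots> = (LINT z|gauss \<sigma>. f (z + y) - f z)"
    unfolding q_def[symmetric] using q0 by (subst integral_density) auto
  finally show ?thesis using \<sigma> by simp
qed

section \<open>Supermartingale products\<close>

text \<open>
  Independence of a real random variable from a sub-sigma-algebra, the latter encoded as a measure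
  \<open>\<F>\<close> on the same space of which only the measurable sets matter. It is stated with events because the identity
  into \<open>\<F>\<close> and the variable \<open>Z\<close> take values in different types.
\<close>

definition indep_of :: "'a measure \<Rightarrow> 'a measure \<Rightarrow> ('a \<Rightarrow> real) \<Rightarrow> bool" where
  "indep_of M \<F> Z \<longleftrightarrow>
     space \<F> = space M \<and> sets \<F> \<subseteq> sets M \<and> Z \<in> borel_measurable M \<and>
     (\<forall>A\<in>sets \<F>. \<forall>B\<in>sets borel.
        measure M (A \<inter> {\<omega>\<in>space M. Z \<omega> \<in> B}) = measure M A * measure M {\<omega>\<in>space M. Z \<omega> \<in> B})"

lemma indep_of_measurable_id: "indep_of M \<F> Z \<Longrightarrow> (\<lambda>\<omega>. \<omega>) \<in> M \<rightarrow>\<^sub>M \<F>"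
  using sets.sets_into_space[of _ \<F>] by (force simp: indep_of_def measurable_def Int_absorb2)

lemma (in prob_space) indep_of_nn_integral:
  assumes ind: "indep_of M \<F> Z"
    and g: "g \<in> borel_measurable (\<F> \<Otimes>\<^sub>M borel)"
  shows "(\<integral>\<^sup>+\<omega>. g (\<omega>, Z \<omega>) \<partial>M) = (\<integral>\<^sup>+\<omega>. (\<integral>\<^sup>+z. g (\<omega>, z) \<partial>distr M borel Z) \<partial>M)"
proof -
  have id [measurable]: "(\<lambda>\<omega>. \<omega>) \<in> M \<rightarrow>\<^sub>M \<F>" by (rule indep_of_measurable_id[OF ind])
  have [measurable]: "Z \<in> borel_measurable M" using ind by (simp add: indep_of_def)
  have D: "distr M \<F> (\<lambda>\<omega>. \<omega>) \<Otimes>\<^sub>M distr M borel Z = distr M (\<F> \<Otimes>\<^sub>M borel) (\<lambda>\<omega>. (\<omega>, Z \<omega>))"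
  proof (rule pair_measure_eqI)
    show "sigma_finite_measure (distr M \<F> (\<lambda>\<omega>. \<omega>))" "sigma_finite_measure (distr M borel Z)"
      by (intro finite_measure.axioms(1)[OF prob_space.axioms(1)] prob_space_distr; measurable)+
    show "sets (distr M \<F> (\<lambda>\<omega>. \<omega>) \<Otimes>\<^sub>M distr M borel Z) = sets (distr M (\<F> \<Otimes>\<^sub>M borel) (\<lambda>\<omega>. (\<omega>, Z \<omega>)))"
      by (simp cong: sets_pair_measure_cong)
    fix A B assume "A \<in> sets (distr M \<F> (\<lambda>\<omega>. \<omega>))" "B \<in> sets (distr M borel Z)"
    then have A: "A \<in> sets \<F>" and B: "B \<in> sets borel" by auto
    have sub: "A \<subseteq> space M" using sets.sets_into_space[OF A] ind by (simp add: indep_of_def)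
    then have "emeasure (distr M (\<F> \<Otimes>\<^sub>M borel) (\<lambda>\<omega>. (\<omega>, Z \<omega>))) (A \<times> B) = ennreal (prob (A \<inter> {\<omega>\<in>space M. Z \<omega> \<in> B}))"
      using A B by (subst emeasure_distr) (auto simp: emeasure_eq_measure intro!: arg_cong[where f = prob])
    also have "\<dots> = ennreal (prob A) * ennreal (prob {\<omega>\<in>space M. Z \<omega> \<in> B})"
      using ind A B by (simp add: indep_of_def ennreal_mult')
    also have "\<dots> = emeasure (distr M \<F> (\<lambda>\<omega>. \<omega>)) A * emeasure (distr M borel Z) B"
    proof -
      have "(\<lambda>\<omega>. \<omega>) -` A \<inter> space M = A" "Z -` B \<inter> space M = {\<omega>\<in>space M. Z \<omega> \<in> B}" using sub by auto
      then show ?thesis using A B by (simp add: emeasure_distr emeasure_eq_measure)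
    qed
    finally show "emeasure (distr M \<F> (\<lambda>\<omega>. \<omega>)) A * emeasure (distr M borel Z) B
        = emeasure (distr M (\<F> \<Otimes>\<^sub>M borel) (\<lambda>\<omega>. (\<omega>, Z \<omega>))) (A \<times> B)" by simp
  qed
  interpret Z: prob_space "distr M borel Z" by (rule prob_space_distr) simp
  have g' [measurable]: "g \<in> borel_measurable (\<F> \<Otimes>\<^sub>M distr M borel Z)"
    using g by (simp cong: measurable_cong_sets)
  have "(\<integral>\<^sup>+\<omega>. g (\<omega>, Z \<omega>) \<partial>M) = (\<integral>\<^sup>+x. g x \<partial>(distr M \<F> (\<lambda>\<omega>. \<omega>) \<Otimes>\<^sub>M distr M borel Z))"
    unfolding D using g by (subst nn_integral_distr) auto
  also have "\<dots> = (\<integral>\<^sup>+\<omega>. (\<integral>\<^sup>+z. g (\<omega>, z) \<partial>distr M borel Z) \<partial>distr M \<F> (\<lambda>\<omega>. \<omega>))"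
    by (rule Z.nn_integral_fst [symmetric]) (use g in \<open>simp cong: measurable_cong_sets\<close>)
  also have "\<dots> = (\<integral>\<^sup>+\<omega>. (\<integral>\<^sup>+z. g (\<omega>, z) \<partial>distr M borel Z) \<partial>M)"
    by (subst nn_integral_distr) (auto intro!: Z.borel_measurable_nn_integral_fst)
  finally show ?thesis .
qed

text \<open>
  If each factor depends on the past and on one innovation independent of it, and has conditional
  expectation at most one, then so does the product.
\<close>

lemma (in prob_space) supermartingale_product:
  fixes g :: "nat \<Rightarrow> 'a \<times> real \<Rightarrow> ennreal"
  assumes ind: "\<And>i. i < n \<Longrightarrow> indep_of M (\<F> i) (Z i)"
    and g: "\<And>i. i < n \<Longrightarrow> g i \<in> borel_measurable (\<F> i \<Otimes>\<^sub>M borel)"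
    and past: "\<And>i j. j < i \<Longrightarrow> i < n \<Longrightarrow> (\<lambda>\<omega>. g j (\<omega>, Z j \<omega>)) \<in> borel_measurable (\<F> i)"
    and le: "\<And>i \<omega>. i < n \<Longrightarrow> \<omega> \<in> space M \<Longrightarrow> (\<integral>\<^sup>+z. g i (\<omega>, z) \<partial>distr M borel (Z i)) \<le> 1"
  shows "(\<integral>\<^sup>+\<omega>. (\<Prod>i<n. g i (\<omega>, Z i \<omega>)) \<partial>M) \<le> 1"
  using assms
proof (induction n)
  case 0
  then show ?case by (simp add: emeasure_space_1)
next
  case (Suc n)
  define R where "R \<omega> = (\<Prod>i<n. g i (\<omega>, Z i \<omega>))" for \<omega>
  have R [measurable]: "R \<in> borel_measurable (\<F> n)"
    unfolding R_def using Suc.prems(3) by (intro borel_measurable_prod_ennreal) auto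
  note [measurable] = Suc.prems(2)[of n, simplified]
  have "(\<integral>\<^sup>+\<omega>. (\<Prod>i<Suc n. g i (\<omega>, Z i \<omega>)) \<partial>M) = (\<integral>\<^sup>+\<omega>. (\<lambda>(\<omega>, z). R \<omega> * g n (\<omega>, z)) (\<omega>, Z n \<omega>) \<partial>M)"
    by (simp add: R_def)
  also have "\<dots> = (\<integral>\<^sup>+\<omega>. (\<integral>\<^sup>+z. R \<omega> * g n (\<omega>, z) \<partial>distr M borel (Z n)) \<partial>M)"
    using Suc.prems(1)[of n] by (subst indep_of_nn_integral) auto
  also have "\<dots> \<le> (\<integral>\<^sup>+\<omega>. R \<omega> \<partial>M)"
  proof (rule nn_integral_mono)
    fix \<omega> assume \<omega>: "\<omega> \<in> space M"
    have "(\<lambda>\<omega>. \<omega>) \<in> M \<rightarrow>\<^sub>M \<F> n" using indep_of_measurable_id[OF Suc.prems(1)[of n]] by simp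
    then have [simp]: "\<omega> \<in> space (\<F> n)" using \<omega> by (rule measurable_space)
    have "(\<integral>\<^sup>+z. R \<omega> * g n (\<omega>, z) \<partial>distr M borel (Z n)) = R \<omega> * (\<integral>\<^sup>+z. g n (\<omega>, z) \<partial>distr M borel (Z n))"
      by (rule nn_integral_cmult) (use \<open>\<omega> \<in> space (\<F> n)\<close> in measurable)
    also have "\<dots> \<le> R \<omega> * 1" using Suc.prems(4)[of n \<omega>] \<omega> by (intro mult_left_mono) auto
    finally show "(\<integral>\<^sup>+z. R \<omega> * g n (\<omega>, z) \<partial>distr M borel (Z n)) \<le> R \<omega>" by simp
  qed
  also have "\<dots> \<le> 1" unfolding R_def using Suc.prems by (intro Suc.IH) auto
  finally show ?case .
qed

section \<open>Shift differences along a Gaussian walk\<close>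

text \<open>
  The mean of \<open>f\<close> over the segment from \<open>r\<close> to \<open>r + y\<close>, with the random parameter \<open>\<omega>\<close> carried along.
\<close>

definition segment_mean :: "('a \<times> real \<Rightarrow> real) \<Rightarrow> ('a \<Rightarrow> real) \<Rightarrow> 'a \<times> real \<Rightarrow> real" where
  "segment_mean f y = (\<lambda>(\<omega>, r). LINT \<theta>:{0..1}|lborel. f (\<omega>, r + \<theta> * y \<omega>))"

lemma segment_mean_measurable [measurable]:
  assumes [measurable]: "f \<in> borel_measurable (\<A> \<Otimes>\<^sub>M borel)" "y \<in> borel_measurable \<A>"
  shows "segment_mean f y \<in> borel_measurable (\<A> \<Otimes>\<^sub>M borel)"
  unfolding segment_mean_def set_lebesgue_integral_def by measurable

lemma segment_mean_bound:
  assumes "\<And>x. \<bar>f x\<bar> \<le> 1"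
  shows "\<bar>segment_mean f y x\<bar> \<le> 1"
proof (cases x)
  case (Pair \<omega> r)
  have int1: "integrable lborel (\<lambda>\<theta>::real. indicator {0..1} \<theta> :: real)"
    by (intro integrable_real_indicator) auto
  have "\<bar>segment_mean f y x\<bar> \<le> (LINT \<theta>|lborel. \<bar>indicator {0..1} \<theta> *\<^sub>R f (\<omega>, r + \<theta> * y \<omega>)\<bar>)"
    unfolding Pair segment_mean_def set_lebesgue_integral_def prod.case by (rule integral_abs_bound)
  also have "\<dots> \<le> (LINT \<theta>|lborel. indicator {0..1::real} \<theta> :: real)"
    by (rule integral_mono'[OF int1]) (auto simp: assms abs_mult split: split_indicator)
  finally show ?thesis by simp
qed

context prob_space
begin

text \<open>
  The one-step estimate for the forward martingale: the shift difference minus its representation by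
  parts is centred under the Gaussian step, and it grows linearly in the step.
\<close>

lemma forward_step_exp:
  fixes f :: "real \<Rightarrow> real"
  assumes \<sigma>: "\<sigma> > 0" and [measurable]: "f \<in> borel_measurable borel" and f: "\<And>x. \<bar>f x\<bar> \<le> 1" and \<mu>: "\<mu> \<ge> 0"
  shows "(\<integral>\<^sup>+z. ennreal (exp (3 * (\<mu> * (f (s + z + y) - f (s + z))
             - \<mu> / \<sigma>\<^sup>2 * (LINT \<theta>:{0..1}|lborel. f (s + z + \<theta> * y)) * (y * z)))) \<partial>gauss \<sigma>)
         \<le> ennreal (exp (324 * \<mu>\<^sup>2 + 81 * (\<mu>\<^sup>2 / \<sigma>\<^sup>2) * y\<^sup>2))"
proof -
  interpret G: prob_space "gauss \<sigma>" using \<sigma> by (rule prob_space_normal_density)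
  define F where "F z = (LINT \<theta>:{0..1}|lborel. f (s + z + \<theta> * y))" for z
  have [measurable]: "F \<in> borel_measurable borel"
    unfolding F_def set_lebesgue_integral_def by measurable
  have F1: "\<bar>F z\<bar> \<le> 1" for z
    using segment_mean_bound[of "\<lambda>(\<omega>, r). f r" "\<lambda>_. y" "((), s + z)"] f
    by (auto simp: segment_mean_def F_def)
  define h where "h z = 3 * (\<mu> * (f (s + z + y) - f (s + z)) - \<mu> / \<sigma>\<^sup>2 * F z * (y * z))" for z
  have int1: "integrable (gauss \<sigma>) (\<lambda>z. f (s + z + y) - f (s + z))"
    by (intro Bochner_Integration.integrable_diff G.integrable_const_bound[of _ 1]) (auto simp: f)
  have int_id: "integrable (gauss \<sigma>) (\<lambda>z. \<bar>z\<bar>)"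
    using integrable_abs_times_normal_density[OF \<sigma>] by (simp add: integrable_density)
  have Fyz: "\<bar>F z * (y * z)\<bar> \<le> \<bar>y\<bar> * \<bar>z\<bar>" for z
    using mult_right_mono[OF F1[of z], of "\<bar>y * z\<bar>"] by (simp add: abs_mult)
  have int2: "integrable (gauss \<sigma>) (\<lambda>z. F z * (y * z))"
    by (rule Bochner_Integration.integrable_bound[OF integrable_mult_right[OF int_id, of "\<bar>y\<bar>"]])
       (auto intro!: AE_I2 simp: Fyz[unfolded abs_mult] abs_mult)
  have "(LINT z|gauss \<sigma>. f (s + z + y) - f (s + z)) = (LINT z|gauss \<sigma>. F z * (y * z)) / \<sigma>\<^sup>2"
    using gauss_shift_by_parts[OF \<sigma>, of "\<lambda>z. f (s + z)" y] f by (simp add: F_def add.assoc)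
  then have mean: "(LINT z|gauss \<sigma>. h z) = 0"
    unfolding h_def using int1 int2 \<sigma> by (simp add: mult.assoc)
  have "(\<integral>\<^sup>+z. ennreal (exp (h z)) \<partial>gauss \<sigma>) \<le> ennreal (exp (9 * ((6 * \<mu>)\<^sup>2 + (3 * (\<mu> / \<sigma>\<^sup>2) * \<bar>y\<bar>)\<^sup>2 * \<sigma>\<^sup>2)))"
  proof (rule gauss_centered_exp[OF \<sigma> _ mean])
    show "h \<in> borel_measurable borel" unfolding h_def by measurable
    show "\<bar>h z\<bar> \<le> 6 * \<mu> + 3 * (\<mu> / \<sigma>\<^sup>2) * \<bar>y\<bar> * \<bar>z\<bar>" for z
    proof -
      have "\<bar>h z\<bar> \<le> 3 * (\<mu> * \<bar>f (s + z + y) - f (s + z)\<bar> + \<mu> / \<sigma>\<^sup>2 * \<bar>F z * (y * z)\<bar>)"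
        using abs_triangle_ineq4[of "\<mu> * (f (s + z + y) - f (s + z))" "\<mu> / \<sigma>\<^sup>2 * (F z * (y * z))"] \<mu>
        unfolding h_def abs_mult[of 3] by (simp add: abs_mult mult.assoc)
      also have "\<dots> \<le> 3 * (\<mu> * 2 + \<mu> / \<sigma>\<^sup>2 * (\<bar>y\<bar> * \<bar>z\<bar>))"
        using \<mu> f[of "s + z + y"] f[of "s + z"] by (intro mult_left_mono add_mono Fyz) auto
      finally show ?thesis by (simp add: mult.assoc)
    qed
  qed (use \<mu> in auto)
  also have "9 * ((6 * \<mu>)\<^sup>2 + (3 * (\<mu> / \<sigma>\<^sup>2) * \<bar>y\<bar>)\<^sup>2 * \<sigma>\<^sup>2) = 324 * \<mu>\<^sup>2 + 81 * (\<mu>\<^sup>2 / \<sigma>\<^sup>2) * y\<^sup>2"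
    using \<sigma> by (simp add: power_mult_distrib power_divide field_simps power2_eq_square)
  finally show ?thesis unfolding h_def F_def .
qed

text \<open>
  The discrete analogue of writing the integral of a divergence as the difference of a backward and a forward
  Ito integral. The walk \<open>S\<close> has Gaussian forward innovations \<open>S (i + 1) - S i\<close>, independent of \<open>\<F> i\<close>, and
  sub-Gaussian backward innovations \<open>S i - \<rho> i S (i + 1)\<close>, independent of \<open>\<G> i\<close>. Both algebras also carry all
  the shifts \<open>y\<close> and all the functions \<open>f\<close>, so these may be random. The right-hand side collects the
  compensators of the two martingales and the drift that appears under time reversal.
\<close>

lemma exp_moment_shift_differences:
  fixes S y :: "nat \<Rightarrow> 'a \<Rightarrow> real" and f :: "nat \<Rightarrow> 'a \<times> real \<Rightarrow> real" and \<rho> :: "nat \<Rightarrow> real"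
  assumes \<sigma>: "\<sigma> > 0" and \<mu>: "\<mu> \<ge> 0" and f1: "\<And>i x. \<bar>f i x\<bar> \<le> 1"
    and fwd: "\<And>i. i < n \<Longrightarrow> indep_of M (\<F> i) (\<lambda>\<omega>. S (Suc i) \<omega> - S i \<omega>)"
    and fwd_law: "\<And>i. i < n \<Longrightarrow> distr M borel (\<lambda>\<omega>. S (Suc i) \<omega> - S i \<omega>) = gauss \<sigma>"
    and fwd_f: "\<And>i j. i < n \<Longrightarrow> j < n \<Longrightarrow> f j \<in> borel_measurable (\<F> i \<Otimes>\<^sub>M borel)"
    and fwd_y: "\<And>i j. i < n \<Longrightarrow> j < n \<Longrightarrow> y j \<in> borel_measurable (\<F> i)"
    and fwd_S: "\<And>i j. i < n \<Longrightarrow> j \<le> i \<Longrightarrow> S j \<in> borel_measurable (\<F> i)"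
    and bwd: "\<And>i. i < n \<Longrightarrow> indep_of M (\<G> i) (\<lambda>\<omega>. S i \<omega> - \<rho> i * S (Suc i) \<omega>)"
    and bwd_law: "\<And>i c. i < n \<Longrightarrow> (\<integral>\<^sup>+\<omega>. ennreal (exp (c * (S i \<omega> - \<rho> i * S (Suc i) \<omega>))) \<partial>M) \<le> ennreal (exp (c\<^sup>2 * \<sigma>\<^sup>2 / 2))"
    and bwd_f: "\<And>i j. i < n \<Longrightarrow> j < n \<Longrightarrow> f j \<in> borel_measurable (\<G> i \<Otimes>\<^sub>M borel)"
    and bwd_y: "\<And>i j. i < n \<Longrightarrow> j < n \<Longrightarrow> y j \<in> borel_measurable (\<G> i)"
    and bwd_S: "\<And>i j. i < n \<Longrightarrow> Suc i \<le> j \<Longrightarrow> j \<le> n \<Longrightarrow> S j \<in> borel_measurable (\<G> i)"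
  shows "(\<integral>\<^sup>+\<omega>. ennreal (exp (\<Sum>i<n. \<mu> * (f i (\<omega>, S (Suc i) \<omega> + y i \<omega>) - f i (\<omega>, S (Suc i) \<omega>)))) \<partial>M)
     \<le> (2 + (\<integral>\<^sup>+\<omega>. ennreal (exp (\<Sum>i<n. 324 * \<mu>\<^sup>2 + 86 * (\<mu>\<^sup>2 / \<sigma>\<^sup>2) * (y i \<omega>)\<^sup>2
            + 3 * (\<mu> / \<sigma>\<^sup>2) * \<bar>1 - \<rho> i\<bar> * \<bar>y i \<omega>\<bar> * \<bar>S (Suc i) \<omega>\<bar>)) \<partial>M)) / 3"
proof -
  define F where "F i = segment_mean (f i) (y i)" for i
  define Z where "Z i \<omega> = S (Suc i) \<omega> - S i \<omega>" for i \<omega>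
  define E where "E i \<omega> = S i \<omega> - \<rho> i * S (Suc i) \<omega>" for i \<omega>
  define \<kappa> where "\<kappa> i \<omega> = 324 * \<mu>\<^sup>2 + 81 * (\<mu>\<^sup>2 / \<sigma>\<^sup>2) * (y i \<omega>)\<^sup>2" for i \<omega>
  define \<kappa>' where "\<kappa>' i \<omega> = 9 / 2 * (\<mu>\<^sup>2 / \<sigma>\<^sup>2) * (y i \<omega>)\<^sup>2" for i \<omega>
  define g where "g i = (\<lambda>(\<omega>, z). 3 * (\<mu> * (f i (\<omega>, S i \<omega> + z + y i \<omega>) - f i (\<omega>, S i \<omega> + z))
      - \<mu> / \<sigma>\<^sup>2 * F i (\<omega>, S i \<omega> + z) * (y i \<omega> * z)) - \<kappa> i \<omega>)" for i
  define h where "h i = (\<lambda>(\<omega>, e). - 3 * (\<mu> / \<sigma>\<^sup>2) * F i (\<omega>, S (Suc i) \<omega>) * y i \<omega> * e - \<kappa>' i \<omega>)" for i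
  have F1: "\<bar>F i x\<bar> \<le> 1" for i x unfolding F_def by (rule segment_mean_bound[OF f1])
  have ind1: "indep_of M (\<F> i) (Z i)" if "i < n" for i using fwd[OF that] unfolding Z_def[abs_def] .
  have ind2: "indep_of M (\<G> i) (E i)" if "i < n" for i using bwd[OF that] unfolding E_def[abs_def] .
  \<comment> \<open>Forward part: \<open>g\<close> is three times the centred increment, minus its compensator \<open>\<kappa>\<close>.\<close>
  have fwd': "(\<integral>\<^sup>+\<omega>. (\<Prod>i<n. ennreal (exp (g i (\<omega>, Z i \<omega>)))) \<partial>M) \<le> 1"
  proof (rule supermartingale_product[where \<F> = \<F> and Z = Z and g = "\<lambda>i x. ennreal (exp (g i x))"])
    show "indep_of M (\<F> i) (Z i)" if "i < n" for i by (rule ind1[OF that])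
    show "(\<lambda>x. ennreal (exp (g i x))) \<in> borel_measurable (\<F> i \<Otimes>\<^sub>M borel)" if i: "i < n" for i
    proof -
      note [measurable] = fwd_f[OF i i] fwd_y[OF i i] fwd_S[OF i, of i, simplified]
      show ?thesis unfolding g_def F_def \<kappa>_def by measurable
    qed
    show "(\<lambda>\<omega>. ennreal (exp (g j (\<omega>, Z j \<omega>)))) \<in> borel_measurable (\<F> i)" if "j < i" and i: "i < n" for i j
    proof -
      have j: "j < n" "j \<le> i" "Suc j \<le> i" using that by auto
      note [measurable] = fwd_f[OF i j(1)] fwd_y[OF i j(1)] fwd_S[OF i j(2)] fwd_S[OF i j(3)]
      show ?thesis unfolding g_def F_def \<kappa>_def Z_def by measurable
    qed
    show "(\<integral>\<^sup>+z. ennreal (exp (g i (\<omega>, z))) \<partial>distr M borel (Z i)) \<le> 1" if i: "i < n" and \<omega>: "\<omega> \<in> space M" for i \<omega>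
    proof -
      have sp: "\<omega> \<in> space (\<F> i)" using ind1[OF i] \<omega> by (simp add: indep_of_def)
      note [measurable] = fwd_f[OF i i]
      have [measurable]: "(\<lambda>r. f i (\<omega>, r)) \<in> borel_measurable borel"
        using sp by measurable
      let ?k = "\<lambda>z. ennreal (exp (3 * (\<mu> * (f i (\<omega>, S i \<omega> + z + y i \<omega>) - f i (\<omega>, S i \<omega> + z))
             - \<mu> / \<sigma>\<^sup>2 * (LINT \<theta>:{0..1}|lborel. f i (\<omega>, S i \<omega> + z + \<theta> * y i \<omega>)) * (y i \<omega> * z))))"
      have "(\<integral>\<^sup>+z. ennreal (exp (g i (\<omega>, z))) \<partial>distr M borel (Z i)) = (\<integral>\<^sup>+z. ?k z * ennreal (exp (- \<kappa> i \<omega>)) \<partial>gauss \<sigma>)"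
        unfolding Z_def[abs_def] fwd_law[OF i] g_def F_def segment_mean_def
        by (intro nn_integral_cong) (simp add: ennreal_mult' [symmetric] exp_add [symmetric])
      also have "\<dots> = (\<integral>\<^sup>+z. ?k z \<partial>gauss \<sigma>) * ennreal (exp (- \<kappa> i \<omega>))"
        unfolding set_lebesgue_integral_def by (rule nn_integral_multc) measurable
      also have "\<dots> \<le> ennreal (exp (\<kappa> i \<omega>)) * ennreal (exp (- \<kappa> i \<omega>))"
        unfolding \<kappa>_def using f1 \<mu> \<sigma> by (intro mult_right_mono forward_step_exp) auto
      also have "\<dots> = 1" by (simp add: ennreal_mult' [symmetric] exp_add [symmetric])
      finally show ?thesis .
    qed
  qed
  \<comment> \<open>Backward part: the same product taken from the last step to the first one.\<close>
  have bwd': "(\<integral>\<^sup>+\<omega>. (\<Prod>i<n. ennreal (exp (h i (\<omega>, E i \<omega>)))) \<partial>M) \<le> 1"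
  proof -
    have "(\<integral>\<^sup>+\<omega>. (\<Prod>i<n. ennreal (exp (h (n - Suc i) (\<omega>, E (n - Suc i) \<omega>)))) \<partial>M) \<le> 1"
    proof (rule supermartingale_product[where \<F> = "\<lambda>i. \<G> (n - Suc i)" and Z = "\<lambda>i. E (n - Suc i)"
          and g = "\<lambda>i x. ennreal (exp (h (n - Suc i) x))"])
      show "indep_of M (\<G> (n - Suc i)) (E (n - Suc i))" if "i < n" for i
        using that by (intro ind2) auto
      show "(\<lambda>x. ennreal (exp (h (n - Suc i) x))) \<in> borel_measurable (\<G> (n - Suc i) \<Otimes>\<^sub>M borel)" if "i < n" for i
      proof -
        define k where "k = n - Suc i"
        have k: "k < n" "Suc k \<le> Suc k" "Suc k \<le> n" using that by (auto simp: k_def)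
        note [measurable] = bwd_f[OF k(1) k(1)] bwd_y[OF k(1) k(1)] bwd_S[OF k]
        show ?thesis unfolding k_def[symmetric] h_def F_def \<kappa>'_def by measurable
      qed
      show "(\<lambda>\<omega>. ennreal (exp (h (n - Suc j) (\<omega>, E (n - Suc j) \<omega>)))) \<in> borel_measurable (\<G> (n - Suc i))"
        if "j < i" and "i < n" for i j
      proof -
        define k where "k = n - Suc i"
        define l where "l = n - Suc j"
        have k: "k < n" and l: "l < n" "Suc k \<le> l" "l \<le> n" "Suc k \<le> Suc l" "Suc l \<le> n" using that by (auto simp: k_def l_def)
        note [measurable] = bwd_f[OF k l(1)] bwd_y[OF k l(1)] bwd_S[OF k l(2,3)] bwd_S[OF k l(4,5)]
        show ?thesis unfolding k_def[symmetric] l_def[symmetric] h_def F_def \<kappa>'_def E_def by measurable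
      qed
      show "(\<integral>\<^sup>+e. ennreal (exp (h (n - Suc i) (\<omega>, e))) \<partial>distr M borel (E (n - Suc i))) \<le> 1" if "i < n" and \<omega>: "\<omega> \<in> space M" for i \<omega>
      proof -
        define k where "k = n - Suc i"
        have k: "k < n" using that by (auto simp: k_def)
        have [measurable]: "E k \<in> borel_measurable M" using ind2[OF k] by (simp add: indep_of_def)
        define c where "c = - 3 * (\<mu> / \<sigma>\<^sup>2) * F k (\<omega>, S (Suc k) \<omega>) * y k \<omega>"
        have "c\<^sup>2 * \<sigma>\<^sup>2 / 2 = \<kappa>' k \<omega> * (F k (\<omega>, S (Suc k) \<omega>))\<^sup>2"
          unfolding c_def \<kappa>'_def using \<sigma> by (simp add: power_mult_distrib power_divide field_simps power2_eq_square)
        also have "\<dots> \<le> \<kappa>' k \<omega> * 1"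
          using F1[of k "(\<omega>, S (Suc k) \<omega>)"] unfolding \<kappa>'_def
          by (intro mult_left_mono) (auto simp: abs_square_le_1)
        finally have c: "c\<^sup>2 * \<sigma>\<^sup>2 / 2 \<le> \<kappa>' k \<omega>" by simp
        have "(\<integral>\<^sup>+e. ennreal (exp (h k (\<omega>, e))) \<partial>distr M borel (E k))
            = (\<integral>\<^sup>+x. ennreal (exp (c * E k x)) * ennreal (exp (- \<kappa>' k \<omega>)) \<partial>M)"
          unfolding h_def c_def by (subst nn_integral_distr) (auto simp: ennreal_mult' [symmetric] exp_add [symmetric])
        also have "\<dots> = (\<integral>\<^sup>+x. ennreal (exp (c * E k x)) \<partial>M) * ennreal (exp (- \<kappa>' k \<omega>))"
          by (rule nn_integral_multc) measurable
        also have "\<dots> \<le> ennreal (exp (\<kappa>' k \<omega>)) * ennreal (exp (- \<kappa>' k \<omega>))"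
          using order_trans[OF bwd_law[OF k, of c]] c unfolding E_def
          by (intro mult_right_mono) (auto intro: ennreal_leI)
        also have "\<dots> = 1" by (simp add: ennreal_mult' [symmetric] exp_add [symmetric])
        finally show ?thesis unfolding k_def .
      qed
    qed
    also have "(\<lambda>\<omega>. \<Prod>i<n. ennreal (exp (h (n - Suc i) (\<omega>, E (n - Suc i) \<omega>)))) = (\<lambda>\<omega>. \<Prod>i<n. ennreal (exp (h i (\<omega>, E i \<omega>))))"
      by (intro ext prod.nat_diff_reindex)
    finally show ?thesis .
  qed
  define Q where "Q \<omega> = (\<Sum>i<n. 324 * \<mu>\<^sup>2 + 86 * (\<mu>\<^sup>2 / \<sigma>\<^sup>2) * (y i \<omega>)\<^sup>2
            + 3 * (\<mu> / \<sigma>\<^sup>2) * \<bar>1 - \<rho> i\<bar> * \<bar>y i \<omega>\<bar> * \<bar>S (Suc i) \<omega>\<bar>)" for \<omega>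
  have id: "(\<lambda>\<omega>. \<omega>) \<in> M \<rightarrow>\<^sub>M \<F> i" "(\<lambda>\<omega>. \<omega>) \<in> M \<rightarrow>\<^sub>M \<G> i" if "i < n" for i
    using ind1[OF that] ind2[OF that] by (auto intro: indep_of_measurable_id)
  have mS: "S i \<in> borel_measurable M" if "i \<le> n" "n > 0" for i
  proof (cases "i < n")
    case True
    show ?thesis by (rule measurable_compose[OF id(1)[OF True] fwd_S[OF True order_refl]])
  next
    case False
    then have n: "n - 1 < n" "Suc (n - 1) \<le> i" using that by auto
    show ?thesis by (rule measurable_compose[OF id(2)[OF n(1)] bwd_S[OF n that(1)]])
  qed
  have my: "y i \<in> borel_measurable M" if "i < n" for i
    by (rule measurable_compose[OF id(1)[OF that] fwd_y[OF that that]])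
  have mf: "f i \<in> borel_measurable (M \<Otimes>\<^sub>M borel)" if "i < n" for i
  proof -
    note [measurable] = fwd_f[OF that that] id(1)[OF that]
    have "(\<lambda>(\<omega>, r). f i (\<omega>, r)) \<in> borel_measurable (M \<Otimes>\<^sub>M borel)" by measurable
    then show ?thesis by simp
  qed
  have m1 [measurable]: "(\<lambda>\<omega>. \<Prod>i<n. ennreal (exp (g i (\<omega>, Z i \<omega>)))) \<in> borel_measurable M"
  proof (rule borel_measurable_prod_ennreal)
    fix i assume "i \<in> {..<n}"
    then have i: "i < n" "i \<le> n" "Suc i \<le> n" "n > 0" by auto
    note [measurable] = mf[OF i(1)] my[OF i(1)] mS[OF i(2,4)] mS[OF i(3,4)]
    show "(\<lambda>\<omega>. ennreal (exp (g i (\<omega>, Z i \<omega>)))) \<in> borel_measurable M"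
      unfolding g_def F_def \<kappa>_def Z_def by measurable
  qed
  have m2 [measurable]: "(\<lambda>\<omega>. \<Prod>i<n. ennreal (exp (h i (\<omega>, E i \<omega>)))) \<in> borel_measurable M"
  proof (rule borel_measurable_prod_ennreal)
    fix i assume "i \<in> {..<n}"
    then have i: "i < n" "i \<le> n" "Suc i \<le> n" "n > 0" by auto
    note [measurable] = mf[OF i(1)] my[OF i(1)] mS[OF i(2,4)] mS[OF i(3,4)]
    show "(\<lambda>\<omega>. ennreal (exp (h i (\<omega>, E i \<omega>)))) \<in> borel_measurable M"
      unfolding h_def F_def \<kappa>'_def E_def by measurable
  qed
  have m3 [measurable]: "Q \<in> borel_measurable M"
    unfolding Q_def
  proof (rule borel_measurable_sum)
    fix i assume "i \<in> {..<n}"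
    then have i: "i < n" "i \<le> n" "Suc i \<le> n" "n > 0" by auto
    note [measurable] = my[OF i(1)] mS[OF i(2,4)] mS[OF i(3,4)]
    show "(\<lambda>\<omega>. 324 * \<mu>\<^sup>2 + 86 * (\<mu>\<^sup>2 / \<sigma>\<^sup>2) * (y i \<omega>)\<^sup>2
            + 3 * (\<mu> / \<sigma>\<^sup>2) * \<bar>1 - \<rho> i\<bar> * \<bar>y i \<omega>\<bar> * \<bar>S (Suc i) \<omega>\<bar>) \<in> borel_measurable M"
      by measurable
  qed
  let ?D = "\<lambda>\<omega>. \<Sum>i<n. \<mu> * (f i (\<omega>, S (Suc i) \<omega> + y i \<omega>) - f i (\<omega>, S (Suc i) \<omega>))"
  have pt: "exp (?D \<omega>)
     \<le> ((\<Prod>i<n. exp (g i (\<omega>, Z i \<omega>))) + (\<Prod>i<n. exp (h i (\<omega>, E i \<omega>))) + exp (Q \<omega>)) / 3" for \<omega>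
  proof -
    define a where "a = (\<Sum>i<n. g i (\<omega>, Z i \<omega>))"
    define b where "b = (\<Sum>i<n. h i (\<omega>, E i \<omega>))"
    have summand: "3 * (\<mu> * (f i (\<omega>, S (Suc i) \<omega> + y i \<omega>) - f i (\<omega>, S (Suc i) \<omega>)))
       \<le> g i (\<omega>, Z i \<omega>) + h i (\<omega>, E i \<omega>) + (324 * \<mu>\<^sup>2 + 86 * (\<mu>\<^sup>2 / \<sigma>\<^sup>2) * (y i \<omega>)\<^sup>2
            + 3 * (\<mu> / \<sigma>\<^sup>2) * \<bar>1 - \<rho> i\<bar> * \<bar>y i \<omega>\<bar> * \<bar>S (Suc i) \<omega>\<bar>)" for i
    proof -
      let ?F = "F i (\<omega>, S (Suc i) \<omega>)"
      \<comment> \<open>The forward step is split as \<open>Z = (1 - \<rho>) S (i + 1) - E\<close>, with the drift as the first term.\<close>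
      have eq: "3 * (\<mu> * (f i (\<omega>, S (Suc i) \<omega> + y i \<omega>) - f i (\<omega>, S (Suc i) \<omega>)))
          = g i (\<omega>, Z i \<omega>) + h i (\<omega>, E i \<omega>) + \<kappa> i \<omega> + \<kappa>' i \<omega> + 3 * (\<mu> / \<sigma>\<^sup>2) * (?F * (y i \<omega> * ((1 - \<rho> i) * S (Suc i) \<omega>)))"
        unfolding g_def h_def Z_def E_def by (simp add: algebra_simps diff_divide_distrib)
      have "?F * (y i \<omega> * ((1 - \<rho> i) * S (Suc i) \<omega>)) \<le> \<bar>?F\<bar> * (\<bar>1 - \<rho> i\<bar> * \<bar>y i \<omega>\<bar> * \<bar>S (Suc i) \<omega>\<bar>)"
        by (rule order_trans[OF abs_ge_self]) (simp add: abs_mult mult_ac)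
      also have "\<dots> \<le> 1 * (\<bar>1 - \<rho> i\<bar> * \<bar>y i \<omega>\<bar> * \<bar>S (Suc i) \<omega>\<bar>)"
        by (intro mult_right_mono F1) auto
      finally have "3 * (\<mu> / \<sigma>\<^sup>2) * (?F * (y i \<omega> * ((1 - \<rho> i) * S (Suc i) \<omega>))) \<le> 3 * (\<mu> / \<sigma>\<^sup>2) * (\<bar>1 - \<rho> i\<bar> * \<bar>y i \<omega>\<bar> * \<bar>S (Suc i) \<omega>\<bar>)"
        using \<mu> by (intro mult_left_mono) auto
      moreover have "\<kappa> i \<omega> + \<kappa>' i \<omega> \<le> 324 * \<mu>\<^sup>2 + 86 * (\<mu>\<^sup>2 / \<sigma>\<^sup>2) * (y i \<omega>)\<^sup>2"
      proof -
        have "0 \<le> \<mu>\<^sup>2 / \<sigma>\<^sup>2 * (y i \<omega>)\<^sup>2" by simp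
        then show ?thesis unfolding \<kappa>_def \<kappa>'_def mult.assoc by linarith
      qed
      ultimately show ?thesis unfolding eq by (simp add: mult.assoc)
    qed
    have "3 * (?D \<omega>) \<le> a + b + Q \<omega>"
      unfolding a_def b_def Q_def sum_distrib_left sum.distrib [symmetric]
      by (rule sum_mono) (rule summand)
    then have "exp (?D \<omega>) \<le> exp ((a + b + Q \<omega>) / 3)"
      by simp
    \<comment> \<open>Convexity of the exponential, by the tangent at the mean; this is the reason for the factors 3.\<close>
    also have "\<dots> \<le> (exp a + exp b + exp (Q \<omega>)) / 3"
    proof -
      have tangent: "exp m * (1 + (t - m)) \<le> exp t" for m t :: real
        using mult_left_mono[OF exp_ge_add_one_self[of "t - m"], of "exp m"] by (simp add: exp_add [symmetric])
      have "exp m * (1 + (a - m)) + exp m * (1 + (b - m)) + exp m * (1 + (Q \<omega> - m)) = 3 * exp m" if "m = (a + b + Q \<omega>) / 3" for m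
      proof -
        have "(1 + (a - m)) + (1 + (b - m)) + (1 + (Q \<omega> - m)) = 3" unfolding that by (simp add: field_simps)
        then show ?thesis by (metis distrib_left mult.commute)
      qed
      then show ?thesis using tangent[of "(a + b + Q \<omega>) / 3" a] tangent[of "(a + b + Q \<omega>) / 3" b] tangent[of "(a + b + Q \<omega>) / 3" "Q \<omega>"]
        by fastforce
    qed
    finally show ?thesis by (simp add: a_def b_def exp_sum)
  qed
  let ?G = "\<lambda>\<omega>. \<Prod>i<n. ennreal (exp (g i (\<omega>, Z i \<omega>)))"
  let ?H = "\<lambda>\<omega>. \<Prod>i<n. ennreal (exp (h i (\<omega>, E i \<omega>)))"
  have "(\<integral>\<^sup>+\<omega>. ennreal (exp (?D \<omega>)) \<partial>M)
     \<le> (\<integral>\<^sup>+\<omega>. (?G \<omega> + ?H \<omega> + ennreal (exp (Q \<omega>))) / 3 \<partial>M)"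
  proof (rule nn_integral_mono)
    fix \<omega>
    have "ennreal (exp (?D \<omega>))
      \<le> ennreal (((\<Prod>i<n. exp (g i (\<omega>, Z i \<omega>))) + (\<Prod>i<n. exp (h i (\<omega>, E i \<omega>))) + exp (Q \<omega>)) / 3)"
      by (intro ennreal_leI pt)
    also have "\<dots> = (ennreal (\<Prod>i<n. exp (g i (\<omega>, Z i \<omega>))) + ennreal (\<Prod>i<n. exp (h i (\<omega>, E i \<omega>))) + ennreal (exp (Q \<omega>))) / 3"
      by (simp add: divide_ennreal [symmetric] prod_nonneg add_nonneg_nonneg)
    finally show "ennreal (exp (?D \<omega>))
      \<le> (?G \<omega> + ?H \<omega> + ennreal (exp (Q \<omega>))) / 3"
      by (simp add: prod_ennreal)
  qed
  also have "\<dots> = ((\<integral>\<^sup>+\<omega>. ?G \<omega> \<partial>M) + (\<integral>\<^sup>+\<omega>. ?H \<omega> \<partial>M)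
      + (\<integral>\<^sup>+\<omega>. ennreal (exp (Q \<omega>)) \<partial>M)) / 3"
    by (simp add: nn_integral_divide nn_integral_add)
  also have "\<dots> \<le> (2 + (\<integral>\<^sup>+\<omega>. ennreal (exp (Q \<omega>)) \<partial>M)) / 3"
    using add_mono[OF fwd' bwd'] by (intro divide_right_mono_ennreal add_right_mono) (simp add: one_add_one)
  finally show ?thesis unfolding Q_def .
qed

end

section \<open>Independence within a Brownian sheet\<close>

text \<open>
  The finite linear combinations of the values of a process.
\<close>

definition process_span :: "'i set \<Rightarrow> ('i \<Rightarrow> 'a \<Rightarrow> real) \<Rightarrow> ('a \<Rightarrow> real) set" where
  "process_span T X = {\<lambda>\<omega>. \<Sum>i\<in>F. c i * X i \<omega> |F c. finite F \<and> F \<subseteq> T}"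

lemma process_span_base: "i \<in> T \<Longrightarrow> X i \<in> process_span T X"
  unfolding process_span_def by (rule CollectI, rule exI[of _ "{i}"], rule exI[of _ "\<lambda>_. 1"]) auto

lemma (in prob_space) gaussian_space_process_span:
  assumes g: "gaussian_process M T X" and m: "\<And>i. i \<in> T \<Longrightarrow> expectation (X i) = 0"
  shows "gaussian_space M (process_span T X)"
  unfolding gaussian_space_def
proof (intro conjI ballI allI)
  show "(\<lambda>_. 0) \<in> process_span T X"
    unfolding process_span_def by (rule CollectI, rule exI[of _ "{}"]) auto
next
  have rv: "gaussian_rv M (X i)" if "i \<in> T" for i
    using g[unfolded gaussian_process_def, rule_format, of "{i}" "\<lambda>_. 1"] that by simp
  have int: "integrable M (X i)" if "i \<in> T" for i
  proof -
    have "X i \<in> borel_measurable M" using rv[OF that] by (simp add: gaussian_rv_def)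
    moreover have "integrable M (\<lambda>\<omega>. (X i \<omega>)\<^sup>2)"
      using gaussian_rv_centered_cases[OF rv m, OF that that] by metis
    ultimately show ?thesis by (rule square_integrable_imp_integrable)
  qed
  fix Y assume "Y \<in> process_span T X"
  then obtain F c where F: "finite F" "F \<subseteq> T" and Y: "Y = (\<lambda>\<omega>. \<Sum>i\<in>F. c i * X i \<omega>)"
    by (auto simp: process_span_def)
  show "gaussian_rv M Y" using g F by (simp add: gaussian_process_def Y)
  show "expectation Y = 0"
    unfolding Y using F int m by (subst Bochner_Integration.integral_sum) (auto intro!: sum.neutral)
next
  fix Y Z a b assume "Y \<in> process_span T X" "Z \<in> process_span T X"
  then obtain F c F' c' where F: "finite F" "F \<subseteq> T" and Y: "Y = (\<lambda>\<omega>. \<Sum>i\<in>F. c i * X i \<omega>)"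
    and F': "finite F'" "F' \<subseteq> T" and Z: "Z = (\<lambda>\<omega>. \<Sum>i\<in>F'. c' i * X i \<omega>)"
    by (auto simp: process_span_def)
  define e where "e i = a * (if i \<in> F then c i else 0) + b * (if i \<in> F' then c' i else 0)" for i
  have sums: "(\<Sum>i\<in>F. c i * x i) = (\<Sum>i\<in>F \<union> F'. (if i \<in> F then c i else 0) * x i)"
       "(\<Sum>i\<in>F'. c' i * x i) = (\<Sum>i\<in>F \<union> F'. (if i \<in> F' then c' i else 0) * x i)" for x :: "_ \<Rightarrow> real"
    using F F' by (intro sum.mono_neutral_cong_left; auto)+
  have "(\<lambda>\<omega>. a * Y \<omega> + b * Z \<omega>) = (\<lambda>\<omega>. \<Sum>i\<in>F \<union> F'. e i * X i \<omega>)"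
    unfolding Y Z e_def sums
    by (simp only: sum_distrib_left sum.distrib distrib_right mult.assoc)
  then show "(\<lambda>\<omega>. a * Y \<omega> + b * Z \<omega>) \<in> process_span T X"
    using F F' unfolding process_span_def by blast
qed

lemma process_span_measurable:
  assumes "Y \<in> process_span T X" "\<And>i. i \<in> T \<Longrightarrow> X i \<in> borel_measurable \<A>"
  shows "Y \<in> borel_measurable \<A>"
  using assms by (auto simp: process_span_def intro!: borel_measurable_sum borel_measurable_times)

lemma borel_measurable_vec_lambda:
  fixes f :: "'d::finite \<Rightarrow> 'a \<Rightarrow> real"
  assumes "\<And>k. f k \<in> borel_measurable \<A>"
  shows "(\<lambda>x. \<chi> k. f k x) \<in> borel_measurable \<A>"
  by (subst borel_measurable_euclidean_space) (auto simp: Basis_vec_def inner_axis assms)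

text \<open>
  The Gaussian space spanned by one component of a sheet over the unit square.
\<close>

definition component_span :: "(real \<times> real \<Rightarrow> 'a \<Rightarrow> real ^ 'd) \<Rightarrow> 'd \<Rightarrow> ('a \<Rightarrow> real) set" where
  "component_span W k = process_span unit_square (\<lambda>p \<omega>. W p \<omega> $ k)"

context prob_space
begin

context
  fixes W :: "real \<times> real \<Rightarrow> 'a \<Rightarrow> real ^ 'd"
  assumes W: "brownian_sheet M W"
begin

lemma component_sheet: "real_brownian_sheet M (\<lambda>p \<omega>. W p \<omega> $ k)"
  using W by (simp add: brownian_sheet_def)

lemma gaussian_space_component_span: "gaussian_space M (component_span W k)"
  unfolding component_span_def
  using component_sheet[of k] by (intro gaussian_space_process_span) (auto simp: real_brownian_sheet_def)

lemma component_in_span: "p \<in> unit_square \<Longrightarrow> (\<lambda>\<omega>. W p \<omega> $ k) \<in> component_span W k"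
  unfolding component_span_def by (rule process_span_base)

lemma component_measurable: "p \<in> unit_square \<Longrightarrow> (\<lambda>\<omega>. W p \<omega> $ k) \<in> borel_measurable M"
  by (rule gaussian_space_measurable[OF gaussian_space_component_span component_in_span])

lemma component_covariance:
  assumes "s \<in> {0..1}" "t \<in> {0..1}" "s' \<in> {0..1}" "t' \<in> {0..1}"
  shows "expectation (\<lambda>\<omega>. W (s, t) \<omega> $ k * W (s', t') \<omega> $ k) = min s s' * min t t'"
proof -
  have "expectation (\<lambda>\<omega>. W p \<omega> $ k) = 0" if "p \<in> unit_square" for p
    using component_sheet[of k] that unfolding real_brownian_sheet_def by blast
  moreover have "covariance M (\<lambda>\<omega>. W (s, t) \<omega> $ k) (\<lambda>\<omega>. W (s', t') \<omega> $ k) = min s s' * min t t'"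
    using component_sheet[of k] assms unfolding real_brownian_sheet_def by blast
  ultimately show ?thesis using assms by (simp add: covariance_def)
qed

text \<open>
  A variable \<open>X\<close> from the span of component \<open>k\<close> is independent of the sigma-algebra generated by finitely many
  variables of the same span that are uncorrelated with \<open>X\<close> and by all other components of the sheet. The algebra is generated by
  the intersections of an event of the former with an event of the latter kind, which form a pi-system.
\<close>

lemma sheet_past_algebra:
  assumes X: "X \<in> component_span W k" and J: "finite J" "J \<subseteq> component_span W k"
    and cov: "\<And>V. V \<in> J \<Longrightarrow> expectation (\<lambda>\<omega>. X \<omega> * V \<omega>) = 0"
  shows "\<exists>\<F>. indep_of M \<F> X \<and> (\<forall>V\<in>J. V \<in> borel_measurable \<F>) \<and>
    (\<forall>j p. j \<noteq> k \<longrightarrow> p \<in> unit_square \<longrightarrow> (\<lambda>\<omega>. W p \<omega> $ j) \<in> borel_measurable \<F>)"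
proof -
  define P where "P = (\<lambda>i \<omega>. \<lambda>p\<in>unit_square. W p \<omega> $ i)"
  define N where "N = (\<lambda>_ :: 'd. PiM unit_square (\<lambda>_. borel :: real measure))"
  define \<K> where "\<K> = vimage_algebra (space M) (\<lambda>\<omega>. restrict (\<lambda>i. P i \<omega>) {k}) (PiM {k} N)"
  define \<O> where "\<O> = vimage_algebra (space M) (\<lambda>\<omega>. restrict (\<lambda>i. P i \<omega>) (UNIV - {k})) (PiM (UNIV - {k}) N)"
  have indP: "indep_vars N P UNIV"
    using W by (simp add: brownian_sheet_def P_def N_def)
  have ind: "indep_set (sets \<K>) (sets \<O>)"
    using indep_var_restrict[OF indP, of "{k}" "UNIV - {k}"]
    unfolding indep_var_eq \<K>_def \<O>_def sets_vimage_algebra by auto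
  have sub: "sets \<K> \<subseteq> sets M" "sets \<O> \<subseteq> sets M"
    using ind by (auto simp: indep_sets2_eq)
  have [simp]: "space \<K> = space M" "space \<O> = space M" by (simp_all add: \<K>_def \<O>_def)
  have coord: "(\<lambda>\<omega>. W p \<omega> $ j) \<in> borel_measurable (vimage_algebra (space M) (\<lambda>\<omega>. restrict (\<lambda>i. P i \<omega>) A) (PiM A N))"
    if p: "p \<in> unit_square" and j: "j \<in> A" for p j A
  proof -
    have "(\<lambda>\<omega>. restrict (\<lambda>i. P i \<omega>) A) \<in> vimage_algebra (space M) (\<lambda>\<omega>. restrict (\<lambda>i. P i \<omega>) A) (PiM A N) \<rightarrow>\<^sub>M PiM A N"
      by (rule measurable_vimage_algebra1) (auto simp: P_def N_def space_PiM)
    then have "(\<lambda>\<omega>. restrict (\<lambda>i. P i \<omega>) A j p) \<in> borel_measurable (vimage_algebra (space M) (\<lambda>\<omega>. restrict (\<lambda>i. P i \<omega>) A) (PiM A N))"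
      by (rule measurable_compose[OF measurable_compose[OF _ measurable_component_singleton[OF j]]])
         (simp add: N_def measurable_component_singleton p)
    then show ?thesis using p j by (simp add: P_def)
  qed
  have spanK: "Y \<in> borel_measurable \<K>" if "Y \<in> component_span W k" for Y
    using that unfolding component_span_def by (rule process_span_measurable) (simp add: \<K>_def coord)
  define ev where "ev C = {\<omega>\<in>space M. \<forall>V\<in>J. V \<omega> \<in> C V}" for C :: "('a \<Rightarrow> real) \<Rightarrow> real set"
  define G where "G = {ev C \<inter> B |C B. (\<forall>V. C V \<in> sets borel) \<and> B \<in> sets \<O>}"
  have evK: "ev C \<in> sets \<K>" if C: "\<forall>V. C V \<in> sets borel" for C
  proof -
    have "{\<omega>\<in>space \<K>. \<forall>V\<in>J. V \<omega> \<in> C V} \<in> sets \<K>"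
    proof (rule sets.sets_Collect_finite_All[OF _ J(1)])
      fix V assume "V \<in> J"
      then have "V \<in> borel_measurable \<K>" using J(2) spanK by auto
      then show "{\<omega>\<in>space \<K>. V \<omega> \<in> C V} \<in> sets \<K>"
        using measurable_sets[of V \<K> borel "C V"] C by (simp add: vimage_def Int_def conj_commute)
    qed
    then show ?thesis by (simp add: ev_def)
  qed
  have XK: "{\<omega>\<in>space M. X \<omega> \<in> A} \<in> sets \<K>" if "A \<in> sets borel" for A
    using measurable_sets[OF spanK[OF X] that] by (simp add: vimage_def Int_def conj_commute)
  have GM: "G \<subseteq> sets M" unfolding G_def using evK sub by auto
  have Gsp: "G \<subseteq> Pow (space M)" using GM sets.sets_into_space by blast
  define \<X> where "\<X> = {{\<omega>\<in>space M. X \<omega> \<in> A} |A. A \<in> sets borel}"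
  have "indep_set G \<X>"
    unfolding indep_sets2_eq
  proof (intro conjI ballI)
    show "G \<subseteq> events" by (rule GM)
    show "\<X> \<subseteq> events" unfolding \<X>_def using XK sub by auto
    fix a b assume "a \<in> G" "b \<in> \<X>"
    then obtain C B A where C: "\<forall>V. C V \<in> sets borel" and B: "B \<in> sets \<O>" and a: "a = ev C \<inter> B"
      and A: "A \<in> sets borel" and b: "b = {\<omega>\<in>space M. X \<omega> \<in> A}" by (auto simp: G_def \<X>_def)
    have e: "b \<inter> ev C = {\<omega>\<in>space M. X \<omega> \<in> A \<and> (\<forall>V\<in>J. V \<omega> \<in> C V)}" by (auto simp: b ev_def)
    have "prob (a \<inter> b) = prob ((b \<inter> ev C) \<inter> B)" by (simp add: a Int_ac)
    also have "\<dots> = prob (b \<inter> ev C) * prob B"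
      using B A C evK XK by (intro indep_setD[OF ind]) (auto simp: b)
    also have "prob (b \<inter> ev C) = prob b * prob (ev C)"
      unfolding e unfolding b ev_def
      by (rule gaussian_space_indep_event[OF gaussian_space_component_span[of k] X J(1), where V = "\<lambda>V. V"])
         (use J cov A C in auto)
    also have "prob b * prob (ev C) * prob B = prob (ev C \<inter> B) * prob b"
      using indep_setD[OF ind evK[OF C] B] by simp
    finally show "prob (a \<inter> b) = prob a * prob b" by (simp add: a)
  qed
  moreover have "Int_stable G"
  proof (rule Int_stableI)
    fix a b assume "a \<in> G" "b \<in> G"
    then obtain C B C' B' where "\<forall>V. C V \<in> sets borel" "B \<in> sets \<O>" "a = ev C \<inter> B"
      "\<forall>V. C' V \<in> sets borel" "B' \<in> sets \<O>" "b = ev C' \<inter> B'" by (auto simp: G_def)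
    then show "a \<inter> b \<in> G"
      unfolding G_def
      by (intro CollectI exI[of _ "\<lambda>V. C V \<inter> C' V"] exI[of _ "B \<inter> B'"]) (auto simp: ev_def)
  qed
  moreover have "Int_stable \<X>"
  proof (rule Int_stableI)
    fix a b assume "a \<in> \<X>" "b \<in> \<X>"
    then obtain A A' where "A \<in> sets borel" "a = {\<omega>\<in>space M. X \<omega> \<in> A}" "A' \<in> sets borel" "b = {\<omega>\<in>space M. X \<omega> \<in> A'}"
      by (auto simp: \<X>_def)
    then show "a \<inter> b \<in> \<X>" unfolding \<X>_def by (intro CollectI exI[of _ "A \<inter> A'"]) auto
  qed
  ultimately have ind': "indep_set (sigma_sets (space M) G) (sigma_sets (space M) \<X>)"
    by (rule indep_set_sigma_sets)
  define \<F> where "\<F> = sigma (space M) G"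
  have F: "space \<F> = space M" "sets \<F> = sigma_sets (space M) G"
    using Gsp by (simp_all add: \<F>_def)
  show ?thesis
  proof (intro exI[of _ \<F>] conjI ballI allI impI)
    show "indep_of M \<F> X"
      unfolding indep_of_def F
    proof (intro conjI ballI refl)
      show "sigma_sets (space M) G \<subseteq> sets M" using GM by (rule sets.sigma_sets_subset)
      show "X \<in> borel_measurable M" by (rule gaussian_space_measurable[OF gaussian_space_component_span X])
      fix A :: "'a set" and B :: "real set" assume "A \<in> sigma_sets (space M) G" "B \<in> sets borel"
      then show "prob (A \<inter> {\<omega>\<in>space M. X \<omega> \<in> B}) = prob A * prob {\<omega>\<in>space M. X \<omega> \<in> B}"
        by (intro indep_setD[OF ind']) (auto simp: \<X>_def)
    qed
    show "V \<in> borel_measurable \<F>" if "V \<in> J" for V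
    proof (rule measurableI)
      fix A :: "real set" assume A: "A \<in> sets borel"
      have "V -` A \<inter> space \<F> = ev (\<lambda>U. if U = V then A else UNIV) \<inter> space M"
        using that by (auto simp: ev_def F)
      also have "\<dots> \<in> G" unfolding G_def
      proof (intro CollectI exI conjI)
        show "space M \<in> sets \<O>" using sets.top[of \<O>] by simp
      qed (use A in auto)
      finally show "V -` A \<inter> space \<F> \<in> sets \<F>" by (simp add: F)
    qed auto
    show "(\<lambda>\<omega>. W p \<omega> $ j) \<in> borel_measurable \<F>" if "j \<noteq> k" and p: "p \<in> unit_square" for j p
    proof (rule measurableI)
      fix A :: "real set" assume A: "A \<in> sets borel"
      have m: "(\<lambda>\<omega>. W p \<omega> $ j) \<in> borel_measurable \<O>" unfolding \<O>_def using that by (intro coord) auto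
      have "(\<lambda>\<omega>. W p \<omega> $ j) -` A \<inter> space \<F> = ev (\<lambda>_. UNIV) \<inter> ((\<lambda>\<omega>. W p \<omega> $ j) -` A \<inter> space \<O>)"
        by (auto simp: ev_def F)
      also have "\<dots> \<in> G" unfolding G_def
        using measurable_sets[OF m A] by (intro CollectI exI conjI) auto
      finally show "(\<lambda>\<omega>. W p \<omega> $ j) -` A \<inter> space \<F> \<in> sets \<F>" by (simp add: F)
    qed auto
  qed
qed

end
end

section \<open>Shifting one coordinate\<close>

lemma sum_inverse_sqrt_le: "(\<Sum>i<n. 1 / sqrt (real (Suc i))) \<le> 2 * sqrt (real n)"
proof (induction n)
  case (Suc n)
  have "sqrt (real n) * sqrt (real (Suc n)) \<le> (real n + real (Suc n)) / 2"
    using arith_geo_mean_sqrt[of "real n" "real (Suc n)"] by (simp add: real_sqrt_mult)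
  then have "1 / sqrt (real (Suc n)) + 2 * sqrt (real n) \<le> 2 * sqrt (real (Suc n))"
    by (simp add: field_simps)
  then show ?case using Suc by simp
qed simp

lemma exp_weighted_sum_le:
  fixes w q :: "nat \<Rightarrow> real"
  assumes n: "n > 0" and w: "\<And>i. i < n \<Longrightarrow> w i > 0" and w2: "(\<Sum>i<n. w i) \<le> 2" and q: "\<And>i. i < n \<Longrightarrow> q i \<ge> 0"
  shows "exp (\<Sum>i<n. w i * q i) \<le> (\<Sum>i<n. w i / (\<Sum>j<n. w j) * exp (2 * q i))"
proof -
  define B where "B = (\<Sum>j<n. w j)"
  have B: "B > 0" unfolding B_def using n w by (intro sum_pos) auto
  have "exp (\<Sum>i<n. (w i / B) *\<^sub>R (B * q i)) \<le> (\<Sum>i<n. w i / B * exp (B * q i))"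
  proof (rule convex_on_sum[where C = UNIV and f = exp])
    show "(\<Sum>i<n. w i / B) = 1" using B by (simp add: sum_divide_distrib [symmetric] B_def)
    show "convex_on UNIV (exp :: real \<Rightarrow> real)" by (rule exp_convex)
  qed (use n w B in \<open>auto intro: less_imp_le\<close>)
  also have "\<dots> \<le> (\<Sum>i<n. w i / B * exp (2 * q i))"
    using w B q w2 by (intro sum_mono mult_left_mono) (auto simp: B_def[symmetric] less_imp_le intro!: mult_right_mono)
  also have "(\<Sum>i<n. (w i / B) *\<^sub>R (B * q i)) = (\<Sum>i<n. w i * q i)"
    using B by (intro sum.cong) auto
  finally show ?thesis by (simp add: B_def)
qed

text \<open>
  The position at time \<open>t\<close> whose coordinates in \<open>A\<close> are taken from \<open>x' + W (s', t)\<close> and whose other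
  coordinates are taken from \<open>x + W (s, t)\<close>. It interpolates between the two positions to be compared, one
  coordinate at a time.
\<close>

definition hybrid :: "(real \<times> real \<Rightarrow> 'a \<Rightarrow> real ^ 'd) \<Rightarrow> real \<Rightarrow> real \<Rightarrow> real ^ 'd \<Rightarrow> real ^ 'd \<Rightarrow> 'd set \<Rightarrow> real \<Rightarrow> 'a \<Rightarrow> real ^ 'd" where
  "hybrid W s s' x x' A t \<omega> = (\<chi> j. if j \<in> A then x' $ j + W (s', t) \<omega> $ j else x $ j + W (s, t) \<omega> $ j)"

context prob_space
begin

lemma gaussian_space_cov_comb_left:
  assumes "gaussian_space M H" "X \<in> H" "Y \<in> H" "Z \<in> H"
  shows "expectation (\<lambda>\<omega>. (X \<omega> - b * Y \<omega>) * Z \<omega>) = expectation (\<lambda>\<omega>. X \<omega> * Z \<omega>) - b * expectation (\<lambda>\<omega>. Y \<omega> * Z \<omega>)"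
  using gaussian_space_cov_comb[OF assms(1,4,2,3), of 1 "-b"] by (simp add: mult.commute)

lemma gaussian_space_variance_comb:
  assumes H: "gaussian_space M H" and X: "X \<in> H" and Y: "Y \<in> H"
  shows "expectation (\<lambda>\<omega>. (X \<omega> - b * Y \<omega>)\<^sup>2)
     = expectation (\<lambda>\<omega>. X \<omega> * X \<omega>) - 2 * b * expectation (\<lambda>\<omega>. X \<omega> * Y \<omega>) + b\<^sup>2 * expectation (\<lambda>\<omega>. Y \<omega> * Y \<omega>)"
proof -
  have "(\<lambda>\<omega>. (X \<omega> - b * Y \<omega>)\<^sup>2) = (\<lambda>\<omega>. X \<omega> * X \<omega> - 2 * b * (X \<omega> * Y \<omega>) + b\<^sup>2 * (Y \<omega> * Y \<omega>))"
    by (auto simp: power2_eq_square algebra_simps)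
  then show ?thesis
    using gaussian_space_product_integrable[OF H X X] gaussian_space_product_integrable[OF H X Y] gaussian_space_product_integrable[OF H Y Y]
    by simp
qed

lemma gaussian_rv_distr:
  assumes "gaussian_rv M X" "expectation X = 0" "expectation (\<lambda>\<omega>. (X \<omega>)\<^sup>2) = \<sigma>\<^sup>2" "\<sigma> > 0"
  shows "distr M borel X = gauss \<sigma>"
  using assms(1,2)
proof (cases rule: gaussian_rv_centered_cases)
  case degenerate
  then show ?thesis using assms by simp
next
  case (normal \<tau>)
  then have "\<tau> = \<sigma>" using assms by (simp add: power2_eq_iff_nonneg)
  with normal show ?thesis by simp
qed

context
  fixes W :: "real \<times> real \<Rightarrow> 'a \<Rightarrow> real ^ 'd"
  assumes W: "brownian_sheet M W"
begin

text \<open>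
  The estimate for a Gaussian walk, applied to coordinate \<open>k\<close> of the sheet along an arithmetic
  progression of times. The walk is \<open>S i = W (s, T i)\<close>; the shift \<open>y\<close> contains
  \<open>W (s', T) - W (s, T)\<close>, which is uncorrelated with every \<open>S j\<close>. Reversed in time, the best linear prediction
  of \<open>S i\<close> from \<open>S (i + 1)\<close> has the coefficient \<open>T i / T (i + 1)\<close>, and the residual is uncorrelated with
  \<open>S (i + 1), \<dots>, S n\<close>.
\<close>

lemma hybrid_exp_moment:
  fixes \<beta> :: "real \<times> (real ^ 'd) \<Rightarrow> real" and T \<theta> :: "nat \<Rightarrow> real" and x x' :: "real ^ 'd"
  assumes [measurable]: "\<beta> \<in> borel_measurable borel" and \<beta>: "\<And>p. \<bar>\<beta> p\<bar> \<le> 1"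
    and s: "0 < s" "s \<le> s'" "s' \<le> 1" and T0: "T 0 \<ge> 0" and h: "h > 0" and step: "\<And>i. T (Suc i) = T i + h" and Tn: "T n \<le> 1"
    and \<mu>: "\<mu> \<ge> 0" and k: "k \<notin> A"
  defines "y \<equiv> \<lambda>i \<omega>. x' $ k - x $ k + (W (s', T (Suc i)) \<omega> $ k - W (s, T (Suc i)) \<omega> $ k)"
  shows "(\<integral>\<^sup>+\<omega>. ennreal (exp (\<Sum>i<n. \<mu> * (\<beta> (\<theta> i, hybrid W s s' x x' (insert k A) (T (Suc i)) \<omega>)
              - \<beta> (\<theta> i, hybrid W s s' x x' A (T (Suc i)) \<omega>)))) \<partial>M)
     \<le> (2 + (\<integral>\<^sup>+\<omega>. ennreal (exp (\<Sum>i<n. 324 * \<mu>\<^sup>2 + 86 * (\<mu>\<^sup>2 / (s * h)) * (y i \<omega>)\<^sup>2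
            + 3 * (\<mu> / (s * h)) * (h / T (Suc i)) * \<bar>y i \<omega>\<bar> * \<bar>W (s, T (Suc i)) \<omega> $ k\<bar>)) \<partial>M)) / 3"
proof -
  have Ti: "T i = T 0 + real i * h" for i by (induction i) (auto simp: step algebra_simps)
  have mono: "T i \<le> T j" if "i \<le> j" for i j using that h Ti[of i] Ti[of j] by (simp add: mult_right_mono)
  have T01: "T i \<in> {0..1}" if "i \<le> n" for i using mono[OF that] mono[of 0 i] Tn T0 by simp
  have Tpos: "T (Suc i) > 0" for i using T0 h Ti[of "Suc i"] by (simp add: add_nonneg_pos)
  have s01: "s \<in> {0..1}" "s' \<in> {0..1}" using s by auto
  define H where "H = component_span W k"
  have H: "gaussian_space M H" unfolding H_def by (rule gaussian_space_component_span[OF W])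
  define S where "S i \<omega> = W (s, T i) \<omega> $ k" for i \<omega>
  define Y where "Y i \<omega> = W (s', T (Suc i)) \<omega> $ k - W (s, T (Suc i)) \<omega> $ k" for i \<omega>
  define S' where "S' i \<omega> = W (s', T i) \<omega> $ k" for i \<omega>
  have SH: "S i \<in> H" "S' i \<in> H" if "i \<le> n" for i
    unfolding S_def[abs_def] S'_def[abs_def] H_def using T01[OF that] s01 by (auto intro!: component_in_span[OF W])
  have YH: "Y i \<in> H" if "i < n" for i
    using gaussian_space_diff[OF H SH(2,1), of "Suc i" "Suc i"] that unfolding Y_def S_def S'_def by simp
  have cSS: "expectation (\<lambda>\<omega>. S i \<omega> * S j \<omega>) = s * min (T i) (T j)"
    and cSS': "expectation (\<lambda>\<omega>. S i \<omega> * S' j \<omega>) = s * min (T i) (T j)" if "i \<le> n" "j \<le> n" for i j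
    unfolding S_def S'_def using component_covariance[OF W, of s "T i" _ "T j" k] s s01 T01[OF that(1)] T01[OF that(2)] by auto
  have cSY: "expectation (\<lambda>\<omega>. S i \<omega> * Y j \<omega>) = 0" if "i \<le> n" "j < n" for i j
  proof -
    have "expectation (\<lambda>\<omega>. S i \<omega> * Y j \<omega>) = expectation (\<lambda>\<omega>. S i \<omega> * (1 * S' (Suc j) \<omega> + -1 * S (Suc j) \<omega>))"
      by (simp add: Y_def S_def S'_def)
    also have "\<dots> = 0"
      using that by (subst gaussian_space_cov_comb[OF H]) (auto simp: SH cSS cSS')
    finally show ?thesis .
  qed
  define \<rho> where "\<rho> i = T i / T (Suc i)" for i
  define \<sigma> where "\<sigma> = sqrt (s * h)"
  have \<sigma>: "\<sigma> > 0" "\<sigma>\<^sup>2 = s * h" using s h by (simp_all add: \<sigma>_def)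
  have ZH: "(\<lambda>\<omega>. S (Suc i) \<omega> - S i \<omega>) \<in> H" if "i < n" for i
    using that by (intro gaussian_space_diff[OF H] SH) auto
  have EH: "(\<lambda>\<omega>. S i \<omega> - \<rho> i * S (Suc i) \<omega>) \<in> H" if "i < n" for i
    using gaussian_space_comb[OF H SH(1) SH(1), of i "Suc i" 1 "- \<rho> i"] that by simp
  define PF where "PF i \<F> \<longleftrightarrow> indep_of M \<F> (\<lambda>\<omega>. S (Suc i) \<omega> - S i \<omega>) \<and> (\<forall>V\<in>S ` {..i} \<union> Y ` {..<n}. V \<in> borel_measurable \<F>) \<and>
      (\<forall>j p. j \<noteq> k \<longrightarrow> p \<in> unit_square \<longrightarrow> (\<lambda>\<omega>. W p \<omega> $ j) \<in> borel_measurable \<F>)" for i \<F>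
  have "\<exists>\<F>. PF i \<F>" if i: "i < n" for i
  proof -
    have "expectation (\<lambda>\<omega>. (S (Suc i) \<omega> - S i \<omega>) * V \<omega>) = 0" if V: "V \<in> S ` {..i} \<union> Y ` {..<n}" for V
    proof -
      have VH: "V \<in> H" using V i SH YH by auto
      have "expectation (\<lambda>\<omega>. (S (Suc i) \<omega> - S i \<omega>) * V \<omega>) = expectation (\<lambda>\<omega>. S (Suc i) \<omega> * V \<omega>) - expectation (\<lambda>\<omega>. S i \<omega> * V \<omega>)"
        using gaussian_space_cov_comb_left[OF H SH(1)[of "Suc i"] SH(1)[of i] VH, of 1] i by simp
      also have "\<dots> = 0" using V i by (auto simp: cSS cSY min_absorb2 mono)
      finally show ?thesis .
    qed
    note cov = this
    have fin: "finite (S ` {..i} \<union> Y ` {..<n})" and sub: "S ` {..i} \<union> Y ` {..<n} \<subseteq> component_span W k" using SH YH i by (auto simp: H_def)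
    show ?thesis
      unfolding PF_def by (rule sheet_past_algebra[OF W ZH[OF i, unfolded H_def] fin sub cov])
  qed
  then have "\<forall>i\<in>{..<n}. \<exists>\<F>. PF i \<F>" by simp
  from bchoice[OF this] obtain \<F> where \<F>_P: "\<forall>i\<in>{..<n}. PF i (\<F> i)" by blast
  have \<F>: "indep_of M (\<F> i) (\<lambda>\<omega>. S (Suc i) \<omega> - S i \<omega>)" "V \<in> S ` {..i} \<union> Y ` {..<n} \<Longrightarrow> V \<in> borel_measurable (\<F> i)"
     "j \<noteq> k \<Longrightarrow> p \<in> unit_square \<Longrightarrow> (\<lambda>\<omega>. W p \<omega> $ j) \<in> borel_measurable (\<F> i)" if "i < n" for i j p V
  proof -
    have q: "i < n \<Longrightarrow> PF i (\<F> i)" for i using \<F>_P by simp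
    note q = q[OF that, unfolded PF_def]
    show "indep_of M (\<F> i) (\<lambda>\<omega>. S (Suc i) \<omega> - S i \<omega>)" by (rule conjunct1[OF q])
    show "V \<in> S ` {..i} \<union> Y ` {..<n} \<Longrightarrow> V \<in> borel_measurable (\<F> i)"
      by (rule bspec[OF conjunct1[OF conjunct2[OF q]]])
    show "j \<noteq> k \<Longrightarrow> p \<in> unit_square \<Longrightarrow> (\<lambda>\<omega>. W p \<omega> $ j) \<in> borel_measurable (\<F> i)"
      by (rule conjunct2[OF conjunct2[OF q], rule_format])
  qed
  define PG where "PG i \<G> \<longleftrightarrow> indep_of M \<G> (\<lambda>\<omega>. S i \<omega> - \<rho> i * S (Suc i) \<omega>) \<and> (\<forall>V\<in>S ` {Suc i..n} \<union> Y ` {..<n}. V \<in> borel_measurable \<G>) \<and>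
      (\<forall>j p. j \<noteq> k \<longrightarrow> p \<in> unit_square \<longrightarrow> (\<lambda>\<omega>. W p \<omega> $ j) \<in> borel_measurable \<G>)" for i \<G>
  have "\<exists>\<G>. PG i \<G>" if i: "i < n" for i
  proof -
    have "expectation (\<lambda>\<omega>. (S i \<omega> - \<rho> i * S (Suc i) \<omega>) * V \<omega>) = 0" if V: "V \<in> S ` {Suc i..n} \<union> Y ` {..<n}" for V
    proof -
      have VH: "V \<in> H" using V i SH YH by auto
      have "expectation (\<lambda>\<omega>. (S i \<omega> - \<rho> i * S (Suc i) \<omega>) * V \<omega>) = expectation (\<lambda>\<omega>. S i \<omega> * V \<omega>) - \<rho> i * expectation (\<lambda>\<omega>. S (Suc i) \<omega> * V \<omega>)"
        using gaussian_space_cov_comb_left[OF H SH(1)[of i] SH(1)[of "Suc i"] VH, of "\<rho> i"] i by simp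
      also have "\<dots> = 0"
      proof (cases "V \<in> Y ` {..<n}")
        case True
        then show ?thesis using i by (auto simp: cSY)
      next
        case False
        then obtain j where j: "V = S j" "Suc i \<le> j" "j \<le> n" using V by auto
        have "min (T i) (T j) = T i" "min (T (Suc i)) (T j) = T (Suc i)"
          using mono[of i j] mono[of "Suc i" j] j by auto
        then show ?thesis using i j Tpos[of i] by (simp add: cSS \<rho>_def)
      qed
      finally show ?thesis .
    qed
    note cov = this
    have fin: "finite (S ` {Suc i..n} \<union> Y ` {..<n})" and sub: "S ` {Suc i..n} \<union> Y ` {..<n} \<subseteq> component_span W k" using SH YH i by (auto simp: H_def)
    show ?thesis
      unfolding PG_def by (rule sheet_past_algebra[OF W EH[OF i, unfolded H_def] fin sub cov])
  qed
  then have "\<forall>i\<in>{..<n}. \<exists>\<G>. PG i \<G>" by simp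
  from bchoice[OF this] obtain \<G> where \<G>_P: "\<forall>i\<in>{..<n}. PG i (\<G> i)" by blast
  have \<G>: "indep_of M (\<G> i) (\<lambda>\<omega>. S i \<omega> - \<rho> i * S (Suc i) \<omega>)" "V \<in> S ` {Suc i..n} \<union> Y ` {..<n} \<Longrightarrow> V \<in> borel_measurable (\<G> i)"
     "j \<noteq> k \<Longrightarrow> p \<in> unit_square \<Longrightarrow> (\<lambda>\<omega>. W p \<omega> $ j) \<in> borel_measurable (\<G> i)" if "i < n" for i j p V
  proof -
    have q: "i < n \<Longrightarrow> PG i (\<G> i)" for i using \<G>_P by simp
    note q = q[OF that, unfolded PG_def]
    show "indep_of M (\<G> i) (\<lambda>\<omega>. S i \<omega> - \<rho> i * S (Suc i) \<omega>)" by (rule conjunct1[OF q])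
    show "V \<in> S ` {Suc i..n} \<union> Y ` {..<n} \<Longrightarrow> V \<in> borel_measurable (\<G> i)"
      by (rule bspec[OF conjunct1[OF conjunct2[OF q]]])
    show "j \<noteq> k \<Longrightarrow> p \<in> unit_square \<Longrightarrow> (\<lambda>\<omega>. W p \<omega> $ j) \<in> borel_measurable (\<G> i)"
      by (rule conjunct2[OF conjunct2[OF q], rule_format])
  qed
  define f where "f i = (\<lambda>(\<omega>, r). \<beta> (\<theta> i, \<chi> j. if j \<in> A then x' $ j + W (s', T (Suc i)) \<omega> $ j
      else if j = k then x $ k + r else x $ j + W (s, T (Suc i)) \<omega> $ j))" for i
  have f_meas: "f i \<in> borel_measurable (\<A> \<Otimes>\<^sub>M borel)"
    if "i < n" and m: "\<And>j p. j \<noteq> k \<Longrightarrow> p \<in> unit_square \<Longrightarrow> (\<lambda>\<omega>. W p \<omega> $ j) \<in> borel_measurable \<A>" for i \<A>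
  proof -
    have "(\<lambda>u. if j \<in> A then x' $ j + W (s', T (Suc i)) (fst u) $ j else if j = k then x $ k + snd u else x $ j + W (s, T (Suc i)) (fst u) $ j)
       \<in> borel_measurable (\<A> \<Otimes>\<^sub>M borel)" for j
    proof (cases "j = k")
      case True
      then show ?thesis using k by simp
    next
      case False
      have "(s, T (Suc i)) \<in> unit_square" "(s', T (Suc i)) \<in> unit_square" using s01 T01[of "Suc i"] that by auto
      note [measurable] = m[OF False this(1)] m[OF False this(2)]
      show ?thesis using False by simp
    qed
    note [measurable] = borel_measurable_vec_lambda[OF this]
    have "(\<lambda>u. \<beta> (\<theta> i, \<chi> j. if j \<in> A then x' $ j + W (s', T (Suc i)) (fst u) $ j else if j = k then x $ k + snd u else x $ j + W (s, T (Suc i)) (fst u) $ j))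
       \<in> borel_measurable (\<A> \<Otimes>\<^sub>M borel)"
      by measurable
    then show ?thesis by (simp add: f_def case_prod_beta')
  qed
  have hyb: "f i (\<omega>, S (Suc i) \<omega> + y i \<omega>) = \<beta> (\<theta> i, hybrid W s s' x x' (insert k A) (T (Suc i)) \<omega>)"
     "f i (\<omega>, S (Suc i) \<omega>) = \<beta> (\<theta> i, hybrid W s s' x x' A (T (Suc i)) \<omega>)" for i \<omega>
    using k by (auto simp: f_def hybrid_def y_def S_def vec_eq_iff intro!: arg_cong[where f = \<beta>])
  have y_eq: "y i = (\<lambda>\<omega>. x' $ k - x $ k + Y i \<omega>)" for i by (auto simp: y_def Y_def)
  have rho: "\<bar>1 - \<rho> i\<bar> = h / T (Suc i)" for i
  proof -
    have "1 - \<rho> i = h / T (Suc i)" using Tpos[of i] by (simp add: \<rho>_def field_simps step)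
    then show ?thesis using h Tpos[of i] by simp
  qed
  have "(\<integral>\<^sup>+\<omega>. ennreal (exp (\<Sum>i<n. \<mu> * (f i (\<omega>, S (Suc i) \<omega> + y i \<omega>) - f i (\<omega>, S (Suc i) \<omega>)))) \<partial>M)
     \<le> (2 + (\<integral>\<^sup>+\<omega>. ennreal (exp (\<Sum>i<n. 324 * \<mu>\<^sup>2 + 86 * (\<mu>\<^sup>2 / \<sigma>\<^sup>2) * (y i \<omega>)\<^sup>2
            + 3 * (\<mu> / \<sigma>\<^sup>2) * \<bar>1 - \<rho> i\<bar> * \<bar>y i \<omega>\<bar> * \<bar>S (Suc i) \<omega>\<bar>)) \<partial>M)) / 3"
  proof (rule exp_moment_shift_differences[where \<F> = \<F> and \<G> = \<G>])
    show "\<bar>f i p\<bar> \<le> 1" for i p by (simp add: f_def \<beta> case_prod_beta')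
    fix i assume i: "i < n"
    show "indep_of M (\<F> i) (\<lambda>\<omega>. S (Suc i) \<omega> - S i \<omega>)" by (rule \<F>(1)[OF i])
    show "indep_of M (\<G> i) (\<lambda>\<omega>. S i \<omega> - \<rho> i * S (Suc i) \<omega>)" by (rule \<G>(1)[OF i])
    have i': "i \<le> n" "Suc i \<le> n" using i by auto
    show "distr M borel (\<lambda>\<omega>. S (Suc i) \<omega> - S i \<omega>) = gauss \<sigma>"
    proof (rule gaussian_rv_distr[OF gaussian_space_rv[OF H ZH[OF i]] gaussian_space_mean[OF H ZH[OF i]] _ \<sigma>(1)])
      show "expectation (\<lambda>\<omega>. (S (Suc i) \<omega> - S i \<omega>)\<^sup>2) = \<sigma>\<^sup>2"
        using gaussian_space_variance_comb[OF H SH(1)[OF i'(2)] SH(1)[OF i'(1)], of 1] h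
        by (simp add: cSS i' step \<sigma> algebra_simps)
    qed
    show "S j \<in> borel_measurable (\<F> i)" if "j \<le> i" for j using \<F>(2)[OF i] that by auto
    show "S j \<in> borel_measurable (\<G> i)" if "Suc i \<le> j" "j \<le> n" for j using \<G>(2)[OF i] that by auto
    show "(\<integral>\<^sup>+\<omega>. ennreal (exp (c * (S i \<omega> - \<rho> i * S (Suc i) \<omega>))) \<partial>M) \<le> ennreal (exp (c\<^sup>2 * \<sigma>\<^sup>2 / 2))" for c
    proof -
      have "expectation (\<lambda>\<omega>. (S i \<omega> - \<rho> i * S (Suc i) \<omega>)\<^sup>2) \<le> \<sigma>\<^sup>2"
      proof -
        have "expectation (\<lambda>\<omega>. (S i \<omega> - \<rho> i * S (Suc i) \<omega>)\<^sup>2) = s * (T i - 2 * \<rho> i * T i + (\<rho> i)\<^sup>2 * T (Suc i))"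
          using gaussian_space_variance_comb[OF H SH(1)[OF i'(1)] SH(1)[OF i'(2)], of "\<rho> i"] mono[of i "Suc i"]
          by (simp add: cSS i' algebra_simps)
        also have "T i - 2 * \<rho> i * T i + (\<rho> i)\<^sup>2 * T (Suc i) = \<rho> i * h"
        proof -
          have r: "\<rho> i * T (Suc i) = T i" using Tpos[of i] by (simp add: \<rho>_def)
          have "T i - 2 * \<rho> i * T i + (\<rho> i)\<^sup>2 * T (Suc i) = T i - 2 * \<rho> i * T i + \<rho> i * (\<rho> i * T (Suc i))"
            by (simp add: power2_eq_square)
          also have "\<dots> = \<rho> i * T (Suc i) - \<rho> i * T i" by (simp add: r)
          finally show ?thesis by (simp add: step algebra_simps)
        qed
        also have "\<rho> i * h \<le> 1 * h"
          using Tpos[of i] mono[of i "Suc i"] h by (intro mult_right_mono) (auto simp: \<rho>_def)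
        finally show ?thesis using s by (simp add: \<sigma>)
      qed
      then show ?thesis
        unfolding gaussian_rv_exp_linear[OF gaussian_space_rv[OF H EH[OF i]] gaussian_space_mean[OF H EH[OF i]]]
        by (intro ennreal_leI) (simp add: mult_left_mono)
    qed
    fix j assume j: "j < n"
    show "f j \<in> borel_measurable (\<F> i \<Otimes>\<^sub>M borel)" "f j \<in> borel_measurable (\<G> i \<Otimes>\<^sub>M borel)"
      using \<F>(3)[OF i] \<G>(3)[OF i] by (auto intro!: f_meas[OF j])
    have [measurable]: "Y j \<in> borel_measurable (\<F> i)" "Y j \<in> borel_measurable (\<G> i)" using \<F>(2)[OF i] \<G>(2)[OF i] j by auto
    show "y j \<in> borel_measurable (\<F> i)" "y j \<in> borel_measurable (\<G> i)" unfolding y_eq by measurable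
  qed (use \<sigma> \<mu> in auto)
  then show ?thesis unfolding hyb rho \<sigma>(2) by (simp only: S_def)
qed

end
end

context prob_space
begin

context
  fixes W :: "real \<times> real \<Rightarrow> 'a \<Rightarrow> real ^ 'd"
  assumes W: "brownian_sheet M W"
begin

text \<open>
  The right-hand side of the previous estimate is bounded uniformly in the grid. Apart from
  the terms \<open>324 \<mu>\<^sup>2\<close>, whose sum is at most 1, the exponent at step \<open>i\<close> is at most \<open>w i\<close> times a
  quadratic form \<open>q i\<close> in the Gaussian variables \<open>y i / c\<close> and \<open>S i / u i\<close>, whose variances are at most 1. Here
  \<open>w i = 1 / sqrt (N (i + 1))\<close> dominates both \<open>1 / N\<close> and the size of the backward drift; these weights sum
  up to at most 2. The constant \<open>1 / 100\<close> in \<open>\<eta>\<close> is small enough for the integrals of \<open>exp (2 q i)\<close> to be at most 3.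
\<close>

lemma hybrid_exp_moment_le:
  fixes \<beta> :: "real \<times> (real ^ 'd) \<Rightarrow> real" and \<theta> :: "nat \<Rightarrow> real" and x x' :: "real ^ 'd" and N :: nat
  assumes \<beta>: "\<beta> \<in> borel_measurable borel" "\<And>p. \<bar>\<beta> p\<bar> \<le> 1"
    and s: "0 < s" "s \<le> s'" "s' \<le> 1" and a: "0 \<le> a" and \<epsilon>: "0 < \<epsilon>" "a + \<epsilon> \<le> 1"
    and c: "0 < c" "\<bar>x' $ k - x $ k\<bar> \<le> c" "s' - s \<le> c\<^sup>2"
    and \<tau>: "0 \<le> \<tau>" "\<tau> \<le> 1" and N: "N \<ge> 2" and eta: "\<eta> = sqrt (\<epsilon> * s) / (100 * c)" and N_eta: "324 * \<eta>\<^sup>2 \<le> real N"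
    and k: "k \<notin> A"
  defines "T \<equiv> \<lambda>i. a + \<epsilon> * ((real i + \<tau>) / real N)"
  shows "(\<integral>\<^sup>+\<omega>. ennreal (exp (\<Sum>i<N - 1. \<eta> / real N * (\<beta> (\<theta> i, hybrid W s s' x x' (insert k A) (T (Suc i)) \<omega>)
              - \<beta> (\<theta> i, hybrid W s s' x x' A (T (Suc i)) \<omega>)))) \<partial>M) \<le> 4"
proof -
  define h where "h = \<epsilon> / real N"
  define n where "n = N - 1"
  define \<mu> where "\<mu> = \<eta> / real N"
  define y where "y i \<omega> = x' $ k - x $ k + (W (s', T (Suc i)) \<omega> $ k - W (s, T (Suc i)) \<omega> $ k)" for i \<omega>
  define S where "S i \<omega> = W (s, T (Suc i)) \<omega> $ k" for i \<omega>
  define Y where "Y i \<omega> = W (s', T (Suc i)) \<omega> $ k - 1 * W (s, T (Suc i)) \<omega> $ k" for i \<omega>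
  define u where "u i = sqrt (s * T (Suc i))" for i
  define w where "w i = 1 / (sqrt (real N) * sqrt (real (Suc i)))" for i
  define q where "q i \<omega> = 3 / 100 * ((y i \<omega> / c)\<^sup>2 + (S i \<omega> / u i)\<^sup>2)" for i \<omega>
  have N0: "real N > 0" using N by simp
  have h: "h > 0" using \<epsilon> N by (simp add: h_def)
  have eta0: "\<eta> \<ge> 0" using c \<epsilon> s by (simp add: eta)
  have step: "T (Suc i) = T i + h" for i
    using N0 by (simp add: T_def h_def field_simps)
  have Tlow: "\<epsilon> * real (Suc i) / real N \<le> T (Suc i)" for i
    using a \<tau> \<epsilon> N0 by (simp add: T_def field_simps)
  have Tpos: "T (Suc i) > 0" for i
    using Tlow[of i] \<epsilon> N0 by (smt (verit) divide_pos_pos mult_pos_pos of_nat_0_less_iff zero_less_Suc)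
  have Thigh: "T (Suc i) \<le> 1" if "i < n" for i
  proof -
    have "(real (Suc i) + \<tau>) / real N \<le> 1" using that \<tau> N by (simp add: n_def field_simps)
    then have "\<epsilon> * ((real (Suc i) + \<tau>) / real N) \<le> \<epsilon> * 1" using \<epsilon> by (intro mult_left_mono) auto
    then show ?thesis using \<epsilon> by (simp add: T_def)
  qed
  have Tn: "T n \<le> 1"
  proof (cases n)
    case 0 then show ?thesis using N by (simp add: n_def)
  next
    case (Suc m) then show ?thesis using Thigh[of m] by simp
  qed
  have T0: "T 0 \<ge> 0" using a \<epsilon> \<tau> by (simp add: T_def)
  have u: "u i > 0" for i using s Tpos[of i] by (simp add: u_def)
  have w: "w i > 0" for i using N0 by (simp add: w_def)
  have q0: "q i \<omega> \<ge> 0" for i \<omega> by (simp add: q_def)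
  have w2: "(\<Sum>i<n. w i) \<le> 2"
  proof -
    have "(\<Sum>i<n. w i) = (\<Sum>i<n. 1 / sqrt (real (Suc i))) / sqrt (real N)"
      by (simp add: w_def sum_divide_distrib mult.commute)
    also have "\<dots> \<le> 2 * sqrt (real n) / sqrt (real N)"
      by (intro divide_right_mono sum_inverse_sqrt_le) simp
    also have "\<dots> \<le> 2 * sqrt (real N) / sqrt (real N)"
      by (intro divide_right_mono mult_left_mono) (auto simp: n_def)
    finally show ?thesis using N0 by simp
  qed
  define Q where "Q i \<omega> = 324 * \<mu>\<^sup>2 + 86 * (\<mu>\<^sup>2 / (s * h)) * (y i \<omega>)\<^sup>2 + 3 * (\<mu> / (s * h)) * (h / T (Suc i)) * \<bar>y i \<omega>\<bar> * \<bar>S i \<omega>\<bar>" for i \<omega>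
  have Qle: "Q i \<omega> \<le> 324 * \<mu>\<^sup>2 + w i * q i \<omega>" if i: "i < n" for i \<omega>
  proof -
    let ?y2 = "(y i \<omega> / c)\<^sup>2" and ?s2 = "(S i \<omega> / u i)\<^sup>2" and ?ys = "\<bar>y i \<omega>\<bar> / c * (\<bar>S i \<omega>\<bar> / u i)"
    have es: "\<epsilon> * s > 0" using \<epsilon> s by simp
    have l2: "\<eta>\<^sup>2 = \<epsilon> * s / (100 * c)\<^sup>2" using es unfolding eta by (simp add: power_divide)
    have "86 * (\<mu>\<^sup>2 / (s * h)) * (y i \<omega>)\<^sup>2 = 86 / 10000 * ?y2 * (1 / real N)"
    proof -
      have "\<mu>\<^sup>2 / (s * h) = 1 / (10000 * c\<^sup>2 * real N)"
        using N0 c \<epsilon> s unfolding \<mu>_def h_def power_divide l2 by (simp add: field_simps power2_eq_square)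
      then show ?thesis by (simp add: power_divide)
    qed
    also have "\<dots> \<le> 86 / 10000 * ?y2 * w i"
    proof (rule mult_left_mono)
      have "sqrt (real N) * sqrt (real (Suc i)) \<le> sqrt (real N) * sqrt (real N)"
        using i by (intro mult_left_mono) (auto simp: n_def)
      then show "1 / real N \<le> w i" unfolding w_def using N0 by (intro divide_left_mono) auto
    qed simp
    finally have t1: "86 * (\<mu>\<^sup>2 / (s * h)) * (y i \<omega>)\<^sup>2 \<le> 86 / 10000 * ?y2 * w i" .
    define v where "v = h * u i / (T (Suc i) * sqrt (\<epsilon> * s))"
    have "3 * (\<mu> / (s * h)) * (h / T (Suc i)) * \<bar>y i \<omega>\<bar> * \<bar>S i \<omega>\<bar> = 3 / 100 * (?ys) * v"
    proof -
      have "\<mu> / (s * h) = 1 / (100 * c * sqrt (\<epsilon> * s))"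
      proof -
        have "\<mu> / (s * h) = sqrt (\<epsilon> * s) / (100 * c) / (\<epsilon> * s)"
          using N0 by (simp add: \<mu>_def eta h_def mult.commute)
        also have "\<dots> = sqrt (\<epsilon> * s) / (100 * c) / (sqrt (\<epsilon> * s) * sqrt (\<epsilon> * s))" using es by simp
        also have "\<dots> = 1 / (100 * c * sqrt (\<epsilon> * s))" using es by (simp del: real_sqrt_mult_self)
        finally show ?thesis .
      qed
      then show ?thesis using u[of i] es by (simp add: v_def mult_ac)
    qed
    also have "\<dots> \<le> 3 / 100 * (?ys) * w i"
    proof (rule mult_left_mono)
      have "v = sqrt \<epsilon> / (real N * sqrt (T (Suc i)))"
      proof -
        have "u i = sqrt s * sqrt (T (Suc i))" "sqrt (\<epsilon> * s) = sqrt \<epsilon> * sqrt s" by (simp_all add: u_def real_sqrt_mult)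
        moreover have "T (Suc i) = sqrt (T (Suc i)) * sqrt (T (Suc i))" "\<epsilon> = sqrt \<epsilon> * sqrt \<epsilon>" using Tpos[of i] \<epsilon> by auto
        ultimately have "v = (sqrt \<epsilon> * sqrt \<epsilon>) / real N * (sqrt s * sqrt (T (Suc i))) / ((sqrt (T (Suc i)) * sqrt (T (Suc i))) * (sqrt \<epsilon> * sqrt s))"
          unfolding v_def h_def by metis
        then show ?thesis using Tpos[of i] \<epsilon> s by (simp del: real_sqrt_mult_self add: field_simps)
      qed
      also have "\<dots> \<le> sqrt \<epsilon> / (real N * sqrt (\<epsilon> * real (Suc i) / real N))"
        using N0 \<epsilon> Tlow[of i] Tpos[of i] by (intro divide_left_mono mult_left_mono real_sqrt_le_mono mult_pos_pos) auto
      also have "\<dots> = w i"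
      proof -
        have "real N * sqrt (\<epsilon> * real (Suc i) / real N) = (sqrt (real N) * sqrt (real N)) * (sqrt \<epsilon> * sqrt (real (Suc i)) / sqrt (real N))"
          using N0 by (simp add: real_sqrt_mult real_sqrt_divide)
        also have "\<dots> = sqrt \<epsilon> * (sqrt (real N) * sqrt (real (Suc i)))"
          using N0 by (simp del: real_sqrt_mult_self)
        finally show ?thesis using \<epsilon> by (simp add: w_def)
      qed
      finally show "v \<le> w i" .
    qed (use u[of i] c in auto)
    also have "\<dots> \<le> 3 / 100 * ((?y2 + ?s2) / 2) * w i"
    proof -
      have "?ys \<le> ((\<bar>y i \<omega>\<bar> / c)\<^sup>2 + (\<bar>S i \<omega>\<bar> / u i)\<^sup>2) / 2"
        using zero_le_power2[of "\<bar>y i \<omega>\<bar> / c - \<bar>S i \<omega>\<bar> / u i"] unfolding power2_diff by (simp add: mult_ac)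
      also have "\<dots> = (?y2 + ?s2) / 2" by (simp add: power_divide)
      finally show ?thesis using w[of i] by (intro mult_right_mono mult_left_mono) auto
    qed
    finally have "3 * (\<mu> / (s * h)) * (h / T (Suc i)) * \<bar>y i \<omega>\<bar> * \<bar>S i \<omega>\<bar> \<le> 3 / 100 * ((?y2 + ?s2) / 2) * w i" .
    moreover have "86 / 10000 * ?y2 * w i + 3 / 100 * ((?y2 + ?s2) / 2) * w i \<le> w i * q i \<omega>"
    proof -
      have "86 / 10000 * ?y2 + 3 / 100 * ((?y2 + ?s2) / 2) \<le> q i \<omega>"
        unfolding q_def distrib_left add_divide_distrib
        using zero_le_power2[of "y i \<omega> / c"] zero_le_power2[of "S i \<omega> / u i"] by linarith
      from mult_right_mono[OF this, of "w i"] w[of i] show ?thesis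
        by (simp only: distrib_right mult.commute[of "w i" "q i \<omega>"] less_imp_le)
    qed
    ultimately show ?thesis using t1 unfolding Q_def by linarith
  qed
  have SH: "S i \<in> component_span W k" "Y i \<in> component_span W k" and varS: "expectation (\<lambda>\<omega>. (S i \<omega>)\<^sup>2) = (u i)\<^sup>2"
    and varY: "expectation (\<lambda>\<omega>. (Y i \<omega>)\<^sup>2) \<le> c\<^sup>2" if i: "i < n" for i
  proof -
    have p: "(s, T (Suc i)) \<in> unit_square" "(s', T (Suc i)) \<in> unit_square" using s Tpos[of i] Thigh[OF i] by auto
    note G = gaussian_space_component_span[OF W, of k]
    note C = component_in_span[OF W p(1), of k] component_in_span[OF W p(2), of k]
    show "S i \<in> component_span W k" unfolding S_def using C by simp
    show "Y i \<in> component_span W k" unfolding Y_def using gaussian_space_diff[OF G C(2,1)] by simp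
    have T: "T (Suc i) \<in> {0..1}" and ss: "s \<in> {0..1}" "s' \<in> {0..1}" using p by auto
    note cov = component_covariance[OF W ss(1) T ss(1) T, of k] component_covariance[OF W ss(2) T ss(1) T, of k] component_covariance[OF W ss(2) T ss(2) T, of k]
    have "(u i)\<^sup>2 = s * T (Suc i)" using s T by (simp add: u_def)
    then show "expectation (\<lambda>\<omega>. (S i \<omega>)\<^sup>2) = (u i)\<^sup>2" using cov(1) by (simp add: S_def power2_eq_square)
    have "expectation (\<lambda>\<omega>. (Y i \<omega>)\<^sup>2) = (s' - s) * T (Suc i)"
      unfolding Y_def gaussian_space_variance_comb[OF G C(2) C(1)] cov using s by (simp add: min_absorb2 algebra_simps)
    also have "\<dots> \<le> (s' - s) * 1" using T s by (intro mult_left_mono) auto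
    finally show "expectation (\<lambda>\<omega>. (Y i \<omega>)\<^sup>2) \<le> c\<^sup>2" using c by simp
  qed
  have expq: "(\<integral>\<^sup>+\<omega>. ennreal (exp (2 * q i \<omega>)) \<partial>M) \<le> 3" if i: "i < n" for i
  proof -
    let ?Y = "\<lambda>\<omega>. exp (24/100 / c\<^sup>2 * (Y i \<omega>)\<^sup>2)" and ?S = "\<lambda>\<omega>. exp (12/100 / (u i)\<^sup>2 * (S i \<omega>)\<^sup>2)"
    note G = gaussian_space_component_span[OF W, of k]
    have [measurable]: "S i \<in> borel_measurable M" "Y i \<in> borel_measurable M"
      using gaussian_space_measurable[OF G SH(1)[OF i]] gaussian_space_measurable[OF G SH(2)[OF i]] by auto
    have eS: "(\<integral>\<^sup>+\<omega>. ennreal (?S \<omega>) \<partial>M) \<le> 2"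
      by (rule gaussian_rv_exp_square[OF gaussian_space_rv[OF G SH(1)[OF i]] gaussian_space_mean[OF G SH(1)[OF i]]])
         (use u[of i] varS[OF i] in auto)
    have eY: "(\<integral>\<^sup>+\<omega>. ennreal (?Y \<omega>) \<partial>M) \<le> 2"
    proof (rule gaussian_rv_exp_square[OF gaussian_space_rv[OF G SH(2)[OF i]] gaussian_space_mean[OF G SH(2)[OF i]]])
      have "2 * (24/100 / c\<^sup>2) * expectation (\<lambda>\<omega>. (Y i \<omega>)\<^sup>2) \<le> 2 * (24/100 / c\<^sup>2) * c\<^sup>2"
        using varY[OF i] by (intro mult_left_mono) auto
      also have "\<dots> = 48/100" using c by simp
      finally show "2 * (24/100 / c\<^sup>2) * expectation (\<lambda>\<omega>. (Y i \<omega>)\<^sup>2) \<le> 1/2" by linarith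
    qed simp
    have pt: "exp (2 * q i \<omega>) \<le> (2 * ?Y \<omega> + ?S \<omega>) / 2" for \<omega>
    proof -
      have "2 * q i \<omega> = 6/100 * (y i \<omega> / c)\<^sup>2 + 6/100 * (S i \<omega> / u i)\<^sup>2" by (simp add: q_def)
      then have "exp (2 * q i \<omega>) \<le> (exp (2 * (6/100 * (y i \<omega> / c)\<^sup>2)) + exp (2 * (6/100 * (S i \<omega> / u i)\<^sup>2))) / 2"
        by (simp only: exp_add_le_sum)
      moreover have "exp (2 * (6/100 * (y i \<omega> / c)\<^sup>2)) \<le> 2 * ?Y \<omega>"
      proof -
        have "(y i \<omega>)\<^sup>2 \<le> 2 * (x' $ k - x $ k)\<^sup>2 + 2 * (Y i \<omega>)\<^sup>2"
        proof -
          have "(v + v')\<^sup>2 \<le> 2 * v\<^sup>2 + 2 * v'\<^sup>2" for v v' :: real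
            using zero_le_power2[of "v - v'"] by (simp add: power2_diff power2_sum)
          moreover have "y i \<omega> = (x' $ k - x $ k) + Y i \<omega>" by (simp add: y_def Y_def)
          ultimately show ?thesis by (simp only:)
        qed
        also have "\<dots> \<le> 2 * c\<^sup>2 + 2 * (Y i \<omega>)\<^sup>2"
          using power_mono[OF c(2), of 2] by simp
        finally have "(y i \<omega> / c)\<^sup>2 \<le> 2 + 2 * (Y i \<omega>)\<^sup>2 / c\<^sup>2"
          using c by (simp add: power_divide divide_le_eq add_divide_distrib distrib_right)
        then have "exp (2 * (6/100 * (y i \<omega> / c)\<^sup>2)) \<le> exp (24/100) * ?Y \<omega>"
          by (simp add: exp_add [symmetric])
        also have "exp (24/100) \<le> (2 :: real)" using exp_bound[of "24/100"] by (simp add: power2_eq_square)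
        finally show ?thesis by simp
      qed
      moreover have "2 * (6/100 * (S i \<omega> / u i)\<^sup>2) = 12/100 / (u i)\<^sup>2 * (S i \<omega>)\<^sup>2" by (simp add: power_divide)
      moreover have "e \<le> (e1 + exp e2) / 2 \<Longrightarrow> e1 \<le> e3 \<Longrightarrow> e2 = e4 \<Longrightarrow> e \<le> (e3 + exp e4) / 2" for e e1 e2 e3 e4 :: real
        by simp
      ultimately show ?thesis by blast
    qed
    have "(\<integral>\<^sup>+\<omega>. ennreal (exp (2 * q i \<omega>)) \<partial>M)
       \<le> (\<integral>\<^sup>+\<omega>. (2 * ennreal (?Y \<omega>) + ennreal (?S \<omega>)) / 2 \<partial>M)"
    proof (rule nn_integral_mono)
      fix \<omega>
      have "ennreal (exp (2 * q i \<omega>)) \<le> ennreal ((2 * ?Y \<omega> + ?S \<omega>) / 2)"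
        by (rule ennreal_leI[OF pt])
      also have "\<dots> = (2 * ennreal (?Y \<omega>) + ennreal (?S \<omega>)) / 2"
        by (simp add: divide_ennreal [symmetric] ennreal_mult')
      finally show "ennreal (exp (2 * q i \<omega>)) \<le> \<dots>" .
    qed
    also have "\<dots> = (2 * (\<integral>\<^sup>+\<omega>. ennreal (?Y \<omega>) \<partial>M) + (\<integral>\<^sup>+\<omega>. ennreal (?S \<omega>) \<partial>M)) / 2"
      by (simp add: nn_integral_divide nn_integral_add nn_integral_cmult)
    also have "\<dots> \<le> (2 * 2 + 2) / 2"
      by (intro divide_right_mono_ennreal add_mono mult_left_mono eS eY) auto
    also have "\<dots> = 3"
      using divide_ennreal[of 6 2] by simp
    finally show ?thesis .
  qed
  define B where "B = (\<Sum>j<n. w j)"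
  have n: "n > 0" using N by (simp add: n_def)
  have B: "B > 0" unfolding B_def using n w by (intro sum_pos) auto
  have qmeas: "q i \<in> borel_measurable M" if i: "i < n" for i
  proof -
    note G = gaussian_space_component_span[OF W, of k]
    have [measurable]: "S i \<in> borel_measurable M" "Y i \<in> borel_measurable M"
      using gaussian_space_measurable[OF G SH(1)[OF i]] gaussian_space_measurable[OF G SH(2)[OF i]] by auto
    have "y i = (\<lambda>\<omega>. x' $ k - x $ k + Y i \<omega>)" by (auto simp: y_def Y_def)
    then show ?thesis unfolding q_def[abs_def] by simp
  qed
  have Qpt: "exp (\<Sum>i<n. Q i \<omega>)
      \<le> (\<Sum>i<n. 3 * (w i / B) * exp (2 * q i \<omega>))" for \<omega>
  proof -
    have "(\<Sum>i<n. Q i \<omega>)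
      \<le> (\<Sum>i<n. 324 * \<mu>\<^sup>2 + w i * q i \<omega>)" by (rule sum_mono) (use Qle in auto)
    also have "\<dots> = real n * (324 * \<mu>\<^sup>2) + (\<Sum>i<n. w i * q i \<omega>)" by (simp add: sum.distrib)
    also have "real n * (324 * \<mu>\<^sup>2) \<le> real N * (324 * \<mu>\<^sup>2)" by (intro mult_right_mono) (auto simp: n_def)
    also have "\<dots> = 324 * \<eta>\<^sup>2 / real N" using N0 by (simp add: \<mu>_def power_divide power2_eq_square)
    also have "\<dots> \<le> 1" using N_eta N0 by simp
    finally have "exp (\<Sum>i<n. Q i \<omega>)
      \<le> exp 1 * exp (\<Sum>i<n. w i * q i \<omega>)" by (simp add: exp_add [symmetric])
    also have "\<dots> \<le> 3 * (\<Sum>i<n. w i / B * exp (2 * q i \<omega>))"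
      unfolding B_def by (intro mult_mono exp_le exp_weighted_sum_le n w w2 q0) auto
    finally show ?thesis by (simp add: sum_distrib_left mult.assoc)
  qed
  have "(\<integral>\<^sup>+\<omega>. ennreal (exp (\<Sum>i<n. Q i \<omega>)) \<partial>M)
      \<le> (\<integral>\<^sup>+\<omega>. (\<Sum>i<n. ennreal (3 * (w i / B)) * ennreal (exp (2 * q i \<omega>))) \<partial>M)"
  proof (rule nn_integral_mono)
    fix \<omega>
    have "(\<Sum>i<n. ennreal (3 * (w i / B)) * ennreal (exp (2 * q i \<omega>))) = ennreal (\<Sum>i<n. 3 * (w i / B) * exp (2 * q i \<omega>))"
    proof -
      have nn: "0 \<le> 3 * (w i / B)" for i using w[of i] B by simp
      show ?thesis
        unfolding ennreal_mult'[OF nn, symmetric] by (rule sum_ennreal) (intro mult_nonneg_nonneg nn; simp)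
    qed
    then show "ennreal (exp (\<Sum>i<n. Q i \<omega>)) \<le> (\<Sum>i<n. ennreal (3 * (w i / B)) * ennreal (exp (2 * q i \<omega>)))"
      using Qpt by (simp add: ennreal_leI)
  qed
  also have "\<dots> = (\<Sum>i<n. ennreal (3 * (w i / B)) * (\<integral>\<^sup>+\<omega>. ennreal (exp (2 * q i \<omega>)) \<partial>M))"
    using qmeas by (subst nn_integral_sum) (auto intro!: sum.cong nn_integral_cmult)
  also have "\<dots> \<le> (\<Sum>i<n. ennreal (3 * (w i / B)) * 3)"
    by (intro sum_mono mult_left_mono expq) auto
  also have "\<dots> = (\<Sum>i<n. ennreal (9 * (w i / B)))"
  proof (rule sum.cong[OF refl])
    fix i
    have "ennreal (3 * (w i / B)) * ennreal 3 = ennreal (3 * (w i / B) * 3)"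
      by (rule ennreal_mult' [symmetric]) (use w[of i] B in simp)
    then show "ennreal (3 * (w i / B)) * 3 = ennreal (9 * (w i / B))" by simp
  qed
  also have "\<dots> = ennreal (\<Sum>i<n. 9 * (w i / B))"
    using w B by (intro sum_ennreal) (auto intro!: mult_nonneg_nonneg divide_nonneg_nonneg less_imp_le)
  also have "(\<Sum>i<n. 9 * (w i / B)) = 9"
    using B by (simp add: sum_distrib_left [symmetric] sum_divide_distrib [symmetric] B_def)
  finally have "(\<integral>\<^sup>+\<omega>. ennreal (exp (\<Sum>i<n. Q i \<omega>)) \<partial>M) \<le> ennreal 9" .
  then have "(2 + (\<integral>\<^sup>+\<omega>. ennreal (exp (\<Sum>i<n. Q i \<omega>)) \<partial>M)) / 3 \<le> (2 + ennreal 9) / 3"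
    by (intro divide_right_mono_ennreal add_left_mono)
  also have "\<dots> = ennreal (11 / 3)"
    using divide_ennreal[of 11 3] by simp
  also have "\<dots> \<le> 4" by (simp add: ennreal_le_iff2 flip: ennreal_numeral)
  finally have "(2 + (\<integral>\<^sup>+\<omega>. ennreal (exp (\<Sum>i<n. Q i \<omega>)) \<partial>M)) / 3 \<le> 4" .
  moreover have "\<mu> \<ge> 0" using eta0 by (simp add: \<mu>_def)
  ultimately show ?thesis
    using hybrid_exp_moment[OF W \<beta> s T0 h step Tn _ k, of \<mu> \<theta> x x']
    unfolding Q_def y_def S_def \<mu>_def[symmetric] n_def[symmetric] by (meson order_trans)
qed

end
end

section \<open>Averages over time grids\<close>

text \<open>
  A process with continuous paths is jointly measurable: it is the limit of the processes frozen
  at the grid points to the left.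
\<close>

lemma jointly_measurable_of_continuous:
  fixes X :: "real \<Rightarrow> 'a \<Rightarrow> 'b :: {metric_space, second_countable_topology}"
  assumes meas: "\<And>t. X t \<in> borel_measurable M" and cont: "\<And>\<omega>. \<omega> \<in> space M \<Longrightarrow> continuous_on UNIV (\<lambda>t. X t \<omega>)"
  shows "(\<lambda>(t, \<omega>). X t \<omega>) \<in> borel_measurable (borel \<Otimes>\<^sub>M M)"
proof (rule borel_measurable_LIMSEQ_metric)
  define r where "r n t = real_of_int \<lfloor>real (Suc n) * t\<rfloor> / real (Suc n)" for n t
  show "(\<lambda>(t, \<omega>). X (r n t) \<omega>) \<in> borel_measurable (borel \<Otimes>\<^sub>M M)" for n
  proof -
    note [measurable] = meas
    have "(\<lambda>u. X (real_of_int \<lfloor>real (Suc n) * fst u\<rfloor> / real (Suc n)) (snd u)) \<in> borel_measurable (borel \<Otimes>\<^sub>M M)"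
      by (rule measurable_compose_countable[where f = "\<lambda>i u. X (real_of_int i / real (Suc n)) (snd u)"]) measurable
    then show ?thesis by (simp add: r_def case_prod_beta')
  qed
  fix u assume "u \<in> space ((borel :: real measure) \<Otimes>\<^sub>M M)"
  then obtain t \<omega> where u: "u = (t, \<omega>)" and \<omega>: "\<omega> \<in> space M" by (auto simp: space_pair_measure)
  have "(\<lambda>n. r n t) \<longlonglongrightarrow> t"
  proof (rule Lim_null_comparison[THEN Lim_null[THEN iffD2]])
    show "(\<lambda>n. 1 / real (Suc n)) \<longlonglongrightarrow> 0" by (rule LIMSEQ_Suc[OF lim_1_over_n])
    have "norm (r n t - t) \<le> 1 / real (Suc n)" for n
    proof -
      have "r n t - t = (real_of_int \<lfloor>real (Suc n) * t\<rfloor> - real (Suc n) * t) / real (Suc n)"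
        by (simp add: r_def diff_divide_distrib del: of_nat_Suc)
      moreover have "\<bar>real_of_int \<lfloor>real (Suc n) * t\<rfloor> - real (Suc n) * t\<bar> \<le> 1" by linarith
      ultimately show ?thesis by (simp add: divide_right_mono del: of_nat_Suc)
    qed
    then show "\<forall>\<^sub>F n in sequentially. norm (r n t - t) \<le> 1 / real (Suc n)" by simp
  qed
  then have "(\<lambda>n. X (r n t) \<omega>) \<longlonglongrightarrow> X t \<omega>"
    using cont[OF \<omega>] by (intro continuous_on_tendsto_compose[where f = "\<lambda>t. X t \<omega>"]) auto
  then show "(\<lambda>n. case u of (t, \<omega>) \<Rightarrow> X (r n t) \<omega>) \<longlonglongrightarrow> (case u of (t, \<omega>) \<Rightarrow> X t \<omega>)" by (simp add: u)
qed

lemma integrable_indicator_bounded: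
  fixes g :: "real \<Rightarrow> real"
  assumes "g \<in> borel_measurable borel" "\<And>t. \<bar>g t\<bar> \<le> K"
  shows "integrable lborel (\<lambda>t. indicator {0..<1} t * g t)"
proof (rule Bochner_Integration.integrable_bound)
  show "integrable lborel (\<lambda>t::real. K * indicator {0..<1} t)"
    by (intro integrable_mult_right integrable_real_indicator) auto
  show "AE t in lborel. norm (indicator {0..<1} t * g t) \<le> norm (K * indicator {0..<1} t)"
    using assms(2) by (intro AE_I2) (auto split: split_indicator intro: order_trans[OF _ abs_ge_self])
qed (use assms in measurable)

text \<open>
  An integral over the unit interval is exactly the average over \<open>\<tau>\<close> of the Riemann sums on the shifted grids
  \<open>(i + \<tau>) / N\<close>. Hence a bound for Riemann sums that holds for one \<open>N\<close> and all shifts passes to the integral without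
  any continuity. The half-open interval makes the translated cells a partition.
\<close>

lemma integral_eq_average:
  fixes g :: "real \<Rightarrow> real"
  assumes [measurable]: "g \<in> borel_measurable borel" and g: "\<And>t. \<bar>g t\<bar> \<le> K" and N: "N > 0"
  shows "(LINT t:{0..1}|lborel. g t) = (LINT \<tau>|lborel. indicator {0..<1} \<tau> * ((\<Sum>i<N. g ((real i + \<tau>) / real N)) / real N))"
proof -
  have N0: "real N > 0" using N by simp
  let ?c = "\<lambda>i \<tau>. indicator {0..<1} \<tau> * g ((real i + \<tau>) / real N)"
  have int: "integrable lborel (\<lambda>\<tau>. ?c i \<tau>)" for i
    by (rule integrable_indicator_bounded[where K = K]) (use g in auto)
  have affine: "(LINT \<tau>|lborel. ?c i \<tau>)
      = real N * (LINT t|lborel. indicator {0..<1} (real N * t - real i) * g t)" for i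
    using lborel_integral_real_affine[of "real N" "?c i" "- real i"] N0
    by (simp add: algebra_simps)
  have int': "integrable lborel (\<lambda>t. indicator {0..<1} (real N * t - real i) * g t)" for i
    using int[of i] N0
    by (subst (asm) lborel_integrable_real_affine_iff[of "real N" _ "- real i", symmetric]) (simp_all add: algebra_simps)
  have part: "(\<Sum>i<m. indicator {0..<1} (real N * t - real i)) = (indicator {0..<real m} (real N * t) :: real)" for m t
    by (induction m) (auto split: split_indicator)
  have "(LINT \<tau>|lborel. indicator {0..<1} \<tau> * ((\<Sum>i<N. g ((real i + \<tau>) / real N)) / real N))
      = (LINT \<tau>|lborel. (\<Sum>i<N. ?c i \<tau>) / real N)"
    by (simp add: sum_distrib_left)
  also have "\<dots> = (\<Sum>i<N. LINT \<tau>|lborel. ?c i \<tau>) / real N"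
    unfolding integral_divide_zero using int by (subst Bochner_Integration.integral_sum) auto
  also have "\<dots> = (\<Sum>i<N. LINT t|lborel. indicator {0..<1} (real N * t - real i) * g t)"
    using N0 by (simp add: affine sum_distrib_left [symmetric])
  also have "\<dots> = (LINT t|lborel. (\<Sum>i<N. indicator {0..<1} (real N * t - real i)) * g t)"
    unfolding sum_distrib_right using int' by (subst Bochner_Integration.integral_sum) auto
  also have "\<dots> = (LINT t|lborel. indicator {0..<1} t * g t)"
    unfolding part using N0 by (intro Bochner_Integration.integral_cong) (auto simp: zero_le_mult_iff split: split_indicator)
  also have "\<dots> = (LINT t:{0..1}|lborel. g t)"
    unfolding set_lebesgue_integral_def
  proof (rule integral_cong_AE)
    show "AE t in lborel. indicator {0..<1} t * g t = indicator {0..1} t *\<^sub>R g t"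
      using AE_lborel_singleton[of 1] by eventually_elim (auto split: split_indicator)
  qed measurable
  finally show ?thesis by simp
qed

lemma exp_integral_le_average:
  fixes g :: "real \<Rightarrow> real"
  assumes [measurable]: "g \<in> borel_measurable borel" and g: "\<And>t. \<bar>g t\<bar> \<le> K" and N: "N > 0" and l: "l \<ge> 0"
  shows "ennreal (exp (l * \<bar>LINT t:{0..1}|lborel. g t\<bar>))
     \<le> (\<integral>\<^sup>+\<tau>. ennreal (exp (l * \<bar>(\<Sum>i<N. g ((real i + \<tau>) / real N)) / real N\<bar>)) * indicator {0..<1} \<tau> \<partial>lborel)"
proof -
  define G where "G \<tau> = \<bar>(\<Sum>i<N. g ((real i + \<tau>) / real N)) / real N\<bar>" for \<tau>
  have [measurable]: "G \<in> borel_measurable borel" unfolding G_def by measurable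
  have K: "K \<ge> 0" using g[of 0] by linarith
  have GK: "\<bar>G \<tau>\<bar> \<le> K" for \<tau>
  proof -
    have "\<bar>\<Sum>i<N. g ((real i + \<tau>) / real N)\<bar> \<le> (\<Sum>i<N. K)"
      by (rule order_trans[OF sum_abs]) (intro sum_mono g)
    then show ?thesis using N by (simp add: G_def divide_le_eq mult.commute)
  qed
  define m where "m = (LINT \<tau>|lborel. indicator {0..<1} \<tau> * G \<tau>)"
  have intG: "integrable lborel (\<lambda>\<tau>. indicator {0..<1} \<tau> * G \<tau>)"
    by (rule integrable_indicator_bounded[OF _ GK]) simp
  have int1: "integrable lborel (\<lambda>\<tau>::real. indicator {0..<1} \<tau> :: real)"
    by (intro integrable_real_indicator) auto
  have intE: "integrable lborel (\<lambda>\<tau>. indicator {0..<1} \<tau> * exp (l * G \<tau>))"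
  proof (rule integrable_indicator_bounded)
    show "\<bar>exp (l * G \<tau>)\<bar> \<le> exp (l * K)" for \<tau> using GK[of \<tau>] l by (auto intro!: mult_left_mono)
  qed simp
  let ?L = "\<lambda>\<tau>. exp (l * m) * (1 - l * m) * indicator {0..<1} \<tau> + exp (l * m) * l * (indicator {0..<1} \<tau> * G \<tau>)"
  have "\<bar>LINT t:{0..1}|lborel. g t\<bar> \<le> (LINT \<tau>|lborel. \<bar>indicator {0..<1} \<tau> * ((\<Sum>i<N. g ((real i + \<tau>) / real N)) / real N)\<bar>)"
    unfolding integral_eq_average[OF assms(1) g N] by (rule integral_abs_bound)
  also have "\<dots> = m" unfolding m_def G_def by (intro Bochner_Integration.integral_cong) (auto simp: abs_mult)
  finally have "exp (l * \<bar>LINT t:{0..1}|lborel. g t\<bar>) \<le> exp (l * m)" using l by (simp add: mult_left_mono)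
  also have "\<dots> = (LINT \<tau>|lborel. ?L \<tau>)"
  proof -
    have "exp (l * m) = exp (l * m) * (1 - l * m) * 1 + exp (l * m) * l * m" by (simp add: algebra_simps)
    also have "\<dots> = (LINT \<tau>|lborel. exp (l * m) * (1 - l * m) * indicator {0..<1::real} \<tau>) + (LINT \<tau>|lborel. exp (l * m) * l * (indicator {0..<1} \<tau> * G \<tau>))"
      by (simp add: m_def)
    also have "\<dots> = (LINT \<tau>|lborel. ?L \<tau>)"
      by (rule Bochner_Integration.integral_add [symmetric]) (intro integrable_mult_right intG int1)+
    finally show ?thesis .
  qed
  also have "\<dots> \<le> (LINT \<tau>|lborel. indicator {0..<1} \<tau> * exp (l * G \<tau>))"
  proof (rule integral_mono)
    show "integrable lborel (\<lambda>\<tau>. ?L \<tau>)"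
      by (intro Bochner_Integration.integrable_add integrable_mult_right intG int1)
    fix \<tau> :: real
    have "exp (l * m) * (1 + (l * G \<tau> - l * m)) \<le> exp (l * m) * exp (l * G \<tau> - l * m)"
      by (intro mult_left_mono exp_ge_add_one_self) auto
    also have "\<dots> = exp (l * G \<tau>)" by (simp add: exp_add [symmetric])
    finally show "?L \<tau>
        \<le> indicator {0..<1} \<tau> * exp (l * G \<tau>)"
      by (auto simp: algebra_simps split: split_indicator)
  qed (rule intE)
  finally have "ennreal (exp (l * \<bar>LINT t:{0..1}|lborel. g t\<bar>)) \<le> ennreal (LINT \<tau>|lborel. indicator {0..<1} \<tau> * exp (l * G \<tau>))"
    by (rule ennreal_leI)
  also have "\<dots> = (\<integral>\<^sup>+\<tau>. ennreal (indicator {0..<1} \<tau> * exp (l * G \<tau>)) \<partial>lborel)"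
    by (rule nn_integral_eq_integral [symmetric, OF intE]) auto
  also have "\<dots> = (\<integral>\<^sup>+\<tau>. ennreal (exp (l * G \<tau>)) * indicator {0..<1} \<tau> \<partial>lborel)"
    by (intro nn_integral_cong) (auto split: split_indicator)
  finally show ?thesis by (simp add: G_def)
qed

lemma exp_abs_sum_le:
  fixes B :: "nat \<Rightarrow> real"
  assumes d: "d > 0"
  shows "exp \<bar>\<Sum>m<d. B m\<bar> \<le> (\<Sum>m<d. exp (real d * B m) + exp (- real d * B m)) / real d"
proof -
  have "exp \<bar>\<Sum>m<d. B m\<bar> \<le> exp (\<Sum>m<d. \<bar>B m\<bar>)" by simp
  also have "\<dots> = exp (\<Sum>m<d. (1 / real d) *\<^sub>R (real d * \<bar>B m\<bar>))" using d by simp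
  also have "\<dots> \<le> (\<Sum>m<d. 1 / real d * exp (real d * \<bar>B m\<bar>))"
    by (rule convex_on_sum[where C = UNIV and f = exp]) (use d exp_convex in auto)
  also have "\<dots> \<le> (\<Sum>m<d. 1 / real d * (exp (real d * B m) + exp (- real d * B m)))"
  proof (intro sum_mono mult_left_mono)
    show "exp (real d * \<bar>B m\<bar>) \<le> exp (real d * B m) + exp (- real d * B m)" for m by (cases "B m \<ge> 0") auto
  qed auto
  finally show ?thesis by (simp add: sum_divide_distrib)
qed

section \<open>The exponential estimate for the sheet\<close>

context prob_space
begin

context
  fixes W :: "real \<times> real \<Rightarrow> 'a \<Rightarrow> real ^ 'd"
  assumes W: "brownian_sheet M W"
begin

lemma sheet_measurable:
  assumes "p \<in> unit_square"
  shows "W p \<in> borel_measurable M"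
  using borel_measurable_vec_lambda[where f = "\<lambda>k \<omega>. W p \<omega> $ k", OF component_measurable[OF W assms]] by simp

lemma sheet_continuous: "\<omega> \<in> space M \<Longrightarrow> continuous_on unit_square (\<lambda>p. W p \<omega>)"
proof -
  assume "\<omega> \<in> space M"
  then have "continuous_on unit_square (\<lambda>p. W p \<omega> $ k)" for k
    using component_sheet[OF W, of k] unfolding real_brownian_sheet_def by blast
  then have "continuous_on unit_square (\<lambda>p. \<chi> k. W p \<omega> $ k)" by (rule continuous_on_vec_lambda)
  then show ?thesis by simp
qed

text \<open>
  The Riemann sums over a shifted grid: the difference is telescoped over the coordinates by means of
  the hybrid positions, and both signs of each summand are covered by the estimate for one coordinate.
\<close>

lemma grid_exp_moment_le:
  fixes \<beta> :: "real \<times> (real ^ 'd) \<Rightarrow> real" and x x' :: "real ^ 'd" and N :: nat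
  assumes \<beta>: "\<beta> \<in> borel_measurable borel" "\<And>p. \<bar>\<beta> p\<bar> \<le> 1"
    and s: "0 < s" "s \<le> s'" "s' \<le> 1" and a: "0 \<le> a" and \<epsilon>: "0 < \<epsilon>" "a + \<epsilon> \<le> 1"
    and c: "0 < c" "\<And>k. \<bar>x' $ k - x $ k\<bar> \<le> c" "s' - s \<le> c\<^sup>2"
    and \<tau>: "0 \<le> \<tau>" "\<tau> < 1" and l: "l = sqrt (\<epsilon> * s) / (100 * c)" and N: "N \<ge> 2" "324 * l\<^sup>2 \<le> real N" "2 * l \<le> real N"
  defines "g \<equiv> \<lambda>t \<omega>. \<beta> (t, x' + W (s', a + \<epsilon> * t) \<omega>) - \<beta> (t, x + W (s, a + \<epsilon> * t) \<omega>)"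
  shows "(\<integral>\<^sup>+\<omega>. ennreal (exp (l / real CARD('d) * \<bar>(\<Sum>i<N. g ((real i + \<tau>) / real N) \<omega>) / real N\<bar>)) \<partial>M) \<le> 24"
proof -
  define d where "d = CARD('d)"
  have d: "d > 0" by (simp add: d_def)
  define n where "n = N - 1"
  have Nn: "N = Suc n" using N by (simp add: n_def)
  obtain e where e: "bij_betw e {..<d} (UNIV :: 'd set)"
    using ex_bij_betw_nat_finite[of "UNIV :: 'd set"] by (auto simp: d_def atLeast0LessThan)
  define A where "A m = e ` {..<m}" for m
  have A0: "A 0 = {}" and Ad: "A d = UNIV" using e by (auto simp: A_def bij_betw_def)
  have AS: "A (Suc m) = insert (e m) (A m)" for m by (auto simp: A_def lessThan_Suc)
  have eA: "e m \<notin> A m" if "m < d" for m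
  proof
    assume "e m \<in> A m"
    then obtain j where "j < m" "e m = e j" by (auto simp: A_def)
    then show False using e that by (auto simp: bij_betw_def dest: inj_onD[of e _ m j])
  qed
  define t where "t i = (real (Suc i) + \<tau>) / real N" for i
  define H where "H B i \<omega> = hybrid W s s' x x' B (a + \<epsilon> * t i) \<omega>" for B i \<omega>
  have l0: "l \<ge> 0" using c \<epsilon> s by (simp add: l)
  define B where "B m \<omega> = (\<Sum>i<n. l / real N * (\<beta> (t i, H (A (Suc m)) i \<omega>) - \<beta> (t i, H (A m) i \<omega>))) / real d" for m \<omega>
  have tele: "(\<Sum>m<d. B m \<omega>) = l / real d * ((\<Sum>i<n. g (t i) \<omega>) / real N)" for \<omega>
  proof -
    have "(\<Sum>m<d. B m \<omega>) = (\<Sum>i<n. \<Sum>m<d. l / real N * (\<beta> (t i, H (A (Suc m)) i \<omega>) - \<beta> (t i, H (A m) i \<omega>))) / real d"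
      unfolding B_def sum_divide_distrib by (rule sum.swap)
    also have "\<dots> = (\<Sum>i<n. l / real N * (\<beta> (t i, H (A d) i \<omega>) - \<beta> (t i, H (A 0) i \<omega>))) / real d"
      by (simp only: sum_distrib_left [symmetric] sum_lessThan_telescope[of "\<lambda>m. \<beta> (t _, H (A m) _ \<omega>)"])
    also have "\<dots> = (\<Sum>i<n. l / real N * g (t i) \<omega>) / real d"
    proof -
      have "H (A d) i \<omega> = x' + W (s', a + \<epsilon> * t i) \<omega>" "H (A 0) i \<omega> = x + W (s, a + \<epsilon> * t i) \<omega>" for i
        by (simp_all add: H_def A0 Ad hybrid_def vec_eq_iff)
      then show ?thesis by (simp add: g_def)
    qed
    finally show ?thesis by (simp add: sum_distrib_left sum_divide_distrib mult_ac)
  qed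
  have g2: "\<bar>g u \<omega>\<bar> \<le> 2" for u \<omega>
    using \<beta>(2)[of "(u, x' + W (s', a + \<epsilon> * u) \<omega>)"] \<beta>(2)[of "(u, x + W (s, a + \<epsilon> * u) \<omega>)"] unfolding g_def by linarith
  define R where "R \<omega> = l / real d * \<bar>(\<Sum>i<N. g ((real i + \<tau>) / real N) \<omega>) / real N\<bar>" for \<omega>
  have pt: "exp (R \<omega>)
     \<le> 3 * ((\<Sum>m<d. exp (real d * B m \<omega>) + exp (- real d * B m \<omega>)) / real d)" for \<omega>
  proof -
    \<comment> \<open>The first grid point has no predecessor in the grid; its term is at most \<open>2 / N\<close> in modulus.\<close>
    have "(\<Sum>i<N. g ((real i + \<tau>) / real N) \<omega>) = g (\<tau> / real N) \<omega> + (\<Sum>i<n. g (t i) \<omega>)"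
      unfolding Nn sum.lessThan_Suc_shift by (simp add: t_def Nn)
    then have "\<bar>(\<Sum>i<N. g ((real i + \<tau>) / real N) \<omega>) / real N\<bar> \<le> \<bar>g (\<tau> / real N) \<omega> / real N\<bar> + \<bar>(\<Sum>i<n. g (t i) \<omega>) / real N\<bar>"
      by (simp only: add_divide_distrib abs_triangle_ineq)
    also have "\<dots> \<le> 2 / real N + \<bar>(\<Sum>i<n. g (t i) \<omega>) / real N\<bar>"
      using g2 by (simp add: divide_right_mono)
    finally have "R \<omega> \<le> l / real d * (2 / real N + \<bar>(\<Sum>i<n. g (t i) \<omega>) / real N\<bar>)"
      unfolding R_def using l0 by (intro mult_left_mono) auto
    also have "\<dots> = l / real d * (2 / real N) + \<bar>\<Sum>m<d. B m \<omega>\<bar>"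
      unfolding tele using l0 by (simp add: distrib_left abs_mult)
    also have "l / real d * (2 / real N) \<le> 1"
    proof -
      have "l / real d * (2 / real N) \<le> l * (2 / real N)"
        using l0 d by (intro mult_right_mono) (auto simp: divide_le_eq mult_le_cancel_left1)
      also have "\<dots> \<le> 1" using N by (simp add: divide_le_eq)
      finally show ?thesis .
    qed
    finally have "exp (R \<omega>) \<le> exp 1 * exp \<bar>\<Sum>m<d. B m \<omega>\<bar>"
      by (simp add: exp_add [symmetric])
    also have "\<dots> \<le> 3 * ((\<Sum>m<d. exp (real d * B m \<omega>) + exp (- real d * B m \<omega>)) / real d)"
      by (intro mult_mono exp_le exp_abs_sum_le d) auto
    finally show ?thesis .
  qed
  define D where "D \<gamma> m \<omega> = (\<Sum>i<N - 1. l / real N * (\<gamma> (t i, hybrid W s s' x x' (insert (e m) (A m)) (a + \<epsilon> * t i) \<omega>)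
      - \<gamma> (t i, hybrid W s s' x x' (A m) (a + \<epsilon> * t i) \<omega>)))" for \<gamma> m \<omega>
  have eq: "real d * B m \<omega> = D \<beta> m \<omega>" "- real d * B m \<omega> = D (\<lambda>p. - \<beta> p) m \<omega>" for m \<omega>
  proof -
    show *: "real d * B m \<omega> = D \<beta> m \<omega>"
      unfolding B_def D_def using d by (simp add: AS H_def n_def)
    have "- D \<beta> m \<omega> = D (\<lambda>p. - \<beta> p) m \<omega>"
      unfolding D_def sum_negf [symmetric] by (intro sum.cong) (auto simp: algebra_simps)
    with * show "- real d * B m \<omega> = D (\<lambda>p. - \<beta> p) m \<omega>" by simp
  qed
  have m\<beta>: "(\<lambda>p. - \<beta> p) \<in> borel_measurable borel" using \<beta>(1) by simp
  have b1: "(\<integral>\<^sup>+\<omega>. ennreal (exp (real d * B m \<omega>)) \<partial>M) \<le> 4" if "m < d" for m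
    unfolding eq D_def t_def by (rule hybrid_exp_moment_le[OF W \<beta> s a \<epsilon> c(1,2,3) \<tau>(1) _ N(1) l N(2) eA[OF that]]) (use \<tau> in simp)
  have b2: "(\<integral>\<^sup>+\<omega>. ennreal (exp (- real d * B m \<omega>)) \<partial>M) \<le> 4" if "m < d" for m
    unfolding eq D_def t_def by (rule hybrid_exp_moment_le[OF W m\<beta> _ s a \<epsilon> c(1,2,3) \<tau>(1) _ N(1) l N(2) eA[OF that]]) (use \<tau> \<beta> in simp_all)
  have Bmeas: "B m \<in> borel_measurable M" for m
  proof -
    have "H S i \<in> borel_measurable M" if i: "i < n" for S i
    proof -
      have t01: "0 \<le> t i" "t i \<le> 1" using \<tau> i by (auto simp: t_def Nn divide_le_eq)
      then have "\<epsilon> * t i \<le> \<epsilon>" "0 \<le> \<epsilon> * t i" using \<epsilon> mult_left_mono[of "t i" 1 \<epsilon>] by auto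
      then have "0 \<le> a + \<epsilon> * t i" "a + \<epsilon> * t i \<le> 1" using a \<epsilon>(2) by linarith+
      then have p: "(s, a + \<epsilon> * t i) \<in> unit_square" "(s', a + \<epsilon> * t i) \<in> unit_square" using s by auto
      show ?thesis unfolding H_def[abs_def] hybrid_def
      proof (rule borel_measurable_vec_lambda)
        note [measurable] = component_measurable[OF W p(1)] component_measurable[OF W p(2)]
        show "(\<lambda>\<omega>. if j \<in> S then x' $ j + W (s', a + \<epsilon> * t i) \<omega> $ j else x $ j + W (s, a + \<epsilon> * t i) \<omega> $ j) \<in> borel_measurable M" for j
          by simp
      qed
    qed
    note H = this
    have "(\<lambda>\<omega>. l / real N * (\<beta> (t i, H (A (Suc m)) i \<omega>) - \<beta> (t i, H (A m) i \<omega>))) \<in> borel_measurable M" if "i < n" for i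
    proof -
      note [measurable] = H[OF that] \<beta>(1)
      show ?thesis by measurable
    qed
    then show ?thesis unfolding B_def[abs_def] by (intro borel_measurable_divide borel_measurable_sum) auto
  qed
  note [measurable] = Bmeas
  have "(\<integral>\<^sup>+\<omega>. ennreal (exp (R \<omega>)) \<partial>M)
     \<le> (\<integral>\<^sup>+\<omega>. ennreal (3 / real d) * (\<Sum>m<d. ennreal (exp (real d * B m \<omega>)) + ennreal (exp (- real d * B m \<omega>))) \<partial>M)"
  proof (rule nn_integral_mono)
    fix \<omega>
    have "ennreal (exp (R \<omega>))
      \<le> ennreal (3 / real d * (\<Sum>m<d. exp (real d * B m \<omega>) + exp (- real d * B m \<omega>)))"
      using pt[of \<omega>] by (intro ennreal_leI) simp
    also have "\<dots> = ennreal (3 / real d) * ennreal (\<Sum>m<d. exp (real d * B m \<omega>) + exp (- real d * B m \<omega>))"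
      by (rule ennreal_mult') simp
    also have "ennreal (\<Sum>m<d. exp (real d * B m \<omega>) + exp (- real d * B m \<omega>)) = (\<Sum>m<d. ennreal (exp (real d * B m \<omega>) + exp (- real d * B m \<omega>)))"
      by (rule sum_ennreal [symmetric]) (simp add: add_nonneg_nonneg)
    also have "\<dots> = (\<Sum>m<d. ennreal (exp (real d * B m \<omega>)) + ennreal (exp (- real d * B m \<omega>)))"
      by (simp add: ennreal_plus)
    finally show "ennreal (exp (R \<omega>))
      \<le> ennreal (3 / real d) * (\<Sum>m<d. ennreal (exp (real d * B m \<omega>)) + ennreal (exp (- real d * B m \<omega>)))" .
  qed
  also have "\<dots> = ennreal (3 / real d) * (\<Sum>m<d. (\<integral>\<^sup>+\<omega>. ennreal (exp (real d * B m \<omega>)) \<partial>M) + (\<integral>\<^sup>+\<omega>. ennreal (exp (- real d * B m \<omega>)) \<partial>M))"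
    by (subst nn_integral_cmult, simp, subst nn_integral_sum) (simp_all add: nn_integral_add)
  also have "\<dots> \<le> ennreal (3 / real d) * (\<Sum>m<d. 4 + 4)"
    by (intro mult_left_mono sum_mono add_mono b1 b2) auto
  also have "\<dots> = ennreal (3 / real d) * ennreal (real d * 8)"
    by (simp add: ennreal_of_nat_eq_real_of_nat ennreal_mult)
  also have "\<dots> = ennreal (3 / real d * (real d * 8))" by (rule ennreal_mult' [symmetric]) simp
  also have "3 / real d * (real d * 8) = 24" using d by simp
  finally show ?thesis by (simp add: R_def d_def)
qed

text \<open>
  Passage from the grids to the time integral, by Jensen and Fubini. The number \<open>N\<close> of cells may depend on all
  parameters, since the bound for the grid sums does not.
\<close>

lemma time_integral_exp_moment_le:
  fixes \<beta> :: "real \<times> (real ^ 'd) \<Rightarrow> real" and x x' :: "real ^ 'd"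
  assumes \<beta>: "\<beta> \<in> borel_measurable borel" "\<And>p. \<bar>\<beta> p\<bar> \<le> 1" and \<beta>0: "\<And>t v. t \<notin> {0..1} \<Longrightarrow> \<beta> (t, v) = 0"
    and s: "0 < s" "s \<le> s'" "s' \<le> 1" and a: "0 \<le> a" and \<epsilon>: "0 < \<epsilon>" "a + \<epsilon> \<le> 1"
    and c: "0 < c" "\<And>k. \<bar>x' $ k - x $ k\<bar> \<le> c" "s' - s \<le> c\<^sup>2"
    and l: "l = sqrt (\<epsilon> * s) / (100 * c)"
  defines "g \<equiv> \<lambda>t \<omega>. \<beta> (t, x' + W (s', a + \<epsilon> * t) \<omega>) - \<beta> (t, x + W (s, a + \<epsilon> * t) \<omega>)"
  shows "(\<lambda>\<omega>. LINT t:{0..1}|lborel. g t \<omega>) \<in> borel_measurable M"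
    and "(\<integral>\<^sup>+\<omega>. ennreal (exp (l / real CARD('d) * \<bar>LINT t:{0..1}|lborel. g t \<omega>\<bar>)) \<partial>M) \<le> 24"
proof -
  \<comment> \<open>Times are clamped to the unit interval because nothing is known about the sheet outside the square.\<close>
  define p where "p t = max 0 (min 1 t)" for t :: real
  have p: "0 \<le> a + \<epsilon> * p t" "a + \<epsilon> * p t \<le> 1" for t
  proof -
    have "0 \<le> p t" "p t \<le> 1" by (auto simp: p_def)
    then have "0 \<le> \<epsilon> * p t" "\<epsilon> * p t \<le> \<epsilon>" using \<epsilon> mult_left_mono[of "p t" 1 \<epsilon>] by auto
    then show "0 \<le> a + \<epsilon> * p t" "a + \<epsilon> * p t \<le> 1" using a \<epsilon>(2) by linarith+
  qed
  have path: "(\<lambda>(t, \<omega>). W (r, a + \<epsilon> * p t) \<omega>) \<in> borel_measurable (borel \<Otimes>\<^sub>M M)" if r: "r \<in> {0..1}" for r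
  proof (rule jointly_measurable_of_continuous)
    show "W (r, a + \<epsilon> * p t) \<in> borel_measurable M" for t using r p[of t] by (intro sheet_measurable) auto
    show "continuous_on UNIV (\<lambda>t. W (r, a + \<epsilon> * p t) \<omega>)" if "\<omega> \<in> space M" for \<omega>
      unfolding p_def
      by (rule continuous_on_compose2[OF sheet_continuous[OF that]])
         (use r p in \<open>auto intro!: continuous_intros simp: p_def\<close>)
  qed
  have s01: "s \<in> {0..1}" "s' \<in> {0..1}" using s by auto
  define V where "V r u = W (r, a + \<epsilon> * p (fst u)) (snd u)" for r u
  have [measurable]: "V s \<in> borel_measurable (borel \<Otimes>\<^sub>M M)" "V s' \<in> borel_measurable (borel \<Otimes>\<^sub>M M)"
    using path[OF s01(1)] path[OF s01(2)] by (simp_all add: V_def[abs_def] case_prod_beta')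
  have g_eq: "g t \<omega> = \<beta> (t, x' + V s' (t, \<omega>)) - \<beta> (t, x + V s (t, \<omega>))" for t \<omega>
  proof (cases "t \<in> {0..1}")
    case True
    then have "p t = t" by (auto simp: p_def)
    then show ?thesis by (simp add: g_def V_def)
  next
    case False
    then show ?thesis by (simp add: g_def \<beta>0)
  qed
  have gm: "(\<lambda>(t, \<omega>). g t \<omega>) \<in> borel_measurable (borel \<Otimes>\<^sub>M M)"
  proof -
    note [measurable] = \<beta>(1)
    have "(\<lambda>u. \<beta> (fst u, x' + V s' u) - \<beta> (fst u, x + V s u)) \<in> borel_measurable (borel \<Otimes>\<^sub>M M)"
      by measurable
    then show ?thesis by (simp add: g_eq case_prod_beta')
  qed
  have gm' [measurable]: "(\<lambda>u. g (f u) (h u)) \<in> borel_measurable K"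
    if [measurable]: "f \<in> borel_measurable K" "h \<in> K \<rightarrow>\<^sub>M M" for f h and K :: "'z measure"
    using measurable_compose[OF _ gm, of "\<lambda>u. (f u, h u)" K] by simp
  show "(\<lambda>\<omega>. LINT t:{0..1}|lborel. g t \<omega>) \<in> borel_measurable M"
    unfolding set_lebesgue_integral_def by measurable
  have gt: "(\<lambda>t. g t \<omega>) \<in> borel_measurable borel" if "\<omega> \<in> space M" for \<omega>
    using that by (intro gm') auto
  have g2: "\<bar>g u \<omega>\<bar> \<le> 2" for u \<omega>
    using \<beta>(2)[of "(u, x' + W (s', a + \<epsilon> * u) \<omega>)"] \<beta>(2)[of "(u, x + W (s, a + \<epsilon> * u) \<omega>)"] unfolding g_def by linarith
  have l0: "l \<ge> 0" using c \<epsilon> s by (simp add: l)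
  define N where "N = nat \<lceil>2 + 324 * l\<^sup>2 + 2 * l\<rceil>"
  have "2 + 324 * l\<^sup>2 + 2 * l \<le> real N" unfolding N_def by linarith
  then have "2 \<le> real N" "324 * l\<^sup>2 \<le> real N" "2 * l \<le> real N"
    using l0 zero_le_power2[of l] by linarith+
  then have N: "N \<ge> 2" "324 * l\<^sup>2 \<le> real N" "2 * l \<le> real N" by auto
  define G where "G \<omega> \<tau> = ennreal (exp (l / real CARD('d) * \<bar>(\<Sum>i<N. g ((real i + \<tau>) / real N) \<omega>) / real N\<bar>))" for \<omega> \<tau>
  have Gm: "(\<lambda>(\<tau>, \<omega>). G \<omega> \<tau> * indicator {0..<1} \<tau>) \<in> borel_measurable (lborel \<Otimes>\<^sub>M M)"
    unfolding G_def by measurable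
  interpret PS: pair_sigma_finite lborel M ..
  have "(\<integral>\<^sup>+\<omega>. ennreal (exp (l / real CARD('d) * \<bar>LINT t:{0..1}|lborel. g t \<omega>\<bar>)) \<partial>M)
     \<le> (\<integral>\<^sup>+\<omega>. (\<integral>\<^sup>+\<tau>. G \<omega> \<tau> * indicator {0..<1} \<tau> \<partial>lborel) \<partial>M)"
    unfolding G_def using N l0 by (intro nn_integral_mono exp_integral_le_average[OF gt g2]) auto
  also have "\<dots> = (\<integral>\<^sup>+\<tau>. (\<integral>\<^sup>+\<omega>. G \<omega> \<tau> * indicator {0..<1} \<tau> \<partial>M) \<partial>lborel)"
    using PS.Fubini[OF Gm] by simp
  also have "\<dots> \<le> (\<integral>\<^sup>+\<tau>. 24 * indicator {0..<1::real} \<tau> \<partial>lborel)"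
  proof (rule nn_integral_mono)
    fix \<tau> :: real
    show "(\<integral>\<^sup>+\<omega>. G \<omega> \<tau> * indicator {0..<1} \<tau> \<partial>M) \<le> 24 * indicator {0..<1} \<tau>"
    proof (cases "\<tau> \<in> {0..<1}")
      case True
      then show ?thesis
        using grid_exp_moment_le[OF \<beta> s a \<epsilon> c _ _ l N, of \<tau>] by (simp add: G_def g_def)
    qed simp
  qed
  also have "\<dots> = 24" by (simp add: nn_integral_cmult_indicator)
  finally show "(\<integral>\<^sup>+\<omega>. ennreal (exp (l / real CARD('d) * \<bar>LINT t:{0..1}|lborel. g t \<omega>\<bar>)) \<partial>M) \<le> 24" .
qed

end
end

theorem corollary3p2:
  fixes M :: "'a measure"
    and W :: "real \<times> real \<Rightarrow> 'a \<Rightarrow> real ^ 'd"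
    and b :: "real \<Rightarrow> real \<Rightarrow> real ^ 'd \<Rightarrow> real"
  assumes "prob_space M"
    and "brownian_sheet M W"
    and "(\<lambda>(s, t, x). b s t x) \<in> borel_measurable (restrict_space borel ({0..1} \<times> {0..1} \<times> UNIV))"
    and "\<And>s t x. s \<in> {0..1} \<Longrightarrow> t \<in> {0..1} \<Longrightarrow> \<bar>b s t x\<bar> \<le> 1"
  shows "\<exists>\<alpha> C. \<alpha> > 0 \<and> C > 0 \<and>
    (\<forall>a \<epsilon> s s' x x'.
       a \<in> {0..1} \<longrightarrow> \<epsilon> \<in> {0<..<1} \<longrightarrow> a + \<epsilon> \<le> 1 \<longrightarrow>
       s \<in> {0<..1} \<longrightarrow> s' \<in> {0<..1} \<longrightarrow> s \<le> s' \<longrightarrow> (s, x) \<noteq> (s', x') \<longrightarrow>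
       (let Z = (\<lambda>\<omega>. exp (\<alpha> * sqrt (\<epsilon> * s) / (infnorm (x' - x) + sqrt (s' - s)) *
                  \<bar>LINT t:{0..1}|lborel.
                     b s t (x' + rescaled_sheet W a \<epsilon> s' t \<omega>) -
                     b s t (x + rescaled_sheet W a \<epsilon> s t \<omega>)\<bar>))
        in integrable M Z \<and> prob_space.expectation M Z \<le> C))"
proof -
  interpret prob_space M by fact
  \<comment> \<open>The dimension enters through the convexity bound for the sum over the coordinates.\<close>
  define \<alpha> where "\<alpha> = 1 / (100 * real CARD('d))"
  let ?Z = "\<lambda>a \<epsilon> s s' x x' \<omega>. exp (\<alpha> * sqrt (\<epsilon> * s) / (infnorm (x' - x) + sqrt (s' - s)) *
                  \<bar>LINT t:{0..1}|lborel. b s t (x' + rescaled_sheet W a \<epsilon> s' t \<omega>) - b s t (x + rescaled_sheet W a \<epsilon> s t \<omega>)\<bar>)"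
  have main: "integrable M (\<lambda>\<omega>. ?Z a \<epsilon> s s' x x' \<omega>) \<and> expectation (\<lambda>\<omega>. ?Z a \<epsilon> s s' x x' \<omega>) \<le> 24"
    if a: "a \<in> {0..1}" and \<epsilon>: "\<epsilon> \<in> {0<..<1}" "a + \<epsilon> \<le> 1" and s: "s \<in> {0<..1}" "s' \<in> {0<..1}" "s \<le> s'" and ne: "(s, x) \<noteq> (s', x')"
    for a \<epsilon> s s' and x x' :: "real ^ 'd"
  proof -
    define c where "c = infnorm (x' - x) + sqrt (s' - s)"
    have c0: "c > 0"
    proof (cases "s = s'")
      case True
      then have "x' - x \<noteq> 0" using ne by auto
      then show ?thesis using True by (simp add: c_def infnorm_pos_lt)
    next
      case False
      then show ?thesis using s infnorm_pos_le[of "x' - x"] by (simp add: c_def add_nonneg_pos)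
    qed
    have cx: "\<bar>x' $ k - x $ k\<bar> \<le> c" for k
      using component_le_infnorm_cart[of "x' - x" k] s by (simp add: c_def add_increasing2)
    have cs: "s' - s \<le> c\<^sup>2"
    proof -
      have "(sqrt (s' - s))\<^sup>2 \<le> c\<^sup>2" using s infnorm_pos_le[of "x' - x"] by (intro power_mono) (auto simp: c_def)
      then show ?thesis using s by simp
    qed
    \<comment> \<open>The coefficient at the fixed level \<open>s\<close>, extended by zero to all times.\<close>
    define \<beta> where "\<beta> = (\<lambda>(t, v). if t \<in> {0..1} then b s t v else 0)"
    have \<beta>m: "\<beta> \<in> borel_measurable borel"
    proof -
      have "(\<lambda>p. indicator ({0..1} \<times> {0..1} \<times> UNIV) p *\<^sub>R (\<lambda>(s, t, x). b s t x) p) \<in> borel_measurable borel"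
        using assms(3) by (subst borel_measurable_restrict_space_iff [symmetric]) (auto intro!: borel_closed closed_Times)
      moreover have "(\<lambda>p. (s, p)) \<in> (borel :: (real \<times> (real ^ 'd)) measure) \<rightarrow>\<^sub>M borel"
        by (intro borel_measurable_continuous_onI continuous_intros)
      ultimately have "(\<lambda>p. indicator ({0..1} \<times> {0..1} \<times> UNIV) (s, p) *\<^sub>R (\<lambda>(s, t, x). b s t x) (s, p)) \<in> borel_measurable borel"
        by (rule measurable_compose[rotated])
      also have "(\<lambda>p. indicator ({0..1} \<times> {0..1} \<times> UNIV) (s, p) *\<^sub>R (\<lambda>(s, t, x). b s t x) (s, p)) = \<beta>"
        using s by (auto simp: \<beta>_def fun_eq_iff split: split_indicator)
      finally show ?thesis .
    qed
    have \<beta>1: "\<bar>\<beta> p\<bar> \<le> 1" for p using assms(4) s by (auto simp: \<beta>_def split: prod.split)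
    define I where "I \<omega> = (LINT t:{0..1}|lborel. \<beta> (t, x' + W (s', a + \<epsilon> * t) \<omega>) - \<beta> (t, x + W (s, a + \<epsilon> * t) \<omega>))" for \<omega>
    have I: "(LINT t:{0..1}|lborel. b s t (x' + rescaled_sheet W a \<epsilon> s' t \<omega>) - b s t (x + rescaled_sheet W a \<epsilon> s t \<omega>)) = I \<omega>" for \<omega>
      unfolding I_def by (rule set_lebesgue_integral_cong) (auto simp: \<beta>_def rescaled_sheet_def)
    let ?E = "\<lambda>\<omega>. exp (\<alpha> * sqrt (\<epsilon> * s) / c * \<bar>I \<omega>\<bar>)"
    have coef: "\<alpha> * sqrt (\<epsilon> * s) / c = sqrt (\<epsilon> * s) / (100 * c) / real CARD('d)"
      by (simp add: \<alpha>_def mult_ac)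
    have Im: "I \<in> borel_measurable M"
      and Ib: "(\<integral>\<^sup>+\<omega>. ennreal (?E \<omega>) \<partial>M) \<le> 24"
      unfolding I_def[abs_def] coef
      by (intro time_integral_exp_moment_le[OF assms(2) \<beta>m \<beta>1 _ _ _ _ _ _ _ c0 cx cs refl]; use s a \<epsilon> in \<open>auto simp: \<beta>_def\<close>)+
    have int: "integrable M (\<lambda>\<omega>. ?E \<omega>)"
      using Im le_less_trans[OF Ib] by (intro integrableI_nonneg) auto
    have "ennreal (expectation (\<lambda>\<omega>. ?E \<omega>)) \<le> ennreal 24"
      using Ib by (subst nn_integral_eq_integral [symmetric, OF int]) auto
    then have "expectation (\<lambda>\<omega>. ?E \<omega>) \<le> 24"
      by (subst (asm) ennreal_le_iff) auto
    with int show ?thesis unfolding I c_def[symmetric] by simp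
  qed
  have "\<alpha> > 0" by (simp add: \<alpha>_def)
  then show ?thesis
    unfolding Let_def using main by (intro exI[of _ \<alpha>] exI[of _ 24]) simp
qed

end
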